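(* Let $\mathcal F$ be a family of bipartite graphs which contains all paths. It is NP-hard to decide whether a given degree sequence $d$ admits a multigraph realization whose underlying graph is in $\mathcal F$.
   Context: A degree sequence is a non-increasing sequence of positive integers with even sum. A multigraph realization of $d$ is a loopless multigraph (parallel edges allowed, no self-loops) whose degree sequence is $d$; its underlying graph is the simple graph obtained by keeping one copy of each edge. *)

theory Defs
  imports "HOL-Library.Multiset" "HOL-Computational_Algebra.Polynomial"
begin

section \<open>Multigraphs and underlying graphs\<close>

record 'a sgraph =
  verts :: "'a set"
  edges :: "'a set set"

definition simple_graph :: "'a sgraph \<Rightarrow> bool" where
  "simple_graph G \<longleftrightarrow> finite (verts G) \<and> (\<forall>e\<in>edges G. e \<subseteq> verts G \<and> card e = 2)"

definition bipartite :: "'a sgraph \<Rightarrow> bool" where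
  "bipartite G \<longleftrightarrow> (\<exists>A B. A \<union> B = verts G \<and> A \<inter> B = {} \<and>
     (\<forall>e\<in>edges G. \<exists>a\<in>A. \<exists>b\<in>B. e = {a, b}))"

definition is_path :: "'a sgraph \<Rightarrow> bool" where
  "is_path G \<longleftrightarrow> (\<exists>vs. vs \<noteq> [] \<and> distinct vs \<and> verts G = set vs \<and>
     edges G = {{vs ! i, vs ! Suc i} | i. Suc i < length vs})"

record 'a multigraph =
  mverts :: "'a set"
  medges :: "'a set multiset"

definition loopless_multigraph :: "'a multigraph \<Rightarrow> bool" where
  "loopless_multigraph H \<longleftrightarrow>
     finite (mverts H) \<and> (\<forall>e\<in>#medges H. e \<subseteq> mverts H \<and> card e = 2)"

definition mdegree :: "'a multigraph \<Rightarrow> 'a \<Rightarrow> nat" where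
  "mdegree H v = size {#e \<in># medges H. v \<in> e#}"

definition degrees :: "'a multigraph \<Rightarrow> nat list" where
  "degrees H = rev (sorted_list_of_multiset (image_mset (mdegree H) (mset_set (mverts H))))"

definition underlying :: "'a multigraph \<Rightarrow> 'a sgraph" where
  "underlying H = \<lparr>verts = mverts H, edges = set_mset (medges H)\<rparr>"

definition degree_sequence :: "nat list \<Rightarrow> bool" where
  "degree_sequence d \<longleftrightarrow> sorted_wrt (\<ge>) d \<and> (\<forall>x\<in>set d. 0 < x) \<and> even (sum_list d)"

definition realization :: "'a multigraph \<Rightarrow> nat list \<Rightarrow> bool" where
  "realization H d \<longleftrightarrow> loopless_multigraph H \<and> degrees H = d"


section \<open>Multi-tape Turing machines\<close>

text \<open>
  States are \<open>0, \<dots>, n_states - 1\<close> with start state \<open>0\<close>; tape symbols are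
  \<open>0, \<dots>, n_symbols - 1\<close>, where \<open>0\<close> is the blank and \<open>1\<close>, \<open>2\<close> are the bits
  \<open>False\<close>, \<open>True\<close>. An element \<open>(q, ss, q', as)\<close> of \<open>delta\<close> says that in state \<open>q\<close>,
  when \<open>ss ! j\<close> is scanned on the \<open>j\<close>-th tape, the machine may change to state \<open>q'\<close> and
  perform the action \<open>as ! j\<close> (write a symbol, then move) on the \<open>j\<close>-th tape.
\<close>

datatype move = Go_Left | Stay | Go_Right

record tm =
  n_tapes :: nat
  n_symbols :: nat
  n_states :: nat
  accepting :: "nat set"
  delta :: "(nat \<times> nat list \<times> nat \<times> (nat \<times> move) list) set"

definition turing_machine :: "tm \<Rightarrow> bool" where
  "turing_machine M \<longleftrightarrow> 1 \<le> n_tapes M \<and> 3 \<le> n_symbols M \<and> 1 \<le> n_states M \<and>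
     (\<forall>(q, ss, q', as)\<in>delta M.
        q < n_states M \<and> length ss = n_tapes M \<and> (\<forall>s\<in>set ss. s < n_symbols M) \<and>
        q' < n_states M \<and> length as = n_tapes M \<and> (\<forall>(s, m)\<in>set as. s < n_symbols M))"

definition deterministic :: "tm \<Rightarrow> bool" where
  "deterministic M \<longleftrightarrow> (\<forall>q ss r r'. (q, ss, r) \<in> delta M \<and> (q, ss, r') \<in> delta M \<longrightarrow> r = r')"

text \<open>A tape, infinite in both directions, is given by its head position and its contents.\<close>

type_synonym tape = "int \<times> (int \<Rightarrow> nat)"

type_synonym config = "nat \<times> tape list"

fun scan :: "tape \<Rightarrow> nat" where
  "scan (h, t) = t h"

fun offset :: "move \<Rightarrow> int" where
  "offset Go_Left = -1"
| "offset Stay = 0"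
| "offset Go_Right = 1"

fun act :: "nat \<times> move \<Rightarrow> tape \<Rightarrow> tape" where
  "act (s, m) (h, t) = (h + offset m, t(h := s))"

definition step :: "tm \<Rightarrow> config \<Rightarrow> config \<Rightarrow> bool" where
  "step M c c' \<longleftrightarrow> (\<exists>as. (fst c, map scan (snd c), fst c', as) \<in> delta M \<and>
     snd c' = map2 act as (snd c))"

definition halted :: "tm \<Rightarrow> config \<Rightarrow> bool" where
  "halted M c \<longleftrightarrow> (\<nexists>c'. step M c c')"

definition bit_symbol :: "bool \<Rightarrow> nat" where
  "bit_symbol b = (if b then 2 else 1)"

definition input_tape :: "bool list \<Rightarrow> tape" where
  "input_tape x =
     (0, \<lambda>i. if 0 \<le> i \<and> i < int (length x) then bit_symbol (x ! nat i) else 0)"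

definition initial :: "tm \<Rightarrow> bool list \<Rightarrow> config" where
  "initial M x = (0, input_tape x # replicate (n_tapes M - 1) (input_tape []))"

text \<open>The output is read off the last tape, from cell \<open>0\<close> up to the first blank.\<close>

definition has_output :: "config \<Rightarrow> bool list \<Rightarrow> bool" where
  "has_output c y \<longleftrightarrow> (let t = snd (last (snd c)) in
     (\<forall>i<length y. t (int i) = bit_symbol (y ! i)) \<and> t (int (length y)) = 0)"


section \<open>NP-hardness\<close>

definition polytime_computable :: "(bool list \<Rightarrow> bool list) \<Rightarrow> bool" where
  "polytime_computable f \<longleftrightarrow> (\<exists>M (p :: nat poly). turing_machine M \<and> deterministic M \<and>
     (\<forall>x. \<exists>n c. n \<le> poly p (length x) \<and> (step M ^^ n) (initial M x) c \<and>
        halted M c \<and> has_output c (f x)))"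

definition NP :: "bool list set set" where
  "NP = {L. \<exists>M (p :: nat poly). turing_machine M \<and>
     (\<forall>x n c. (step M ^^ n) (initial M x) c \<longrightarrow> n \<le> poly p (length x)) \<and>
     (\<forall>x. x \<in> L \<longleftrightarrow>
        (\<exists>n c. (step M ^^ n) (initial M x) c \<and> halted M c \<and> fst c \<in> accepting M))}"

text \<open>
  A decision problem is given by an encoding of instances, the set \<open>I\<close> of instances and the
  property \<open>P\<close> to be decided; a reduction must produce instances in \<open>I\<close>, also for inputs
  outside the reduced language.
\<close>

definition NP_hard :: "('i \<Rightarrow> bool list) \<Rightarrow> 'i set \<Rightarrow> ('i \<Rightarrow> bool) \<Rightarrow> bool" where
  "NP_hard enc I P \<longleftrightarrow> (\<forall>L\<in>NP. \<exists>f. polytime_computable (\<lambda>x. enc (f x)) \<and>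
     (\<forall>x. f x \<in> I \<and> (x \<in> L \<longleftrightarrow> P (f x))))"

text \<open>
  Numbers are encoded in binary, least significant bit first. In a sequence each bit is
  preceded by \<open>True\<close> and each number is followed by \<open>False\<close>, so that the code is uniquely
  decodable.
\<close>

fun bits :: "nat \<Rightarrow> bool list" where
  "bits n = (if n = 0 then [] else odd n # bits (n div 2))"

declare bits.simps [simp del]

definition encode_nat :: "nat \<Rightarrow> bool list" where
  "encode_nat n = concat (map (\<lambda>b. [True, b]) (bits n)) @ [False]"

definition encode_seq :: "nat list \<Rightarrow> bool list" where
  "encode_seq d = concat (map encode_nat d)"

end

(* Let a nondeterministic machine decide L. A computation on x is a table whose rows are configurations,
with the tape contents shifted so that the heads stay in a fixed column; then a row is determined by the row
below and one transition, which is broadcast along the row. Hence x is in L iff a helical strip of cells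
(cell c borders on c + 1 and on c + W) can be filled with coloured tiles from a finite set depending on L only.

Placing tile t on cell c is a number, written in a fixed base, whose digits contribute a colour to the
borders of the cell; two tiles match iff their digits on the common border sum up to a constant. So
the tilings are the subsets of the numbers with a prescribed sum. Two further numbers turn this into a partition into halves of equal
sum, and zeros with a common huge leading digit turn it into one into halves of equal sum and size.

A bipartite realization splits the degrees into halves of equal sum. Conversely, halves x and y of equal
sum and size that alternate along a path determine the multiplicities of its edges, and these are positive
because one of the y dominates all small parts and is put first.

The reduction is a program with nested loops over unary registers whose total length does not grow inside
these loops, which bounds its running time by a polynomial. *)

theory Submission
  imports Defs "HOL-Library.Countable"
begin

section \<open>Path multigraphs\<close>

text \<open>The family enters through two facts, which form a sandwich: a bipartite realization
  yields halves of equal sum, and a tiling yields halves that alternate along a path. Bipartiteness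
  says nothing about the sizes of the halves, whereas the path needs equal sizes; so the numbers are
  built such that equal sums force equal sizes. The helix makes all cells alike: below the common
  leading digit, the number for tile \<open>t\<close> on cell \<open>c\<close> is
  \<open>D ^ c\<close> times a number independent of \<open>c\<close>, and only the first and the
  last cell need boundary conditions on the left and right. The degrees must come out sorted from a
  program that does neither arithmetic nor sorting. Hence the base is a power of two, which turns
  digits into words of fixed length, and the digit that counts the tiles on a cell is the highest in
  the low part of an item, which orders the items by cells. The order of the tiles on one cell is
  the same for all cells. Tiles, base and words depend on the language only, so they are constants
  of the program. The strip may have any height above the time bound, so the polynomial of the
  machine can be replaced by some \<open>C * (n + 1) ^ k\<close>.\<close>

lemma sum_mdegree:
  assumes "loopless_multigraph H" "finite A" 
    and "\<forall>e\<in>#medges H. card (e \<inter> A) = 1"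
  shows "(\<Sum>v\<in>A. mdegree H v) = size (medges H)"
proof -
  have "(\<Sum>v\<in>A. size {#e \<in># E. v \<in> e#}) = size E" if "\<forall>e\<in>#E. card (e \<inter> A) = 1" for E
    using that
  proof (induction E)
    case empty
    then show ?case by simp
  next
    case (add e E)
    have "(\<Sum>v\<in>A. size {#e' \<in># add_mset e E. v \<in> e'#})
        = (\<Sum>v\<in>A. size {#e' \<in># E. v \<in> e'#} + (if v \<in> e then 1 else 0))"
      by (intro sum.cong) auto
    also have "\<dots> = size E + card (e \<inter> A)"
      using add assms(2) by (simp add: sum.distrib sum.If_cases Int_commute)
    finally show ?case using add by simp
  qed
  with assms(3) show ?thesis unfolding mdegree_def by blast
qed

lemma mset_degrees: "mset (degrees H) = image_mset (mdegree H) (mset_set (mverts H))"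
  by (simp add: degrees_def)

lemma sorted_degrees: "sorted_wrt (\<ge>) (degrees H)"
  by (simp add: degrees_def sorted_wrt_rev)

text \<open>Each edge has exactly one end in each colour class, so the degree sum of either class is
  the number of edges.\<close>

lemma bipartite_realization_halves:
  assumes "realization H d" "bipartite (underlying H)"
  shows "\<exists>A B. mset d = A + B \<and> sum_mset A = sum_mset B"
proof -
  have H: "loopless_multigraph H" and d: "degrees H = d"
    using assms(1) by (auto simp: realization_def)
  then have fin: "finite (mverts H)" by (auto simp: loopless_multigraph_def)
  obtain A B where AB: "A \<union> B = mverts H" "A \<inter> B = {}"
    "\<forall>e\<in>#medges H. \<exists>a\<in>A. \<exists>b\<in>B. e = {a, b}"
    using assms(2) by (auto simp: bipartite_def underlying_def)
  have fin': "finite A" "finite B" using fin AB(1) by (metis finite_Un)+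
  have 1: "e \<inter> A = {a} \<and> e \<inter> B = {b}" if "a \<in> A" "b \<in> B" "e = {a,b}" for a b e
    using that AB(2) by auto
  have "\<forall>e\<in>#medges H. card (e \<inter> A) = 1 \<and> card (e \<inter> B) = 1"
    using AB(3) 1 by (metis is_singletonI is_singleton_altdef)
  then have "(\<Sum>v\<in>A. mdegree H v) = (\<Sum>v\<in>B. mdegree H v)"
    using sum_mdegree[OF H] fin' by metis
  moreover have "mset d = image_mset (mdegree H) (mset_set A) + image_mset (mdegree H) (mset_set B)"
    using mset_degrees[of H] d AB fin' by (metis image_mset_union mset_set_Union)
  ultimately show ?thesis
    by (metis sum_unfold_sum_mset)
qed

definition path_multigraph :: "nat \<Rightarrow> (nat \<Rightarrow> nat) \<Rightarrow> nat multigraph" where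
  "path_multigraph n m = \<lparr>mverts = {0..n}, medges = (\<Sum>i<n. replicate_mset (m i) {i, Suc i})\<rparr>"

lemma filter_mset_sum: "{#x \<in># sum f A. P x#} = (\<Sum>i\<in>A. {#x \<in># f i. P x#})"
  by (induction A rule: infinite_finite_induct) auto

lemma size_sum_mset: "size (sum f A :: 'b multiset) = (\<Sum>i\<in>A. size (f i))"
  by (induction A rule: infinite_finite_induct) auto

lemma filter_replicate_mset: "{#x \<in># replicate_mset k a. P x#} = (if P a then replicate_mset k a else {#})"
  by (induction k) auto

lemma mdegree_path_multigraph:
  assumes "v \<le> n"
  shows "mdegree (path_multigraph n m) v = (if v = 0 then 0 else m (v - 1)) + (if v < n then m v else 0)"
proof -
  have "mdegree (path_multigraph n m) v = (\<Sum>i<n. if v = i \<or> v = Suc i then m i else 0)"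
    unfolding mdegree_def path_multigraph_def
    by (auto simp: filter_mset_sum size_sum_mset filter_replicate_mset intro!: sum.cong)
  also have "\<dots> = (\<Sum>i<n. (if i = v then m i else 0) + (if Suc i = v then m i else 0))"
    by (intro sum.cong) auto
  also have "\<dots> = (if v < n then m v else 0) + (\<Sum>i<n. if Suc i = v then m i else 0)"
    by (simp add: sum.distrib)
  also have "(\<Sum>i<n. if Suc i = v then m i else 0) = (if v = 0 then 0 else m (v - 1))"
  proof (cases v)
    case (Suc u)
    then show ?thesis using assms by (simp add: sum.delta)
  qed simp
  finally show ?thesis by simp
qed

lemma set_mset_sum: "finite A \<Longrightarrow> set_mset (sum f A) = (\<Union>i\<in>A. set_mset (f i))"
  by (induction A rule: finite_induct) auto

lemma is_path_path_multigraph: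
  assumes "\<forall>i<n. 0 < m i"
  shows "is_path (underlying (path_multigraph n m))"
proof -
  have "edges (underlying (path_multigraph n m)) = {{i, Suc i} | i. i < n}"
    using assms by (auto simp: underlying_def path_multigraph_def set_mset_sum)
  also have "\<dots> = {{[0..<Suc n] ! i, [0..<Suc n] ! Suc i} | i. Suc i < length [0..<Suc n]}"
    by (force simp del: upt_Suc)
  finally show ?thesis unfolding is_path_def
    by (intro exI[of _ "[0..<Suc n]"]) (auto simp: underlying_def path_multigraph_def simp del: upt_Suc)
qed

lemma loopless_path_multigraph: "loopless_multigraph (path_multigraph n m)"
  by (auto simp: loopless_multigraph_def path_multigraph_def set_mset_sum)

lemma sorted_desc_mset_unique:
  fixes xs ys :: "'a::linorder list"
  assumes "sorted_wrt (\<ge>) xs" "sorted_wrt (\<ge>) ys" "mset xs = mset ys"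
  shows "xs = ys"
  using assms by (metis mset_rev properties_for_sort rev_rev_ident sorted_wrt_rev)

lemma mset_interleave:
  "mset (map f [0..<2 * n]) = mset (map (\<lambda>i. f (2 * i)) [0..<n]) + mset (map (\<lambda>i. f (2 * i + 1)) [0..<n])"
  by (induction n) auto

text \<open>The edges of the path with degrees \<open>x 0\<close>, \<open>y 0\<close>, \<open>x 1\<close>, \<open>y 1\<close>, ... have the multiplicities
  \<open>x k - D k\<close> and \<open>D (k + 1)\<close>.\<close>

lemma path_realization:
  fixes x y :: "nat \<Rightarrow> nat" and n :: nat
  defines "D \<equiv> (\<lambda>k. (\<Sum>i<k. int (y i)) - (\<Sum>i<k. int (x i)))"
  assumes d: "sorted_wrt (\<ge>) d" "mset d = mset (map x [0..<n]) + mset (map y [0..<n])"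
    and n: "0 < n" and pos: "\<And>k. 0 < k \<Longrightarrow> k < n \<Longrightarrow> 0 < D k"
    and less: "\<And>k. k < n \<Longrightarrow> D k < int (x k)" and zero: "D n = 0"
  shows "\<exists>H :: nat multigraph. realization H d \<and> is_path (underlying H)"
proof -
  \<comment> \<open>The multiplicities are forced from vertex 0 on: each edge carries what its
    predecessor leaves over at the common vertex. \<open>D k\<close> is the part of
    \<open>x k\<close> already used up by the edge before it.\<close>
  define m where "m = (\<lambda>i. nat (if even i then int (x (i div 2)) - D (i div 2) else D (Suc (i div 2))))"
  let ?H = "path_multigraph (2 * n - 1) m"
  have D0: "D 0 = 0" by (simp add: D_def)
  have DS: "D (Suc k) = D k + int (y k) - int (x k)" for k by (simp add: D_def)
  have D_ge: "0 \<le> D k" if "k \<le> n" for k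
    using pos[of k] zero D0 that by (cases "k = 0"; cases "k = n") auto
  have mpos: "0 < m i" if "i < 2 * n - 1" for i
  proof (cases "even i")
    case True
    then obtain j where j: "i = 2 * j" by blast
    then show ?thesis using less[of j] that by (simp add: m_def)
  next
    case False
    then obtain j where j: "i = 2 * j + 1" by (auto elim: oddE)
    then show ?thesis using pos[of "Suc j"] that by (simp add: m_def)
  qed
  have even: "mdegree ?H (2 * k) = x k" if "k < n" for k
  proof (cases k)
    case 0
    then show ?thesis using n by (simp add: mdegree_path_multigraph m_def D0)
  next
    case (Suc j)
    have "mdegree ?H (2 * k) = m (2 * j + 1) + m (2 * k)"
      using that Suc by (simp add: mdegree_path_multigraph)
    also have "\<dots> = nat (D k) + nat (int (x k) - D k)" using Suc by (simp add: m_def)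
    also have "\<dots> = x k" using less[OF that] D_ge[of k] that by simp
    finally show ?thesis .
  qed
  have odd: "mdegree ?H (2 * k + 1) = y k" if "k < n" for k
  proof -
    have "mdegree ?H (2 * k + 1) = m (2 * k) + (if Suc k < n then m (2 * k + 1) else 0)"
      using that by (simp add: mdegree_path_multigraph) auto
    \<comment> \<open>Behind the last vertex the missing edge would have multiplicity
      \<open>D n = 0\<close>, which makes the case distinction disappear.\<close>
    also have "(if Suc k < n then m (2 * k + 1) else 0) = nat (D (Suc k))"
      using that zero by (cases "Suc k = n") (auto simp: m_def)
    also have "m (2 * k) + nat (D (Suc k)) = y k"
      using less[OF that] D_ge[of "Suc k"] DS[of k] that by (simp add: m_def)
    finally show ?thesis .
  qed
  have "mset (degrees ?H) = mset (map (mdegree ?H) [0..<2 * n])"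
  proof -
    have "{0..2 * n - 1} = {0..<2 * n}" using n by auto
    then show ?thesis by (simp add: mset_degrees path_multigraph_def)
  qed
  also have "\<dots> = mset (map x [0..<n]) + mset (map y [0..<n])"
    unfolding mset_interleave using even odd by (auto intro!: arg_cong2[where f="(+)"] image_mset_cong)
  finally have "degrees ?H = d"
    using d sorted_degrees sorted_desc_mset_unique by metis
  then have "realization ?H d" by (simp add: realization_def loopless_path_multigraph)
  moreover have "is_path (underlying ?H)" using mpos by (intro is_path_path_multigraph) auto
  ultimately show ?thesis by auto
qed

section \<open>A structured language for Turing machines\<close>

text \<open>An assembly language in which every instruction touches a single tape, so that a tape
  can serve as a register. In \<open>Op j w m\<close> the value \<open>w = None\<close> keeps the
  scanned symbol, \<open>LIf j s\<close> tests for the symbol \<open>s\<close>, and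
  \<open>LWhile j\<close> repeats until a blank is scanned.\<close>

datatype lcom =
    Op nat "nat option" move
  | LSeq lcom lcom
  | LIf nat nat lcom lcom
  | LWhile nat lcom

text \<open>The number of states: code loaded at state \<open>a\<close> is left through the single
  state \<open>a + code_size c\<close>. The two extra states of \<open>LIf\<close> are the test and
  the jump over the second branch, those of \<open>LWhile\<close> the test and the jump
  back.\<close>

fun code_size :: "lcom \<Rightarrow> nat" where
  "code_size (Op j w m) = 1"
| "code_size (LSeq c d) = code_size c + code_size d"
| "code_size (LIf j s c d) = code_size c + code_size d + 2"
| "code_size (LWhile j c) = code_size c + 2"

definition scans :: "nat \<Rightarrow> nat list set" where
  "scans k = {ss. length ss = k \<and> (\<forall>s\<in>set ss. s < 3)}"

definition stay :: "nat list \<Rightarrow> (nat \<times> move) list" where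
  "stay ss = map (\<lambda>s. (s, Stay)) ss"

definition jump :: "nat \<Rightarrow> nat \<Rightarrow> (nat list \<Rightarrow> bool) \<Rightarrow> nat \<Rightarrow> (nat \<times> nat list \<times> nat \<times> (nat \<times> move) list) set" where
  "jump k a P b = {(a, ss, b, stay ss) | ss. ss \<in> scans k \<and> P ss}"

fun trans_of :: "nat \<Rightarrow> nat \<Rightarrow> lcom \<Rightarrow> (nat \<times> nat list \<times> nat \<times> (nat \<times> move) list) set" where
  "trans_of k a (Op j w m) =
     {(a, ss, Suc a, (stay ss)[j := (case w of None \<Rightarrow> ss ! j | Some s \<Rightarrow> s, m)]) | ss. ss \<in> scans k}"
| "trans_of k a (LSeq c d) = trans_of k a c \<union> trans_of k (a + code_size c) d"
| "trans_of k a (LIf j s c d) =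
     jump k a (\<lambda>ss. ss ! j = s) (a + 1) \<union>
     jump k a (\<lambda>ss. ss ! j \<noteq> s) (a + 1 + code_size c + 1) \<union>
     trans_of k (a + 1) c \<union>
     jump k (a + 1 + code_size c) (\<lambda>_. True) (a + code_size (LIf j s c d)) \<union>
     trans_of k (a + 1 + code_size c + 1) d"
| "trans_of k a (LWhile j c) =
     jump k a (\<lambda>ss. ss ! j \<noteq> 0) (a + 1) \<union>
     jump k a (\<lambda>ss. ss ! j = 0) (a + code_size (LWhile j c)) \<union>
     trans_of k (a + 1) c \<union>
     jump k (a + 1 + code_size c) (\<lambda>_. True) a"

fun lcom_ok :: "nat \<Rightarrow> lcom \<Rightarrow> bool" where
  "lcom_ok k (Op j w m) \<longleftrightarrow> j < k \<and> (\<forall>s. w = Some s \<longrightarrow> s < 3)"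
| "lcom_ok k (LSeq c d) \<longleftrightarrow> lcom_ok k c \<and> lcom_ok k d"
| "lcom_ok k (LIf j s c d) \<longleftrightarrow> j < k \<and> lcom_ok k c \<and> lcom_ok k d"
| "lcom_ok k (LWhile j c) \<longleftrightarrow> j < k \<and> lcom_ok k c"

definition sources_in :: "(nat \<times> 'b \<times> 'c) set \<Rightarrow> nat \<Rightarrow> nat \<Rightarrow> bool" where
  "sources_in T a b \<longleftrightarrow> (\<forall>(q, _)\<in>T. a \<le> q \<and> q < b)"

definition functional :: "(nat \<times> 'b \<times> 'c) set \<Rightarrow> bool" where
  "functional T \<longleftrightarrow> (\<forall>q ss r r'. (q, ss, r) \<in> T \<longrightarrow> (q, ss, r') \<in> T \<longrightarrow> r = r')"

lemma sources_in_Un: "sources_in S a b \<Longrightarrow> sources_in T b' c \<Longrightarrow> a \<le> b' \<Longrightarrow> b \<le> c \<Longrightarrow> sources_in (S \<union> T) a c"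
  by (fastforce simp: sources_in_def)

lemma functional_Un: "functional S \<Longrightarrow> functional T \<Longrightarrow> sources_in S a b \<Longrightarrow> sources_in T b c \<Longrightarrow> functional (S \<union> T)"
  unfolding functional_def sources_in_def by (fastforce dest: leD)

lemma jump_sources: "sources_in (jump k a P b) a (a + 1)"
  by (auto simp: sources_in_def jump_def)

lemma jump_functional: "functional (jump k a P b)"
  by (auto simp: functional_def jump_def)

lemma jump_jump_functional: "(\<And>ss. P ss \<Longrightarrow> P' ss \<Longrightarrow> False) \<Longrightarrow> functional (jump k a P b \<union> jump k a P' b')"
  by (auto simp: functional_def jump_def)

text \<open>Consecutive pieces of code own disjoint intervals of states. This yields determinism,
  and also halting, since the exit state is not the source of any transition.\<close>

lemma trans_of_sources: "sources_in (trans_of k a c) a (a + code_size c)"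
proof (induction c arbitrary: a)
  case (Op j w m)
  then show ?case by (auto simp: sources_in_def)
next
  case (LSeq c d)
  from sources_in_Un[OF LSeq.IH(1)[of a] LSeq.IH(2)[of "a + code_size c"]] show ?case
    by (simp add: add.assoc)
next
  case (LIf j s c d)
  have *: "a + code_size (LIf j s c d) = a + 1 + code_size c + 1 + code_size d" by simp
  show ?case unfolding trans_of.simps *
    by (rule sources_in_Un[OF sources_in_Un[OF sources_in_Un[OF sources_in_Un[OF
        jump_sources jump_sources] LIf.IH(1)] jump_sources] LIf.IH(2)]) auto
next
  case (LWhile j c)
  have *: "a + code_size (LWhile j c) = a + 1 + code_size c + 1" by simp
  show ?case unfolding trans_of.simps *
    by (rule sources_in_Un[OF sources_in_Un[OF sources_in_Un[OF
        jump_sources jump_sources] LWhile.IH] jump_sources]) auto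
qed

text \<open>Only the test states of \<open>LIf\<close> and \<open>LWhile\<close> are sources of two
  groups of transitions, and their conditions exclude each other; all other pieces have disjoint
  sources.\<close>

lemma trans_of_functional: "functional (trans_of k a c)"
proof (induction c arbitrary: a)
  case (Op j w m)
  then show ?case by (auto simp: functional_def)
next
  case (LSeq c d)
  show ?case unfolding trans_of.simps
    by (rule functional_Un LSeq.IH trans_of_sources)+
next
  case (LIf j s c d)
  let ?J = "jump k a (\<lambda>ss. ss ! j = s) (a + 1) \<union> jump k a (\<lambda>ss. ss ! j \<noteq> s) (a + 1 + code_size c + 1)"
  let ?A = "?J \<union> trans_of k (a + 1) c"
  let ?B = "?A \<union> jump k (a + 1 + code_size c) (\<lambda>_. True) (a + code_size (LIf j s c d))"
  have J: "sources_in ?J a (a + 1)" by (rule sources_in_Un[OF jump_sources jump_sources]) auto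
  have A: "sources_in ?A a (a + 1 + code_size c)"
    by (rule sources_in_Un[OF J trans_of_sources]) auto
  have B: "sources_in ?B a (a + 1 + code_size c + 1)"
    by (rule sources_in_Un[OF A jump_sources]) auto
  have "functional ?J" by (rule jump_jump_functional) auto
  then have "functional ?A" by (rule functional_Un[OF _ LIf.IH(1) J trans_of_sources])
  then have "functional ?B" by (rule functional_Un[OF _ jump_functional A jump_sources])
  then show ?case unfolding trans_of.simps
    by (rule functional_Un[OF _ LIf.IH(2) B trans_of_sources])
next
  case (LWhile j c)
  let ?J = "jump k a (\<lambda>ss. ss ! j \<noteq> 0) (a + 1) \<union> jump k a (\<lambda>ss. ss ! j = 0) (a + code_size (LWhile j c))"
  let ?A = "?J \<union> trans_of k (a + 1) c"
  have J: "sources_in ?J a (a + 1)" by (rule sources_in_Un[OF jump_sources jump_sources]) auto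
  have A: "sources_in ?A a (a + 1 + code_size c)"
    by (rule sources_in_Un[OF J trans_of_sources]) auto
  have "functional ?J" by (rule jump_jump_functional) auto
  then have "functional ?A" by (rule functional_Un[OF _ LWhile.IH J trans_of_sources])
  then show ?case unfolding trans_of.simps
    by (rule functional_Un[OF _ jump_functional A jump_sources])
qed

lemma trans_of_wf:
  assumes "(q, ss, q', as) \<in> trans_of k a c" "lcom_ok k c"
  shows "length ss = k \<and> (\<forall>s\<in>set ss. s < 3) \<and> q' \<le> a + code_size c \<and>
    length as = k \<and> (\<forall>(s, m)\<in>set as. s < 3)"
  using assms
proof (induction c arbitrary: a)
  case (Op j w m)
  then show ?case
    by (auto simp: scans_def stay_def all_set_conv_all_nth nth_list_update split: option.splits)
next
  case (LSeq c d)
  from LSeq.prems show ?case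
    using LSeq.IH(1)[of a] LSeq.IH(2)[of "a + code_size c"] by fastforce
next
  case (LIf j s c d)
  from LIf.prems show ?case
    using LIf.IH(1)[of "a + 1"] LIf.IH(2)[of "a + 1 + code_size c + 1"]
    by (auto simp: jump_def scans_def stay_def)
next
  case (LWhile j c)
  from LWhile.prems show ?case
    using LWhile.IH[of "a + 1"] by (auto simp: jump_def scans_def stay_def)
qed

text \<open>Compiled code has transitions for the symbols 0, 1 and 2 only, so it would get stuck on
  other tapes.\<close>

definition tapes_ok :: "(nat \<Rightarrow> tape) \<Rightarrow> bool" where
  "tapes_ok T \<longleftrightarrow> (\<forall>j i. snd (T j) i < 3)"

definition config_of :: "nat \<Rightarrow> nat \<Rightarrow> (nat \<Rightarrow> tape) \<Rightarrow> config" where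
  "config_of k q T = (q, map T [0..<k])"

text \<open>The quantifiers over the machine and the load address \<open>a\<close> let the code
  become a part of any larger code.\<close>

definition executes :: "nat \<Rightarrow> lcom \<Rightarrow> nat \<Rightarrow> (nat \<Rightarrow> tape) \<Rightarrow> (nat \<Rightarrow> tape) \<Rightarrow> bool" where
  "executes k c n T T' \<longleftrightarrow> (\<forall>a M. trans_of k a c \<subseteq> delta M \<longrightarrow>
     (step M ^^ n) (config_of k a T) (config_of k (a + code_size c) T'))"

text \<open>The time is only bounded from above, since the two branches of a conditional take
  different times.\<close>

definition runs :: "nat \<Rightarrow> lcom \<Rightarrow> (nat \<Rightarrow> tape) \<Rightarrow> nat \<Rightarrow> (nat \<Rightarrow> tape) \<Rightarrow> bool" where
  "runs k c T n T' \<longleftrightarrow> (tapes_ok T \<longrightarrow> tapes_ok T' \<and> (\<exists>m\<le>n. executes k c m T T'))"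

lemma runsI: "(tapes_ok T \<Longrightarrow> \<exists>m\<le>n. tapes_ok T' \<and> executes k c m T T') \<Longrightarrow> runs k c T n T'"
  by (auto simp: runs_def)

lemma runsE:
  assumes "runs k c T n T'" "tapes_ok T"
  obtains m where "m \<le> n" "executes k c m T T'" "tapes_ok T'"
  using assms by (auto simp: runs_def)

lemma executesD:
  "executes k c n T T' \<Longrightarrow> trans_of k a c \<subseteq> delta M \<Longrightarrow> b = a + code_size c \<Longrightarrow>
    (step M ^^ n) (config_of k a T) (config_of k b T')"
  by (simp add: executes_def)

lemma scan_eq: "scan tp = snd tp (fst tp)"
  by (cases tp) auto

lemma scan_in_scans: "tapes_ok T \<Longrightarrow> map scan (map T [0..<k]) \<in> scans k"
  by (auto simp: scans_def tapes_ok_def scan_eq)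

lemma act_stay: "act (scan tp, Stay) tp = tp"
  by (cases tp) auto

lemma map2_act_stay: "map2 act (stay (map scan tps)) tps = tps"
  by (induction tps) (auto simp: stay_def act_stay)

lemma step_jump:
  assumes "jump k a P b \<subseteq> delta M" "tapes_ok T" "P (map scan (map T [0..<k]))"
  shows "step M (config_of k a T) (config_of k b T)"
proof -
  have "(a, map scan (map T [0..<k]), b, stay (map scan (map T [0..<k]))) \<in> delta M"
    using assms scan_in_scans[OF assms(2)] by (auto simp: jump_def)
  then show ?thesis
    unfolding step_def config_of_def using map2_act_stay[of "map T [0..<k]"] by auto
qed

lemma runs_mono: "runs k c T n T' \<Longrightarrow> n \<le> n' \<Longrightarrow> runs k c T n' T'"
  unfolding runs_def by (meson order_trans)

lemma runs_Op:
  assumes "j < k" "\<And>s. w = Some s \<Longrightarrow> s < 3"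
  shows "runs k (Op j w m) T 1 (T(j := act (case w of None \<Rightarrow> scan (T j) | Some s \<Rightarrow> s, m) (T j)))"
    (is "runs k ?c T 1 ?T'")
proof (rule runsI)
  assume ok: "tapes_ok T"
  have "tapes_ok ?T'"
    using ok assms(2) unfolding tapes_ok_def
    by (cases "T j") (auto split: option.splits simp: scan_eq, (metis snd_conv)+)
  moreover have "executes k ?c 1 T ?T'"
    unfolding executes_def
  proof (intro allI impI)
    fix a and M :: tm assume sub: "trans_of k a ?c \<subseteq> delta M"
    let ?ss = "map scan (map T [0..<k])"
    let ?as = "(stay ?ss)[j := (case w of None \<Rightarrow> ?ss ! j | Some s \<Rightarrow> s, m)]"
    have "(a, ?ss, Suc a, ?as) \<in> delta M"
      using sub scan_in_scans[OF ok, of k] unfolding trans_of.simps by blast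
    moreover have "map2 act ?as (map T [0..<k]) = map ?T' [0..<k]"
      using assms(1)
      by (intro nth_equalityI) (auto simp: stay_def nth_list_update act_stay split: option.splits)
    ultimately have "step M (config_of k a T) (config_of k (a + code_size ?c) ?T')"
      unfolding step_def config_of_def by (intro exI[of _ ?as]) auto
    then show "(step M ^^ 1) (config_of k a T) (config_of k (a + code_size ?c) ?T')"
      by (auto simp: relpowp_1)
  qed
  ultimately show "\<exists>m'\<le>1. tapes_ok ?T' \<and> executes k ?c m' T ?T'" by blast
qed

lemma runs_Seq:
  assumes "runs k c T n T'" "runs k d T' m T''"
  shows "runs k (LSeq c d) T (n + m) T''"
proof (rule runsI)
  assume ok: "tapes_ok T"
  obtain n' where n: "n' \<le> n" "executes k c n' T T'" "tapes_ok T'" using assms(1) ok by (rule runsE)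
  obtain m' where m: "m' \<le> m" "executes k d m' T' T''" "tapes_ok T''" using assms(2) n(3) by (rule runsE)
  have "executes k (LSeq c d) (n' + m') T T''"
    unfolding executes_def relpowp_add
    by (auto intro!: relcomppI executesD[OF n(2)] executesD[OF m(2)] simp: add.assoc)
  then show "\<exists>m'\<le>n + m. tapes_ok T'' \<and> executes k (LSeq c d) m' T T''" using n m by (meson add_mono)
qed

lemma runs_If_True:
  assumes "j < k" "scan (T j) = s" "runs k c T n T'"
  shows "runs k (LIf j s c d) T (n + 2) T'"
proof (rule runsI)
  assume ok: "tapes_ok T"
  obtain n' where n: "n' \<le> n" "executes k c n' T T'" "tapes_ok T'" using assms(3) ok by (rule runsE)
  have "executes k (LIf j s c d) (Suc (Suc n')) T T'"
    unfolding executes_def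
  proof (intro allI impI)
    fix a and M :: tm assume sub: "trans_of k a (LIf j s c d) \<subseteq> delta M"
    show "(step M ^^ Suc (Suc n')) (config_of k a T) (config_of k (a + code_size (LIf j s c d)) T')"
    proof (rule relpowp_Suc_I[OF relpowp_Suc_I2])
      show "step M (config_of k a T) (config_of k (a + 1) T)"
        by (rule step_jump[of k a "\<lambda>ss. ss ! j = s"]) (use sub ok assms in auto)
      show "(step M ^^ n') (config_of k (a + 1) T) (config_of k (a + 1 + code_size c) T')"
        by (rule executesD[OF n(2)]) (use sub in auto)
      show "step M (config_of k (a + 1 + code_size c) T') (config_of k (a + code_size (LIf j s c d)) T')"
        by (rule step_jump[of k _ "\<lambda>ss. True"]) (use sub n(3) in auto)
    qed
  qed
  then show "\<exists>m\<le>n + 2. tapes_ok T' \<and> executes k (LIf j s c d) m T T'"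
    using n by (intro exI[of _ "Suc (Suc n')"]) auto
qed

lemma runs_If_False:
  assumes "j < k" "scan (T j) \<noteq> s" "runs k d T n T'"
  shows "runs k (LIf j s c d) T (n + 2) T'"
proof (rule runsI)
  assume ok: "tapes_ok T"
  obtain n' where n: "n' \<le> n" "executes k d n' T T'" "tapes_ok T'" using assms(3) ok by (rule runsE)
  have "executes k (LIf j s c d) (Suc n') T T'"
    unfolding executes_def
  proof (intro allI impI)
    fix a and M :: tm assume sub: "trans_of k a (LIf j s c d) \<subseteq> delta M"
    show "(step M ^^ Suc n') (config_of k a T) (config_of k (a + code_size (LIf j s c d)) T')"
    proof (rule relpowp_Suc_I2)
      show "step M (config_of k a T) (config_of k (a + 1 + code_size c + 1) T)"
        by (rule step_jump[of k a "\<lambda>ss. ss ! j \<noteq> s"]) (use sub ok assms in auto)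
      show "(step M ^^ n') (config_of k (a + 1 + code_size c + 1) T) (config_of k (a + code_size (LIf j s c d)) T')"
        by (rule executesD[OF n(2)]) (use sub in auto)
    qed
  qed
  then show "\<exists>m\<le>n + 2. tapes_ok T' \<and> executes k (LIf j s c d) m T T'"
    using n by (intro exI[of _ "Suc n'"]) auto
qed

lemma runs_While_False:
  assumes "j < k" "scan (T j) = 0"
  shows "runs k (LWhile j c) T 1 T"
proof (rule runsI)
  assume ok: "tapes_ok T"
  have "step M (config_of k a T) (config_of k (a + code_size (LWhile j c)) T)"
    if "trans_of k a (LWhile j c) \<subseteq> delta M" for a M
    by (rule step_jump[of k a "\<lambda>ss. ss ! j = 0"]) (use that ok assms in auto)
  then have "executes k (LWhile j c) 1 T T" by (auto simp: executes_def relpowp_1)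
  then show "\<exists>m\<le>1. tapes_ok T \<and> executes k (LWhile j c) m T T" using ok by blast
qed

lemma runs_While_True:
  assumes "j < k" "scan (T j) \<noteq> 0" "runs k c T n T'" "runs k (LWhile j c) T' m T''"
  shows "runs k (LWhile j c) T (n + m + 2) T''"
proof (rule runsI)
  assume ok: "tapes_ok T"
  obtain n' where n: "n' \<le> n" "executes k c n' T T'" "tapes_ok T'" using assms(3) ok by (rule runsE)
  obtain m' where m: "m' \<le> m" "executes k (LWhile j c) m' T' T''" "tapes_ok T''"
    using assms(4) n(3) by (rule runsE)
  have "executes k (LWhile j c) (Suc (Suc n') + m') T T''"
    unfolding executes_def relpowp_add
  proof (intro allI impI relcomppI)
    fix a and M :: tm assume sub: "trans_of k a (LWhile j c) \<subseteq> delta M"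
    show "(step M ^^ Suc (Suc n')) (config_of k a T) (config_of k a T')"
    proof (rule relpowp_Suc_I[OF relpowp_Suc_I2])
      show "step M (config_of k a T) (config_of k (a + 1) T)"
        by (rule step_jump[of k a "\<lambda>ss. ss ! j \<noteq> 0"]) (use sub ok assms in auto)
      show "(step M ^^ n') (config_of k (a + 1) T) (config_of k (a + 1 + code_size c) T')"
        by (rule executesD[OF n(2)]) (use sub in auto)
      show "step M (config_of k (a + 1 + code_size c) T') (config_of k a T')"
        by (rule step_jump[of k _ "\<lambda>ss. True"]) (use sub n(3) in auto)
    qed
    show "(step M ^^ m') (config_of k a T') (config_of k (a + code_size (LWhile j c)) T'')"
      by (rule executesD[OF m(2) sub refl])
  qed
  then show "\<exists>m'\<le>n + m + 2. tapes_ok T'' \<and> executes k (LWhile j c) m' T T''"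
    using n m by (intro exI[of _ "Suc (Suc n') + m'"]) auto
qed

section \<open>Unary registers and loops\<close>

definition reg_tape :: "int \<Rightarrow> bool list \<Rightarrow> tape" where
  "reg_tape i xs = (i, snd (input_tape xs))"

lemma input_tape_reg: "input_tape xs = reg_tape 0 xs"
  by (simp add: reg_tape_def input_tape_def)

lemma scan_reg_tape:
  "scan (reg_tape i xs) = (if 0 \<le> i \<and> i < int (length xs) then bit_symbol (xs ! nat i) else 0)"
  by (simp add: reg_tape_def input_tape_def)

lemma act_reg_tape: "act (scan (reg_tape i xs), m) (reg_tape i xs) = reg_tape (i + offset m) xs"
  by (auto simp: reg_tape_def input_tape_def)

lemma bit_symbol_range: "0 < bit_symbol b" "bit_symbol b < 3"
  by (auto simp: bit_symbol_def)

abbreviation move_head :: "nat \<Rightarrow> move \<Rightarrow> lcom" where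
  "move_head j m \<equiv> Op j None m"

lemma runs_move:
  assumes "j < k" "T j = reg_tape i xs"
  shows "runs k (move_head j m) T 1 (T(j := reg_tape (i + offset m) xs))"
  using runs_Op[OF assms(1), of None m T] assms(2) by (simp add: act_reg_tape)

lemma runs_right:
  assumes "j < k"
  shows "T j = reg_tape i xs \<Longrightarrow> 0 \<le> i \<Longrightarrow> i \<le> int (length xs) \<Longrightarrow>
    runs k (LWhile j (move_head j Go_Right)) T (3 * nat (int (length xs) - i) + 1)
      (T(j := reg_tape (int (length xs)) xs))"
proof (induction "nat (int (length xs) - i)" arbitrary: i T)
  case 0
  then have "i = int (length xs)" by simp
  moreover from this have "scan (T j) = 0" using 0 by (simp add: scan_reg_tape)
  ultimately show ?case
    using runs_While_False[OF assms, of T] 0 by (simp add: fun_upd_idem)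
next
  case (Suc n)
  then have "scan (T j) \<noteq> 0" by (auto simp: scan_reg_tape bit_symbol_range)
  moreover have "runs k (move_head j Go_Right) T 1 (T(j := reg_tape (i + 1) xs))"
    using runs_move[OF assms, of T i xs Go_Right] Suc.prems by simp
  moreover have "runs k (LWhile j (move_head j Go_Right)) (T(j := reg_tape (i + 1) xs))
      (3 * n + 1) (T(j := reg_tape (int (length xs)) xs))"
  proof -
    have n: "n = nat (int (length xs) - (i + 1))" using Suc.hyps(2) by simp
    show ?thesis
      using Suc.hyps(1)[OF n, of "T(j := reg_tape (i + 1) xs)"] Suc.hyps(2) Suc.prems
      by (auto simp flip: n)
  qed
  ultimately show ?case
    using runs_While_True[OF assms] Suc.hyps(2) by (fastforce elim!: runs_mono)
qed

lemma runs_left: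
  assumes "j < k"
  shows "T j = reg_tape i xs \<Longrightarrow> - 1 \<le> i \<Longrightarrow> i < int (length xs) \<Longrightarrow>
    runs k (LWhile j (move_head j Go_Left)) T (3 * nat (i + 1) + 1) (T(j := reg_tape (- 1) xs))"
proof (induction "nat (i + 1)" arbitrary: i T)
  case 0
  then have "i = - 1" by simp
  moreover from this have "scan (T j) = 0" using 0 by (simp add: scan_reg_tape)
  ultimately show ?case
    using runs_While_False[OF assms, of T] 0 by (simp add: fun_upd_idem)
next
  case (Suc n)
  then have "scan (T j) \<noteq> 0" by (auto simp: scan_reg_tape bit_symbol_range)
  moreover have "runs k (move_head j Go_Left) T 1 (T(j := reg_tape (i - 1) xs))"
    using runs_move[OF assms, of T i xs Go_Left] Suc.prems by simp
  moreover have "runs k (LWhile j (move_head j Go_Left)) (T(j := reg_tape (i - 1) xs))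
      (3 * n + 1) (T(j := reg_tape (- 1) xs))"
  proof -
    have n: "n = nat (i - 1 + 1)" using Suc.hyps(2) by simp
    show ?thesis
      using Suc.hyps(1)[OF n, of "T(j := reg_tape (i - 1) xs)"] n Suc.hyps(2) Suc.prems
      by auto
  qed
  ultimately show ?case
    using runs_While_True[OF assms] Suc.hyps(2) by (fastforce elim!: runs_mono)
qed

text \<open>The home position 0 is found as the right neighbour of the blank on cell -1. On the
  blank behind the register the loop would stop at once, so users of this code step left
  first.\<close>

definition rewind :: "nat \<Rightarrow> lcom" where
  "rewind j = LSeq (LWhile j (move_head j Go_Left)) (move_head j Go_Right)"

lemma runs_rewind:
  assumes "j < k" "T j = reg_tape i xs" "- 1 \<le> i" "i < int (length xs)"
  shows "runs k (rewind j) T (3 * length xs + 2) (T(j := input_tape xs))"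
proof -
  have "runs k (rewind j) T (3 * nat (i + 1) + 1 + 1) (T(j := input_tape xs))"
    unfolding rewind_def
  proof (rule runs_Seq)
    show "runs k (LWhile j (move_head j Go_Left)) T (3 * nat (i + 1) + 1) (T(j := reg_tape (- 1) xs))"
      using assms by (intro runs_left)
    show "runs k (move_head j Go_Right) (T(j := reg_tape (- 1) xs)) 1 (T(j := input_tape xs))"
      using runs_move[OF assms(1), of "T(j := reg_tape (- 1) xs)" "- 1" xs Go_Right]
      by (simp add: input_tape_reg)
  qed
  moreover have "3 * nat (i + 1) + 1 + 1 \<le> 3 * length xs + 2" using assms by simp
  ultimately show ?thesis by (rule runs_mono)
qed

definition push_code :: "nat \<Rightarrow> bool \<Rightarrow> lcom" where
  "push_code j b = LSeq (LWhile j (move_head j Go_Right))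
     (LSeq (Op j (Some (bit_symbol b)) Go_Left) (rewind j))"

lemma runs_push:
  assumes "j < k" "T j = input_tape xs"
  shows "runs k (push_code j b) T (6 * length xs + 7) (T(j := input_tape (xs @ [b])))"
proof -
  let ?n = "int (length xs)"
  have 1: "runs k (LWhile j (move_head j Go_Right)) T (3 * length xs + 1) (T(j := reg_tape ?n xs))"
    using runs_right[OF assms(1), of T 0 xs] assms(2) by (simp add: input_tape_reg)
  have eq: "act (bit_symbol b, Go_Left) (reg_tape ?n xs) = reg_tape (?n - 1) (xs @ [b])"
    by (auto simp: reg_tape_def input_tape_def nth_append fun_eq_iff)
  have 2: "runs k (Op j (Some (bit_symbol b)) Go_Left) (T(j := reg_tape ?n xs)) 1
      (T(j := reg_tape (?n - 1) (xs @ [b])))"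
    using runs_Op[OF assms(1), of "Some (bit_symbol b)" Go_Left "T(j := reg_tape ?n xs)"] bit_symbol_range
    by (simp add: eq)
  have 3: "runs k (rewind j) (T(j := reg_tape (?n - 1) (xs @ [b]))) (3 * (length xs + 1) + 2)
      (T(j := input_tape (xs @ [b])))"
    using runs_rewind[OF assms(1), of "T(j := reg_tape (?n - 1) (xs @ [b]))" "?n - 1" "xs @ [b]"] by simp
  show ?thesis
    using runs_Seq[OF 1 runs_Seq[OF 2 3]] by (auto simp: push_code_def elim!: runs_mono)
qed

text \<open>After running to the right end and one step back, a blank is scanned iff the register is
  empty, the head then being on cell -1.\<close>

definition transfer_code :: "nat \<Rightarrow> nat \<Rightarrow> lcom" where
  "transfer_code a b = LSeq (LWhile a (move_head a Go_Right)) (LSeq (move_head a Go_Left)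
     (LIf a 0 (move_head a Go_Right)
       (LSeq (Op a (Some 0) Go_Left) (LSeq (rewind a) (push_code b True)))))"

lemma runs_transfer:
  assumes "a < k" "b < k" "a \<noteq> b" "T a = input_tape xs" "T b = input_tape ys"
  shows "runs k (transfer_code a b) T (6 * length xs + 6 * length ys + 20)
    (if xs = [] then T else T(a := input_tape (butlast xs), b := input_tape (ys @ [True])))"
proof -
  let ?n = "int (length xs)"
  have 1: "runs k (LWhile a (move_head a Go_Right)) T (3 * length xs + 1) (T(a := reg_tape ?n xs))"
    using runs_right[OF assms(1), of T 0 xs] assms(4) by (simp add: input_tape_reg)
  have 2: "runs k (move_head a Go_Left) (T(a := reg_tape ?n xs)) 1 (T(a := reg_tape (?n - 1) xs))"
    using runs_move[OF assms(1), of "T(a := reg_tape ?n xs)" ?n xs Go_Left] by simp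
  show ?thesis
  proof (cases "xs = []")
    case True
    have "runs k (LIf a 0 (move_head a Go_Right) (LSeq (Op a (Some 0) Go_Left) (LSeq (rewind a) (push_code b True))))
        (T(a := reg_tape (?n - 1) xs)) (1 + 2) T"
    proof (rule runs_If_True[OF assms(1)])
      show "scan ((T(a := reg_tape (?n - 1) xs)) a) = 0" using True by (simp add: scan_reg_tape)
      show "runs k (move_head a Go_Right) (T(a := reg_tape (?n - 1) xs)) 1 T"
        using runs_move[OF assms(1), of "T(a := reg_tape (?n - 1) xs)" "?n - 1" xs Go_Right] True assms(4)
        by (simp add: input_tape_reg fun_upd_idem)
    qed
    from runs_Seq[OF 1 runs_Seq[OF 2 this]] show ?thesis
      using True by (auto simp: transfer_code_def elim!: runs_mono)
  next
    case False
    then obtain zs z where xs: "xs = zs @ [z]" by (metis rev_exhaust)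
    have eq: "act (0, Go_Left) (reg_tape (?n - 1) xs) = reg_tape (?n - 2) zs"
      by (auto simp: reg_tape_def input_tape_def nth_append fun_eq_iff xs)
    have 3: "runs k (Op a (Some 0) Go_Left) (T(a := reg_tape (?n - 1) xs)) 1 (T(a := reg_tape (?n - 2) zs))"
      using runs_Op[OF assms(1), of "Some 0" Go_Left "T(a := reg_tape (?n - 1) xs)"] by (simp add: eq)
    have 4: "runs k (rewind a) (T(a := reg_tape (?n - 2) zs)) (3 * length zs + 2) (T(a := input_tape zs))"
      using runs_rewind[OF assms(1), of "T(a := reg_tape (?n - 2) zs)" "?n - 2" zs] by (simp add: xs)
    have 5: "runs k (push_code b True) (T(a := input_tape zs)) (6 * length ys + 7)
        (T(a := input_tape zs, b := input_tape (ys @ [True])))"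
      using runs_push[OF assms(2), of "T(a := input_tape zs)" ys True] assms(3,5) by simp
    have "scan ((T(a := reg_tape (?n - 1) xs)) a) \<noteq> 0"
      by (simp add: scan_reg_tape xs bit_symbol_range)
    from runs_Seq[OF 1 runs_Seq[OF 2 runs_If_False[where c = "move_head a Go_Right", OF assms(1) this runs_Seq[OF 3 runs_Seq[OF 4 5]]]]]
    show ?thesis
      by (auto simp: transfer_code_def xs elim!: runs_mono)
  qed
qed

section \<open>Programs with bounded loops over bit strings, and their compilation\<close>

datatype com =
    Skip
  | Push nat bool
  | Transfer nat nat
  | Seq com com
  | For nat com com

type_synonym regs = "nat \<Rightarrow> bool list"

text \<open>\<open>For\<close> reads its register once from left to right and branches on the
  current bit. The number of rounds is fixed on entry, so every program terminates.\<close>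

primrec exec :: "com \<Rightarrow> regs \<Rightarrow> regs" where
  "exec Skip = (\<lambda>\<rho>. \<rho>)"
| "exec (Push j b) = (\<lambda>\<rho>. \<rho>(j := \<rho> j @ [b]))"
| "exec (Transfer a b) = (\<lambda>\<rho>. if \<rho> a = [] then \<rho> else \<rho>(a := butlast (\<rho> a), b := \<rho> b @ [True]))"
| "exec (Seq c d) = (\<lambda>\<rho>. exec d (exec c \<rho>))"
| "exec (For j c d) = (\<lambda>\<rho>. fold (\<lambda>b. if b then exec d else exec c) (\<rho> j) \<rho>)"

primrec uses :: "com \<Rightarrow> nat set" where
  "uses Skip = {}"
| "uses (Push j b) = {j}"
| "uses (Transfer a b) = {a, b}"
| "uses (Seq c d) = uses c \<union> uses d"
| "uses (For j c d) = insert j (uses c \<union> uses d)"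

primrec compile :: "com \<Rightarrow> lcom" where
  "compile Skip = Op 0 None Stay"
| "compile (Push j b) = push_code j b"
| "compile (Transfer a b) = transfer_code a b"
| "compile (Seq c d) = LSeq (compile c) (compile d)"
| "compile (For j c d) =
     LSeq (LWhile j (LSeq (LIf j 1 (compile c) (compile d)) (move_head j Go_Right)))
       (LSeq (move_head j Go_Left) (rewind j))"

text \<open>Registers in \<open>R\<close> may control loops; their total length never increases. The body of a loop must not
  use the loop register, whose head is then away from its home position.\<close>

primrec safe :: "nat set \<Rightarrow> com \<Rightarrow> bool" where
  "safe R Skip \<longleftrightarrow> True"
| "safe R (Push j b) \<longleftrightarrow> j \<notin> R"
| "safe R (Transfer a b) \<longleftrightarrow> a \<in> R \<and> a \<noteq> b"
| "safe R (Seq c d) \<longleftrightarrow> safe R c \<and> safe R d"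
| "safe R (For j c d) \<longleftrightarrow> j \<in> R \<and> j \<notin> uses c \<and> j \<notin> uses d \<and> safe R c \<and> safe R d"

text \<open>An upper bound for the number of executed operations, in terms of the total length of the registers in \<open>R\<close>.\<close>

primrec op_count :: "com \<Rightarrow> nat poly" where
  "op_count Skip = 1"
| "op_count (Push j b) = 1"
| "op_count (Transfer a b) = 1"
| "op_count (Seq c d) = op_count c + op_count d"
| "op_count (For j c d) = [:1, 1:] * (op_count c + op_count d + 1)"

lemma exec_other: "j \<notin> uses c \<Longrightarrow> exec c \<rho> j = \<rho> j"
proof (induction c arbitrary: \<rho>)
  case (For i c d)
  have "fold (\<lambda>b. if b then exec d else exec c) xs \<rho> j = \<rho> j" for xs \<rho>
    using For by (induction xs arbitrary: \<rho>) auto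
  then show ?case by simp
qed auto

definition reg_size :: "nat set \<Rightarrow> regs \<Rightarrow> nat" where
  "reg_size R \<rho> = (\<Sum>j\<in>R. length (\<rho> j))"

lemma reg_size_cong: "(\<And>j. j \<in> R \<Longrightarrow> length (\<rho> j) = length (\<rho>' j)) \<Longrightarrow> reg_size R \<rho> = reg_size R \<rho>'"
  by (simp add: reg_size_def)

text \<open>Pushes go outside \<open>R\<close>, and a transfer takes one bit from \<open>R\<close>
  and puts back at most one. So the initial total bounds every loop register at all times, however
  deeply loops are nested.\<close>

lemma reg_size_exec:
  assumes "finite R"
  shows "safe R c \<Longrightarrow> reg_size R (exec c \<rho>) \<le> reg_size R \<rho>"
proof (induction c arbitrary: \<rho>)
  case (Push j b)
  then show ?case by (auto intro!: eq_refl reg_size_cong)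
next
  case (Transfer a b)
  show ?case
  proof (cases "\<rho> a = []")
    case False
    then have a: "length (\<rho> a) > 0" by simp
    have "reg_size R (exec (Transfer a b) \<rho>) =
        (length (\<rho> a) - 1) + (\<Sum>j\<in>R - {a}. length (\<rho> j) + (if j = b then 1 else 0))"
      using Transfer False assms
      by (auto simp: reg_size_def sum.remove[of R a] intro!: sum.cong split: if_splits)
    also have "\<dots> \<le> (length (\<rho> a) - 1) + ((\<Sum>j\<in>R - {a}. length (\<rho> j)) + 1)"
      using assms by (simp add: sum.distrib)
    also have "\<dots> = reg_size R \<rho>"
      using a Transfer assms by (simp add: reg_size_def sum.remove[of R a])
    finally show ?thesis .
  qed simp
next
  case (Seq c d)
  then show ?case using order_trans by fastforce
next
  case (For i c d)
  have "reg_size R (fold (\<lambda>b. if b then exec d else exec c) xs \<rho>) \<le> reg_size R \<rho>" for xs \<rho>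
  proof (induction xs arbitrary: \<rho>)
    case (Cons x xs)
    then show ?case using For order_trans[OF Cons.IH] by auto
  qed simp
  then show ?case by simp
qed simp

lemma length_le_reg_size: "finite R \<Longrightarrow> j \<in> R \<Longrightarrow> length (\<rho> j) \<le> reg_size R \<rho>"
  unfolding reg_size_def by (rule member_le_sum) auto

text \<open>An operation lengthens a register by at most one bit, so the operation count also bounds
  the growth of the registers outside \<open>R\<close>.\<close>

lemma length_exec_le:
  assumes "finite R"
  shows "safe R c \<Longrightarrow> reg_size R \<rho> \<le> r \<Longrightarrow> \<forall>j. length (\<rho> j) \<le> s \<Longrightarrow>
    length (exec c \<rho> i) \<le> s + poly (op_count c) r"
proof (induction c arbitrary: \<rho> s i)
  case Skip
  then show ?case by (auto simp: le_SucI)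
next
  case (Push j b)
  then show ?case by (auto simp: le_SucI)
next
  case (Transfer a b)
  then show ?case by (auto simp: le_SucI diff_le_mono intro: le_trans[OF diff_le_self])
next
  case (Seq c d)
  have "\<forall>j. length (exec c \<rho> j) \<le> s + poly (op_count c) r" using Seq by auto
  moreover have "reg_size R (exec c \<rho>) \<le> r" using Seq reg_size_exec[OF assms, of c \<rho>] by auto
  ultimately have "length (exec d (exec c \<rho>) i) \<le> (s + poly (op_count c) r) + poly (op_count d) r"
    using Seq by simp
  then show ?case by (simp add: add.assoc)
next
  case (For j c d)
  let ?g = "poly (op_count c) r + poly (op_count d) r"
  let ?f = "\<lambda>b. if b then exec d else exec c"
  \<comment> \<open>The bound \<open>s'\<close> on the lengths grows by \<open>?g\<close> per round,
    whereas the bound \<open>r\<close>, which governs the inner loops, stays the same.\<close>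
  have step: "length (fold ?f xs \<rho>' i) \<le> s' + length xs * ?g"
    if "reg_size R \<rho>' \<le> r" "\<forall>j. length (\<rho>' j) \<le> s'" for xs \<rho>' s' i
    using that
  proof (induction xs arbitrary: \<rho>' s')
    case (Cons x xs)
    have "length (?f x \<rho>' i) \<le> s' + ?g" for i
      using For.IH(1)[of \<rho>' s' i] For.IH(2)[of \<rho>' s' i] For.prems Cons.prems by (cases x) auto
    moreover have "reg_size R (?f x \<rho>') \<le> r"
      using reg_size_exec[OF assms, of c \<rho>'] reg_size_exec[OF assms, of d \<rho>'] For.prems Cons.prems by auto
    ultimately show ?case using Cons.IH[of "?f x \<rho>'" "s' + ?g"] by (simp add: algebra_simps)
  qed auto
  have "length (\<rho> j) \<le> r" using For.prems length_le_reg_size[OF assms, of j \<rho>] by auto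
  then have "length (\<rho> j) * ?g \<le> (1 + r) * (?g + 1)" by (intro mult_mono) auto
  then show ?case using step[OF For.prems(2,3), of "\<rho> j" i] by (simp add: add.assoc)
qed

text \<open>\<open>U\<close> collects the registers whose heads are at home. While a loop over
  \<open>j\<close> runs, \<open>j\<close> is removed from \<open>U\<close>, and its tape, with the
  head somewhere inside, belongs to \<open>T\<close>.\<close>

definition overlay :: "nat set \<Rightarrow> regs \<Rightarrow> (nat \<Rightarrow> tape) \<Rightarrow> nat \<Rightarrow> tape" where
  "overlay U \<rho> T = (\<lambda>j. if j \<in> U then input_tape (\<rho> j) else T j)"

text \<open>The dearest operation, a transfer between registers of length at most \<open>s\<close>,
  takes \<open>12 * s + 20\<close> steps. The constant 30 also covers the control steps of
  loops.\<close>

definition op_cost :: "nat \<Rightarrow> nat" where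
  "op_cost s = 12 * s + 30"

lemma op_cost_mono: "s \<le> t \<Longrightarrow> op_cost s \<le> op_cost t"
  by (simp add: op_cost_def)

lemma overlay_upd: "j \<in> U \<Longrightarrow> overlay U (\<rho>(j := xs)) T = (overlay U \<rho> T)(j := input_tape xs)"
  by (auto simp: overlay_def)

lemma overlay_remove: "j \<in> U \<Longrightarrow> overlay U \<rho> T = overlay (U - {j}) \<rho> (T(j := reg_tape 0 (\<rho> j)))"
  by (auto simp: overlay_def input_tape_reg)

lemma overlay_remove_upd:
  "(overlay (U - {j}) \<rho> (T(j := tp)))(j := tp') = overlay (U - {j}) \<rho> (T(j := tp'))"
  by (auto simp: overlay_def)

theorem runs_compile:
  assumes "finite R" "0 < k"
  shows "safe R c \<Longrightarrow> uses c \<subseteq> U \<Longrightarrow> U \<subseteq> {..<k} \<Longrightarrow> reg_size R \<rho> \<le> r \<Longrightarrow> \<forall>j. length (\<rho> j) \<le> s \<Longrightarrow>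
    runs k (compile c) (overlay U \<rho> T) (poly (op_count c) r * op_cost (s + poly (op_count c) r))
      (overlay U (exec c \<rho>) T)"
proof (induction c arbitrary: U \<rho> T s)
  case Skip
  have "runs k (compile Skip) (overlay U \<rho> T) 1 (overlay U (exec Skip \<rho>) T)"
    using runs_Op[OF assms(2), of None Stay "overlay U \<rho> T"] by (simp add: act_stay)
  then show ?case by (rule runs_mono) (simp add: op_cost_def)
next
  case (Push j b)
  have "j < k" "overlay U \<rho> T j = input_tape (\<rho> j)" using Push by (auto simp: overlay_def)
  from runs_push[where T = "overlay U \<rho> T", OF this, of b] have
    "runs k (compile (Push j b)) (overlay U \<rho> T) (6 * length (\<rho> j) + 7) (overlay U (exec (Push j b) \<rho>) T)"
    using Push by (simp add: overlay_upd)
  then show ?case using Push.prems(5)[rule_format, of j] by (elim runs_mono) (simp add: op_cost_def)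
next
  case (Transfer a b)
  have k: "a < k" "b < k" "a \<noteq> b" and
    t: "overlay U \<rho> T a = input_tape (\<rho> a)" "overlay U \<rho> T b = input_tape (\<rho> b)"
    using Transfer by (auto simp: overlay_def)
  have "runs k (compile (Transfer a b)) (overlay U \<rho> T) (6 * length (\<rho> a) + 6 * length (\<rho> b) + 20)
     (overlay U (exec (Transfer a b) \<rho>) T)"
    using runs_transfer[where T = "overlay U \<rho> T", OF k t] Transfer by (auto simp: overlay_upd)
  moreover have "6 * length (\<rho> a) + 6 * length (\<rho> b) + 20 \<le> op_cost s"
    using Transfer.prems(5)[rule_format, of a] Transfer.prems(5)[rule_format, of b]
    by (simp add: op_cost_def)
  ultimately show ?case by (elim runs_mono) (simp add: op_cost_def)
next
  case (Seq c d)
  let ?c = "poly (op_count c) r" and ?d = "poly (op_count d) r"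
  have 1: "runs k (compile c) (overlay U \<rho> T) (?c * op_cost (s + ?c)) (overlay U (exec c \<rho>) T)"
    using Seq by auto
  have "\<forall>j. length (exec c \<rho> j) \<le> s + ?c"
    using Seq length_exec_le[OF assms(1)] by auto
  moreover have "reg_size R (exec c \<rho>) \<le> r" using Seq reg_size_exec[OF assms(1), of c \<rho>] by auto
  ultimately have 2: "runs k (compile d) (overlay U (exec c \<rho>) T) (?d * op_cost (s + ?c + ?d))
      (overlay U (exec d (exec c \<rho>)) T)"
    using Seq.prems by (intro Seq.IH(2)) auto
  have "?c * op_cost (s + ?c) + ?d * op_cost (s + ?c + ?d) \<le> (?c + ?d) * op_cost (s + ?c + ?d)"
    unfolding add_mult_distrib by (rule add_mono; rule mult_le_mono) (auto intro: op_cost_mono)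
  with runs_Seq[OF 1 2] show ?case by (auto simp: add.assoc elim!: runs_mono)
next
  case (For j c d)
  let ?c = "poly (op_count c) r" and ?d = "poly (op_count d) r"
  define xs where "xs = \<rho> j"
  define G where "G = ?c + ?d"
  \<comment> \<open>A bound for all lengths until the end of the loop, so that one price per
    operation serves all rounds.\<close>
  define S where "S = s + length xs * G"
  define V where "V = U - {j}"
  let ?f = "\<lambda>b. if b then exec d else exec c"
  let ?body = "LSeq (LIf j 1 (compile c) (compile d)) (move_head j Go_Right)"
  let ?st = "\<lambda>\<rho> i. overlay V \<rho> (T(j := reg_tape i xs))"
  have j: "j < k" "j \<in> U" using For.prems by auto
  have stj: "?st \<rho>' i j = reg_tape i xs" for \<rho>' i by (simp add: overlay_def V_def)
  have upd: "(?st \<rho>' i)(j := reg_tape i' xs) = ?st \<rho>' i'" for \<rho>' i i'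
    by (simp add: overlay_remove_upd V_def)
  have V: "uses c \<subseteq> V" "uses d \<subseteq> V" "V \<subseteq> {..<k}" using For.prems by (auto simp: V_def)
  have sf: "safe R c" "safe R d" using For.prems(1) by auto
  \<comment> \<open>Here \<open>pre\<close> has been read already, the head of \<open>j\<close>
    stands right behind it, and each round has added at most \<open>G\<close> to a length. The 5
    extra steps per round are 2 for the conditional, 1 for the move and 2 for the loop.\<close>
  have loop: "runs k (LWhile j ?body) (?st \<rho>' (int (length pre)))
      (length ys * (G * op_cost S + 5) + 1) (?st (fold ?f ys \<rho>') (int (length xs)))"
    if "xs = pre @ ys" "reg_size R \<rho>' \<le> r" "\<forall>j. length (\<rho>' j) \<le> s + length pre * G" for pre ys \<rho>'
    using that
  proof (induction ys arbitrary: pre \<rho>')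
    case Nil
    then have "scan (?st \<rho>' (int (length pre)) j) = 0" unfolding stj scan_reg_tape by simp
    from runs_While_False[where c = ?body and T = "?st \<rho>' (int (length pre))", OF j(1) this]
    show ?case using Nil.prems(1)
      by (simp only: list.size fold_simps mult_zero_left add_0 append_Nil2)
  next
    case (Cons y ys)
    let ?t = "s + length pre * G"
    have scan: "scan (?st \<rho>' (int (length pre)) j) = bit_symbol y"
      unfolding stj scan_reg_tape using Cons.prems(1) by simp
    have le: "length pre * G + G \<le> length xs * G"
      using Cons.prems mult_le_mono1[of "Suc (length pre)" "length xs" G] by (simp add: add.commute)
    have mono: "g * op_cost (?t + g) \<le> G * op_cost S" if "g \<le> G" for g
      using that le unfolding S_def by (intro mult_mono op_cost_mono) auto
    have "runs k (compile c) (?st \<rho>' (int (length pre))) (G * op_cost S) (?st (exec c \<rho>') (int (length pre)))"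
      by (rule runs_mono[OF For.IH(1)[OF sf(1) V(1,3) Cons.prems(2,3)] mono]) (simp add: G_def)
    moreover have "runs k (compile d) (?st \<rho>' (int (length pre))) (G * op_cost S) (?st (exec d \<rho>') (int (length pre)))"
      by (rule runs_mono[OF For.IH(2)[OF sf(2) V(2,3) Cons.prems(2,3)] mono]) (simp add: G_def)
    ultimately have "runs k (LIf j 1 (compile c) (compile d)) (?st \<rho>' (int (length pre))) (G * op_cost S + 2)
        (?st (?f y \<rho>') (int (length pre)))"
      using runs_If_True[OF j(1), of "?st \<rho>' (int (length pre))" 1]
        runs_If_False[OF j(1), of "?st \<rho>' (int (length pre))" 1] scan
      by (cases y) (auto simp: bit_symbol_def)
    moreover have "runs k (move_head j Go_Right) (?st (?f y \<rho>') (int (length pre))) 1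
        (?st (?f y \<rho>') (int (length (pre @ [y]))))"
      using runs_move[where T = "?st (?f y \<rho>') (int (length pre))", OF j(1) stj, of Go_Right]
      by (simp add: upd add.commute split del: if_split)
    ultimately have 1: "runs k ?body (?st \<rho>' (int (length pre))) (G * op_cost S + 2 + 1)
        (?st (?f y \<rho>') (int (length (pre @ [y]))))"
      by (rule runs_Seq)
    have "length (?f y \<rho>' i) \<le> ?t + G" for i
      using length_exec_le[OF assms(1), of c \<rho>' r ?t i] length_exec_le[OF assms(1), of d \<rho>' r ?t i]
        For.prems(1) Cons.prems by (cases y) (auto simp: G_def)
    moreover have "reg_size R (?f y \<rho>') \<le> r"
      using reg_size_exec[OF assms(1), of c \<rho>'] reg_size_exec[OF assms(1), of d \<rho>'] For.prems Cons.prems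
      by auto
    ultimately have 2: "runs k (LWhile j ?body) (?st (?f y \<rho>') (int (length (pre @ [y]))))
        (length ys * (G * op_cost S + 5) + 1) (?st (fold ?f ys (?f y \<rho>')) (int (length xs)))"
      by (intro Cons.IH) (use Cons.prems(1) in \<open>auto simp: algebra_simps split del: if_split\<close>)
    have "scan (?st \<rho>' (int (length pre)) j) \<noteq> 0" using scan bit_symbol_range[of y] by simp
    from runs_While_True[where T = "?st \<rho>' (int (length pre))", OF j(1) this 1 2] show ?case
      unfolding fold_simps by (rule runs_mono) (simp add: algebra_simps)
  qed
  have "runs k (LWhile j ?body) (?st \<rho> 0) (length xs * (G * op_cost S + 5) + 1)
      (?st (fold ?f xs \<rho>) (int (length xs)))"
    using loop[of "[]" xs \<rho>] For.prems by simp
  moreover have "runs k (move_head j Go_Left) (?st (fold ?f xs \<rho>) (int (length xs))) 1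
      (?st (fold ?f xs \<rho>) (int (length xs) - 1))"
    using runs_move[where T = "?st (fold ?f xs \<rho>) (int (length xs))", OF j(1) stj, of Go_Left] by (simp add: upd)
  moreover have "runs k (rewind j) (?st (fold ?f xs \<rho>) (int (length xs) - 1)) (3 * length xs + 2)
      (?st (fold ?f xs \<rho>) 0)"
    using runs_rewind[where T = "?st (fold ?f xs \<rho>) (int (length xs) - 1)", OF j(1) stj]
    by (simp add: upd input_tape_reg)
  ultimately have "runs k (compile (For j c d)) (?st \<rho> 0)
      (length xs * (G * op_cost S + 5) + 1 + (1 + (3 * length xs + 2))) (?st (fold ?f xs \<rho>) 0)"
    unfolding compile.simps by (intro runs_Seq)
  moreover have "?st \<rho> 0 = overlay U \<rho> T"
    using j(2) overlay_remove[of j U \<rho> T] by (simp add: V_def xs_def)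
  moreover have "?st (fold ?f xs \<rho>) 0 = overlay U (exec (For j c d) \<rho>) T"
  proof -
    have "fold ?f ys \<rho>' j = \<rho>' j" for ys \<rho>'
      using For.prems(1) by (induction ys arbitrary: \<rho>') (auto simp: exec_other)
    then show ?thesis
      using j(2) overlay_remove[of j U "fold ?f xs \<rho>" T] by (simp add: V_def xs_def)
  qed
  moreover have "length xs * (G * op_cost S + 5) + 1 + (1 + (3 * length xs + 2))
      \<le> poly (op_count (For j c d)) r * op_cost (s + poly (op_count (For j c d)) r)"
  proof -
    define E where "E = op_cost (s + (1 + r) * (G + 1))"
    have len: "length xs \<le> r"
      using For.prems length_le_reg_size[OF assms(1), of j \<rho>] by (auto simp: xs_def)
    then have "length xs * G \<le> (1 + r) * (G + 1)" by (intro mult_le_mono) auto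
    then have "op_cost S \<le> E" unfolding S_def E_def by (intro op_cost_mono) simp
    then have "length xs * (G * op_cost S) \<le> r * (G * E)" using len by (intro mult_mono) auto
    \<comment> \<open>Per bit there are 5 control steps in the loop and 3 for rewinding.\<close>
    moreover have "8 * length xs + 4 \<le> (r + 1) * E"
    proof -
      have "(r + 1) * 30 \<le> (r + 1) * E" unfolding E_def by (intro mult_le_mono2) (simp add: op_cost_def)
      then show ?thesis using len by simp
    qed
    ultimately have "length xs * (G * op_cost S) + (8 * length xs + 4) \<le> r * (G * E) + (r + 1) * E + G * E"
      by linarith
    also have "\<dots> = (1 + r) * (G + 1) * E" by (simp add: algebra_simps)
    finally show ?thesis by (simp add: E_def G_def algebra_simps)
  qed
  ultimately show ?case using runs_mono by simp
qed

section \<open>Polynomial time and sequential composition\<close>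

definition runs_within :: "nat poly \<Rightarrow> com \<Rightarrow> bool" where
  "runs_within p c \<longleftrightarrow> (\<forall>\<rho> s. (\<forall>j. length (\<rho> j) \<le> s) \<longrightarrow>
     (\<forall>j. length (exec c \<rho> j) \<le> poly p s) \<and>
     (\<forall>k U T. 0 < k \<longrightarrow> uses c \<subseteq> U \<longrightarrow> U \<subseteq> {..<k} \<longrightarrow>
        runs k (compile c) (overlay U \<rho> T) (poly p s) (overlay U (exec c \<rho>) T)))"

text \<open>\<open>safe\<close> fixes one set of loop registers, so it cannot describe a program
  that fills a register and then loops over it. Bounds in terms of the longest register compose by
  substitution, which allows such phases to be put in sequence.\<close>

definition polytime :: "com \<Rightarrow> bool" where
  "polytime c \<longleftrightarrow> (\<exists>p. runs_within p c)"

lemma runs_withinD: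
  assumes "runs_within p c" "\<forall>j. length (\<rho> j) \<le> s"
  shows "length (exec c \<rho> j) \<le> poly p s"
    and "0 < k \<Longrightarrow> uses c \<subseteq> U \<Longrightarrow> U \<subseteq> {..<k} \<Longrightarrow>
      runs k (compile c) (overlay U \<rho> T) (poly p s) (overlay U (exec c \<rho>) T)"
  using assms unfolding runs_within_def by simp_all

lemma polytime_safe:
  assumes "finite R" "safe R c"
  shows "polytime c"
proof -
  let ?X = "[:0, 1:] :: nat poly"
  \<comment> \<open>The total length of the registers in \<open>R\<close> is at most
    \<open>card R\<close> times the longest length.\<close>
  define g where "g = pcompose (op_count c) [:0, card R:]"
  have "runs_within (?X + g + g * (12 * (?X + g) + 30)) c" (is "runs_within ?p c")
    unfolding runs_within_def
  proof (intro allI impI)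
    fix \<rho> :: regs and s assume s: "\<forall>j. length (\<rho> j) \<le> s"
    have r: "reg_size R \<rho> \<le> s * card R"
      using sum_bounded_above[of R "\<lambda>j. length (\<rho> j)" s] s by (simp add: reg_size_def mult.commute)
    have g: "poly g s = poly (op_count c) (s * card R)" by (simp add: g_def poly_pcompose)
    have "length (exec c \<rho> i) \<le> poly ?p s" for i
      using length_exec_le[OF assms r s, of i] by (simp add: g)
    moreover have "runs k (compile c) (overlay U \<rho> T) (poly ?p s) (overlay U (exec c \<rho>) T)"
      if "0 < k" "uses c \<subseteq> U" "U \<subseteq> {..<k}" for k U T
      by (rule runs_mono[OF runs_compile[OF assms(1) that(1) assms(2) that(2,3) r s]])
        (simp add: g op_cost_def numeral_poly)
    ultimately show "(\<forall>j. length (exec c \<rho> j) \<le> poly ?p s) \<and> (\<forall>k U T. 0 < k \<longrightarrow> uses c \<subseteq> U \<longrightarrow> U \<subseteq> {..<k} \<longrightarrow>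
        runs k (compile c) (overlay U \<rho> T) (poly ?p s) (overlay U (exec c \<rho>) T))" by blast
  qed
  then show ?thesis by (auto simp: polytime_def)
qed

lemma polytime_Seq:
  assumes "polytime c" "polytime d"
  shows "polytime (Seq c d)"
proof -
  obtain p q where p: "runs_within p c" and q: "runs_within q d"
    using assms by (auto simp: polytime_def)
  show ?thesis
    unfolding polytime_def runs_within_def
  proof (intro exI[of _ "p + pcompose q p"] allI impI conjI)
    fix \<rho> :: regs and s i assume s: "\<forall>j. length (\<rho> j) \<le> s"
    have s': "\<forall>j. length (exec c \<rho> j) \<le> poly p s" using runs_withinD(1)[OF p s] by blast
    show "length (exec (Seq c d) \<rho> i) \<le> poly (p + pcompose q p) s"
      using runs_withinD(1)[OF q s', of i] by (simp add: poly_pcompose)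
  next
    fix \<rho> :: regs and s k U T assume s: "\<forall>j. length (\<rho> j) \<le> s" and k: "0 < (k::nat)" "uses (Seq c d) \<subseteq> U" "U \<subseteq> {..<k}"
    have s': "\<forall>j. length (exec c \<rho> j) \<le> poly p s" using runs_withinD(1)[OF p s] by blast
    have u: "uses c \<subseteq> U" "uses d \<subseteq> U" using k(2) by auto
    from runs_Seq[OF runs_withinD(2)[OF p s k(1) u(1) k(3)] runs_withinD(2)[OF q s' k(1) u(2) k(3)]]
    show "runs k (compile (Seq c d)) (overlay U \<rho> T) (poly (p + pcompose q p) s) (overlay U (exec (Seq c d) \<rho>) T)"
      by (simp add: poly_pcompose)
  qed
qed

lemma lcom_ok_compile: "0 < k \<Longrightarrow> uses c \<subseteq> {..<k} \<Longrightarrow> lcom_ok k (compile c)"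
  by (induction c) (auto simp: push_code_def transfer_code_def rewind_def bit_symbol_def)

text \<open>With \<open>k + 1\<close> tapes, register \<open>k\<close> is the last tape, where the
  output is expected. The machine halts because the exit state has no transitions.\<close>

lemma polytime_computable_exec:
  assumes "polytime c" "uses c \<subseteq> {..k}"
  shows "polytime_computable (\<lambda>x. exec c ((\<lambda>_. [])(0 := x)) k)"
proof -
  let ?K = "Suc k"
  define M where "M = \<lparr>n_tapes = ?K, n_symbols = 3, n_states = Suc (code_size (compile c)),
    accepting = {}, delta = trans_of ?K 0 (compile c)\<rparr>"
  have U: "uses c \<subseteq> {..<?K}" using assms(2) by (simp add: lessThan_Suc_atMost)
  have ok: "lcom_ok ?K (compile c)" using U by (intro lcom_ok_compile) auto
  have tm: "turing_machine M"
    unfolding turing_machine_def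
  proof (intro conjI ballI)
    fix r assume "r \<in> delta M"
    then obtain q ss q' as where r: "r = (q, ss, q', as)" "(q, ss, q', as) \<in> trans_of ?K 0 (compile c)"
      by (cases r) (auto simp: M_def)
    have "q < code_size (compile c)" using trans_of_sources[of ?K 0 "compile c"] r(2)
      by (auto simp: sources_in_def)
    then show "case r of (q, ss, q', as) \<Rightarrow>
        q < n_states M \<and> length ss = n_tapes M \<and> (\<forall>s\<in>set ss. s < n_symbols M) \<and>
        q' < n_states M \<and> length as = n_tapes M \<and> (\<forall>(s, m)\<in>set as. s < n_symbols M)"
      using trans_of_wf[OF r(2) ok] r(1) by (auto simp: M_def)
  qed (auto simp: M_def)
  have det: "deterministic M"
    using trans_of_functional[of ?K 0 "compile c"] by (auto simp: deterministic_def functional_def M_def)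
  obtain p where p: "runs_within p c"
    using assms(1) by (auto simp: polytime_def)
  have "\<exists>n e. n \<le> poly p (length x) \<and> (step M ^^ n) (initial M x) e \<and> halted M e \<and>
      has_output e (exec c ((\<lambda>_. [])(0 := x)) k)" for x
  proof -
    let ?\<rho> = "(\<lambda>_. [])(0 := x) :: regs"
    let ?e = "\<lambda>_. input_tape []"
    let ?T = "overlay {..<?K} ?\<rho> ?e" and ?T' = "overlay {..<?K} (exec c ?\<rho>) ?e"
    have "runs ?K (compile c) ?T (poly p (length x)) ?T'"
      by (rule runs_withinD(2)[OF p]) (use U in auto)
    moreover have "tapes_ok ?T"
      using bit_symbol_range(2) by (auto simp: tapes_ok_def overlay_def input_tape_def)
    ultimately obtain n where n: "n \<le> poly p (length x)" "executes ?K (compile c) n ?T ?T'"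
      by (rule runsE)
    have n': "(step M ^^ n) (config_of ?K 0 ?T) (config_of ?K (0 + code_size (compile c)) ?T')"
      by (rule executesD[OF n(2)]) (simp_all add: M_def)
    have "map ?T [0..<?K] = input_tape x # replicate k (input_tape [])"
      by (intro nth_equalityI) (auto simp: overlay_def nth_Cons' simp del: upt_Suc)
    then have "config_of ?K 0 ?T = initial M x"
      by (simp add: config_of_def initial_def M_def)
    moreover have "halted M (config_of ?K (0 + code_size (compile c)) ?T')"
      using trans_of_sources[of ?K 0 "compile c"]
      by (auto simp: halted_def step_def config_of_def M_def sources_in_def)
    moreover have "has_output (config_of ?K (0 + code_size (compile c)) ?T') (exec c ?\<rho> k)"
      by (auto simp: has_output_def config_of_def overlay_def input_tape_def)
    ultimately show ?thesis using n n' by (metis (no_types, lifting))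
  qed
  then show ?thesis
    unfolding polytime_computable_def using tm det by blast
qed

section \<open>From computations to tilings\<close>

abbreviation west :: "'h \<times> 'v \<times> 'h \<times> 'v \<Rightarrow> 'h" where "west t \<equiv> fst t"
abbreviation south :: "'h \<times> 'v \<times> 'h \<times> 'v \<Rightarrow> 'v" where "south t \<equiv> fst (snd t)"
abbreviation east :: "'h \<times> 'v \<times> 'h \<times> 'v \<Rightarrow> 'h" where "east t \<equiv> fst (snd (snd t))"
abbreviation north :: "'h \<times> 'v \<times> 'h \<times> 'v \<Rightarrow> 'v" where "north t \<equiv> snd (snd (snd t))"

text \<open>Cell \<open>c\<close> borders on \<open>c + 1\<close> to its right and on \<open>c + W\<close> above it: the end of a row borders on the start of
  the next one.\<close>

definition tiling :: "'h \<Rightarrow> 'v \<Rightarrow> ('h \<times> 'v \<times> 'h \<times> 'v) set \<Rightarrow> nat \<Rightarrow> nat \<Rightarrow> 'v list \<Rightarrow>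
    (nat \<Rightarrow> 'h \<times> 'v \<times> 'h \<times> 'v) \<Rightarrow> bool" where
  "tiling h0 v0 S W N w \<theta> \<longleftrightarrow>
     (\<forall>c<N. \<theta> c \<in> S) \<and>
     west (\<theta> 0) = h0 \<and> east (\<theta> (N - 1)) = h0 \<and>
     (\<forall>c. Suc c < N \<longrightarrow> east (\<theta> c) = west (\<theta> (Suc c))) \<and>
     (\<forall>c<W. south (\<theta> c) = w ! c) \<and>
     (\<forall>c. c + W < N \<longrightarrow> north (\<theta> c) = south (\<theta> (c + W))) \<and>
     (\<forall>c<N. N \<le> c + W \<longrightarrow> north (\<theta> c) = v0)"

type_synonym rule = "nat \<times> nat list \<times> nat \<times> (nat \<times> move) list"

text \<open>The entries of a row: \<open>Wall\<close> marks its start, \<open>Ctl\<close> the state,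
  and \<open>Sym\<close> lists the symbols in one column, one for each tape.\<close>

datatype vcolour = Wall | Ctl nat | Sym "nat list" | Junk nat

instance move :: countable by countable_datatype
instance vcolour :: countable by countable_datatype

type_synonym hcolour = "rule \<times> bool \<times> nat list \<times> nat list"
type_synonym ctile = "hcolour option \<times> vcolour option \<times> hcolour option \<times> vcolour option"

definition source :: "rule \<Rightarrow> nat" where "source r = fst r"
definition scanned :: "rule \<Rightarrow> nat list" where "scanned r = fst (snd r)"
definition target :: "rule \<Rightarrow> nat" where "target r = fst (snd (snd r))"
definition actions :: "rule \<Rightarrow> (nat \<times> move) list" where "actions r = snd (snd (snd r))"

lemmas rule_sel = source_def scanned_def target_def actions_def

text \<open>A row gives the contents of all tapes relative to the heads, so that moving a head shifts its tape;
  \<open>after\<close> is the row between the writing and the shift.\<close>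

definition after :: "rule \<Rightarrow> (int \<Rightarrow> nat list) \<Rightarrow> int \<Rightarrow> nat list" where
  "after r g i = (if i = 0 then map fst (actions r) else g i)"

text \<open>When a head moves left, its tape appears shifted to the right, so the new entry comes
  from the left neighbour \<open>a\<close>.\<close>

definition shifted :: "rule \<Rightarrow> nat list \<Rightarrow> nat list \<Rightarrow> nat list \<Rightarrow> nat list" where
  "shifted r a b c = map (\<lambda>j. case snd (actions r ! j) of Go_Left \<Rightarrow> a ! j | Stay \<Rightarrow> b ! j | Go_Right \<Rightarrow> c ! j)
     [0..<length (actions r)]"

definition next_row :: "rule \<Rightarrow> (int \<Rightarrow> nat list) \<Rightarrow> int \<Rightarrow> nat list" where
  "next_row r g i = shifted r (after r g (i - 1)) (after r g i) (after r g (i + 1))"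

definition window :: "config \<Rightarrow> int \<Rightarrow> nat list" where
  "window c i = map (\<lambda>(h, t). t (h + i)) (snd c)"

locale ntm =
  fixes M :: tm
  assumes tm: "turing_machine M"
begin

abbreviation "k \<equiv> n_tapes M"

definition blank :: "nat list" where "blank = replicate k 0"

definition words :: "nat list set" where
  "words = {ss. set ss \<subseteq> {..<n_symbols M} \<and> length ss = k}"

text \<open>An accepting configuration is left by a transition to \<open>final\<close>; above its row all tiles have the colour
  \<open>None\<close> below and above.\<close>

definition final :: nat where "final = n_states M"

text \<open>They require that \<open>delta\<close> offers no transition, so a tiling cannot stop at
  an accepting state that the machine would leave.\<close>

definition halting_rules :: "rule set" where
  "halting_rules = {(q, ss, final, map (\<lambda>s. (s, Stay)) ss) | q ss. q \<in> accepting M \<and> q < n_states M \<and>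
     ss \<in> words \<and> (\<forall>r. (q, ss, r) \<notin> delta M)}"

definition rules :: "rule set" where
  "rules = delta M \<union> halting_rules"

definition up :: "rule \<Rightarrow> vcolour \<Rightarrow> vcolour option" where
  "up r v = (if target r = final then None else Some v)"

text \<open>The right border of a tile carries the transition, whether the next cell is the one under the heads, and
  the contents of the cells on both sides after writing.\<close>

definition cell_tiles :: "ctile set" where
  "cell_tiles = {(Some (r, f, a, b), Some (Sym s), Some (r, False, b, c), up r (Sym (shifted r a b c))) | r f a b c s.
     r \<in> rules \<and> a \<in> words \<and> b \<in> words \<and> c \<in> words \<and> s \<in> words \<and>
     b = (if f then map fst (actions r) else s) \<and> (f \<longrightarrow> s = scanned r)}"

text \<open>The state stands directly to the left of the scanned cell. This tile passes on both
  entries and raises the flag, whereupon the next cell compares the scanned symbols and applies the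
  writing.\<close>

definition control_tiles :: "ctile set" where
  "control_tiles = {(Some (r, False, a, b), Some (Ctl (source r)), Some (r, True, a, b), up r (Ctl (target r))) | r a b.
     r \<in> rules \<and> a \<in> words \<and> b \<in> words}"

definition edge_colours :: "hcolour option set" where
  "edge_colours = {Some (r, False, a, blank) | r a. r \<in> rules \<and> a \<in> words}"

text \<open>Here the transition of a row is guessed: the left border may carry any transition of the
  preceding row, or \<open>None\<close> on the first cell of the strip, and the right border starts
  with a new one.\<close>

definition wall_tiles :: "ctile set" where
  "wall_tiles = {(l, Some Wall, Some (r, False, blank, c), up r Wall) | l r c.
     l \<in> insert None edge_colours \<and> r \<in> rules \<and> c \<in> words}"

text \<open>The first closing tile still borders on the end of the accepting row, hence the edge
  colours on its left.\<close>

definition close_tiles :: "ctile set" where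
  "close_tiles = {(l, None, None, None) | l. l \<in> insert None edge_colours}"

text \<open>Never usable; they ensure that there are at least three tiles.\<close>

definition junk_tiles :: "ctile set" where
  "junk_tiles = {(None, Some (Junk 0), None, None), (None, Some (Junk 1), None, None)}"

definition tiles :: "ctile set" where
  "tiles = cell_tiles \<union> control_tiles \<union> wall_tiles \<union> close_tiles \<union> junk_tiles"

lemmas tile_defs = cell_tiles_def control_tiles_def wall_tiles_def close_tiles_def junk_tiles_def edge_colours_def

lemma delta_wf:
  assumes "(q, ss, q', as) \<in> delta M"
  shows "q < n_states M" "ss \<in> words" "q' < n_states M" "length as = k" "map fst as \<in> words"
  using tm assms unfolding turing_machine_def words_def by fastforce+

lemma rules_wf:
  assumes "r \<in> rules"
  shows "source r < n_states M" "scanned r \<in> words" "target r \<le> final" "length (actions r) = k"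
    "map fst (actions r) \<in> words"
proof -
  obtain q ss q' as where r: "r = (q, ss, q', as)" by (cases r)
  consider "r \<in> delta M" | "r \<in> halting_rules" using assms by (auto simp: rules_def)
  then have "source r < n_states M \<and> scanned r \<in> words \<and> target r \<le> final \<and> length (actions r) = k \<and>
    map fst (actions r) \<in> words"
  proof cases
    case 1
    then show ?thesis using delta_wf[of q ss q' as] r by (auto simp: rule_sel final_def)
  next
    case 2
    then show ?thesis by (auto simp: halting_rules_def rule_sel words_def comp_def)
  qed
  then show "source r < n_states M" "scanned r \<in> words" "target r \<le> final" "length (actions r) = k"
    "map fst (actions r) \<in> words" by auto
qed

lemma finite_words: "finite words"
  unfolding words_def by (rule finite_lists_length_eq) simp

lemma finite_delta: "finite (delta M)"
proof (rule finite_subset)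
  let ?A = "{as. set as \<subseteq> {..<n_symbols M} \<times> {Go_Left, Stay, Go_Right} \<and> length as = k}"
  have "move \<in> {Go_Left, Stay, Go_Right}" for move by (cases move) auto
  then show "delta M \<subseteq> {..<n_states M} \<times> words \<times> {..<n_states M} \<times> ?A"
    using tm delta_wf unfolding turing_machine_def words_def by fastforce
  show "finite ({..<n_states M} \<times> words \<times> {..<n_states M} \<times> ?A)"
    by (intro finite_cartesian_product finite_words finite_lists_length_eq) auto
qed

lemma finite_rules: "finite rules"
proof -
  have "halting_rules \<subseteq> (\<lambda>(q, ss). (q, ss, final, map (\<lambda>s. (s, Stay)) ss)) ` ({..<n_states M} \<times> words)"
    by (auto simp: halting_rules_def)
  then show ?thesis unfolding rules_def
    using finite_delta finite_words by (meson finite_SigmaI finite_Un finite_imageI finite_lessThan finite_subset)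
qed

lemma finite_tiles: "finite tiles"
proof -
  have "cell_tiles \<subseteq> (\<lambda>(r, f, a, b, c, s). (Some (r, f, a, b), Some (Sym s), Some (r, False, b, c), up r (Sym (shifted r a b c)))) `
      (rules \<times> UNIV \<times> words \<times> words \<times> words \<times> words)"
    by (auto simp: cell_tiles_def image_iff)
  then have 1: "finite cell_tiles"
    by (rule finite_subset) (intro finite_imageI finite_cartesian_product finite_rules finite_words finite)
  have "control_tiles \<subseteq> (\<lambda>(r, a, b). (Some (r, False, a, b), Some (Ctl (source r)), Some (r, True, a, b), up r (Ctl (target r)))) `
      (rules \<times> words \<times> words)"
    by (auto simp: control_tiles_def image_iff)
  then have 2: "finite control_tiles"
    by (rule finite_subset) (intro finite_imageI finite_cartesian_product finite_rules finite_words finite)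
  have "edge_colours \<subseteq> (\<lambda>(r, a). Some (r, False, a, blank)) ` (rules \<times> words)"
    by (auto simp: edge_colours_def)
  then have e: "finite edge_colours"
    by (rule finite_subset) (intro finite_imageI finite_cartesian_product finite_rules finite_words finite)
  define E where "E = insert None edge_colours"
  have E: "finite E" using e by (simp add: E_def)
  have "wall_tiles \<subseteq> (\<lambda>(l, r, c). (l, Some Wall, Some (r, False, blank, c), up r Wall)) `
      (E \<times> rules \<times> words)"
    unfolding wall_tiles_def E_def[symmetric] by (auto simp: image_iff)
  then have 3: "finite wall_tiles"
    by (rule finite_subset) (intro finite_imageI finite_cartesian_product finite_rules finite_words E)
  have "close_tiles \<subseteq> (\<lambda>l. (l, None, None, None)) ` E"
    unfolding close_tiles_def E_def[symmetric] by auto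
  then have 4: "finite close_tiles"
    by (rule finite_subset) (intro finite_imageI E)
  show ?thesis using 1 2 3 4 by (simp add: tiles_def junk_tiles_def)
qed

lemma window_act:
  assumes "length (actions r) = length (snd c)"
  shows "window (q, map2 act (actions r) (snd c)) = next_row r (window c)"
proof (intro ext nth_equalityI)
  fix i
  show "length (window (q, map2 act (actions r) (snd c)) i) = length (next_row r (window c) i)"
    using assms by (simp add: window_def next_row_def shifted_def)
  fix j assume "j < length (window (q, map2 act (actions r) (snd c)) i)"
  then have j: "j < length (snd c)" using assms by (simp add: window_def)
  obtain h t where ht: "snd c ! j = (h, t)" by (cases "snd c ! j")
  obtain s m where sm: "actions r ! j = (s, m)" by (cases "actions r ! j")
  have "window (q, map2 act (actions r) (snd c)) i ! j = (t(h := s)) (h + offset m + i)"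
    using j assms ht sm by (simp add: window_def)
  also have "\<dots> = next_row r (window c) i ! j"
    using j assms ht sm
    by (cases m) (auto simp: next_row_def shifted_def after_def window_def algebra_simps)
  finally show "window (q, map2 act (actions r) (snd c)) i ! j = next_row r (window c) i ! j" .
qed

lemma map_scan_window: "map scan (snd c) = window c 0"
  by (auto simp: window_def)

lemma step_window:
  assumes "step M c c'" "length (snd c) = k"
  shows "\<exists>r\<in>delta M. source r = fst c \<and> scanned r = window c 0 \<and> fst c' = target r \<and>
    window c' = next_row r (window c) \<and> length (snd c') = k"
proof -
  obtain as where as: "(fst c, map scan (snd c), fst c', as) \<in> delta M" "snd c' = map2 act as (snd c)"
    using assms(1) by (auto simp: step_def)
  have len: "length as = k" using delta_wf[OF as(1)] by simp
  let ?r = "(fst c, map scan (snd c), fst c', as)"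
  have "window c' = next_row ?r (window c)"
    using window_act[of ?r c "fst c'"] as(2) len assms(2)
    by (cases c') (auto simp: rule_sel)
  then show ?thesis
    using as len assms(2) by (intro bexI[of _ ?r]) (auto simp: rule_sel map_scan_window)
qed

lemma delta_step:
  assumes "r \<in> delta M" "source r = fst c" "scanned r = window c 0" "length (snd c) = k"
  shows "\<exists>c'. step M c c' \<and> fst c' = target r \<and> window c' = next_row r (window c) \<and> length (snd c') = k"
proof -
  have len: "length (actions r) = k" using rules_wf(4)[of r] assms(1) by (simp add: rules_def)
  have "step M c (target r, map2 act (actions r) (snd c))"
    using assms by (cases r) (auto simp: step_def rule_sel map_scan_window)
  then show ?thesis
    using window_act[of r c "target r"] len assms(4) by (intro exI[of _ "(target r, map2 act (actions r) (snd c))"]) auto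
qed

end

text \<open>Column \<open>0\<close> of a row is a wall, column \<open>a + 1\<close> holds the state; \<open>cell_of\<close> gives the tape cell, relative
  to the heads, that lies to the left of the right border of a column.\<close>

definition cell_of :: "nat \<Rightarrow> nat \<Rightarrow> int" where
  "cell_of a pos = (if pos \<le> a then int pos - int a - 1 else int pos - int a - 2)"

context ntm
begin

section \<open>Rows of a tiling and successive configurations\<close>

definition row :: "nat \<Rightarrow> nat \<Rightarrow> (int \<Rightarrow> nat list) \<Rightarrow> nat \<Rightarrow> vcolour option" where
  "row a q g pos = (if pos = 0 then Some Wall else if pos = Suc a then Some (Ctl q)
     else Some (Sym (g (cell_of a pos))))"

definition border :: "nat \<Rightarrow> rule \<Rightarrow> (int \<Rightarrow> nat list) \<Rightarrow> nat \<Rightarrow> hcolour" where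
  "border a r g pos = (r, pos = Suc a, after r g (cell_of a pos), after r g (cell_of a pos + 1))"

definition top_row :: "nat \<Rightarrow> rule \<Rightarrow> (int \<Rightarrow> nat list) \<Rightarrow> nat \<Rightarrow> vcolour option" where
  "top_row a r g pos = (if target r = final then None else row a (target r) (next_row r g) pos)"

text \<open>The wall fixes the transition, and the rest follows from left to right. The right border
  of a tile guesses the entry of the next cell, which the next tile confirms; at the end of the row
  the edge colour confirms a blank. The assumption \<open>right\<close> looks at the upper colour of
  the wall because the row end borders on the tile above that wall.\<close>

lemma row_up:
  assumes t: "\<And>i. i < n \<Longrightarrow> \<theta> (b + i) \<in> tiles"
    and adj: "\<And>i. Suc i < n \<Longrightarrow> east (\<theta> (b + i)) = west (\<theta> (b + Suc i))"
    and south: "\<And>i. i < n \<Longrightarrow> south (\<theta> (b + i)) = row a q g i"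
    and n: "a + 2 < n" "0 < a"
    and right: "\<And>r. north (\<theta> b) = up r Wall \<Longrightarrow>
      east (\<theta> (b + (n - 1))) \<in> insert None edge_colours"
    and blank: "g (cell_of a 0) = blank" "g (cell_of a (n - 1) + 1) = blank"
  shows "\<exists>r\<in>rules. source r = q \<and> scanned r = g 0 \<and> (\<forall>i<n. north (\<theta> (b + i)) = top_row a r g i)"
proof -
  define wt et nt where "wt i = west (\<theta> (b + i))"
    and "et i = east (\<theta> (b + i))" and "nt i = north (\<theta> (b + i))" for i
  have tile: "(wt i, row a q g i, et i, nt i) \<in> tiles" if "i < n" for i
    using t[OF that] south[OF that] unfolding wt_def et_def nt_def by (metis prod.collapse)
  have adj: "et i = wt (Suc i)" if "Suc i < n" for i
    using adj[OF that] by (simp add: wt_def et_def)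
  have Wall: "\<exists>r\<in>rules. \<exists>c. e = Some (r, False, blank, c) \<and> u = up r Wall" if "(l, Some Wall, e, u) \<in> tiles" for l e u
    using that by (auto simp: tiles_def tile_defs)
  have Ctl: "\<exists>r x y. l = Some (r, False, x, y) \<and> e = Some (r, True, x, y) \<and> source r = p \<and> u = up r (Ctl (target r))"
    if "(l, Some (Ctl p), e, u) \<in> tiles" for l e u p
    using that by (auto simp: tiles_def tile_defs)
  have Sym: "\<exists>r f x y z. l = Some (r, f, x, y) \<and> e = Some (r, False, y, z) \<and>
      y = (if f then map fst (actions r) else s) \<and> (f \<longrightarrow> s = scanned r) \<and> u = up r (Sym (shifted r x y z))"
    if "(l, Some (Sym s), e, u) \<in> tiles" for l e u s
  proof -
    have "(l, Some (Sym s), e, u) \<in> cell_tiles"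
      using that by (auto simp: tiles_def control_tiles_def wall_tiles_def close_tiles_def junk_tiles_def)
    then show ?thesis
      unfolding cell_tiles_def mem_Collect_eq prod.inject option.inject vcolour.inject by metis
  qed
  have cell0: "cell_of a 0 = - int a - 1" by (simp add: cell_of_def)
  have row0: "row a q g 0 = Some Wall" by (simp add: row_def)
  from tile[of 0] n obtain r c0 where r: "r \<in> rules" "et 0 = Some (r, False, blank, c0)" "nt 0 = up r Wall"
    using Wall row0 by fastforce
  have a0: "after r g (cell_of a 0) = blank" using blank(1) n by (simp add: after_def cell0)
  \<comment> \<open>Transition, flag and left entry are forced; the right entry \<open>c\<close> is
    still a guess.\<close>
  have et: "\<exists>c. et i = Some (r, i = Suc a, after r g (cell_of a i), c)" if "i < n" for i
    using that
  proof (induction i)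
    case 0
    then show ?case using r(2) a0 by simp
  next
    case (Suc i)
    then obtain c where c: "wt (Suc i) = Some (r, i = Suc a, after r g (cell_of a i), c)"
      using adj[of i] by auto
    show ?case
    proof (cases "i = a")
      case True
      then show ?thesis using Ctl tile[OF Suc.prems] c by (fastforce simp: row_def cell_of_def)
    next
      case False
      have "cell_of a (Suc i) = 0 \<longleftrightarrow> i = Suc a" using False by (auto simp: cell_of_def)
      then show ?thesis
        using Sym[of "wt (Suc i)" "g (cell_of a (Suc i))" "et (Suc i)" "nt (Suc i)"] tile[OF Suc.prems] c False
        by (auto simp: row_def after_def)
    qed
  qed
  have cell: "\<exists>z. wt (Suc i) = Some (r, i = Suc a, after r g (cell_of a i), after r g (cell_of a (Suc i))) \<and>
      et (Suc i) = Some (r, False, after r g (cell_of a (Suc i)), z) \<and>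
      nt (Suc i) = up r (Sym (shifted r (after r g (cell_of a i)) (after r g (cell_of a (Suc i))) z)) \<and>
      (i = Suc a \<longrightarrow> g (cell_of a (Suc i)) = scanned r)"
    if si: "Suc i < n" and ia: "i \<noteq> a" for i
  proof -
    obtain c where c: "wt (Suc i) = Some (r, i = Suc a, after r g (cell_of a i), c)"
      using adj[of i] et[of i] si by auto
    have "cell_of a (Suc i) = 0 \<longleftrightarrow> i = Suc a" using ia by (auto simp: cell_of_def)
    then show ?thesis
      using Sym[of "wt (Suc i)" "g (cell_of a (Suc i))" "et (Suc i)" "nt (Suc i)"] tile[OF si] c ia
      by (auto simp: row_def after_def)
  qed
  have ctl: "source r = q \<and> nt (Suc a) = up r (Ctl (target r)) \<and>
      (\<exists>c. et (Suc a) = Some (r, True, after r g (cell_of a a), c) \<and> et a = Some (r, False, after r g (cell_of a a), c))"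
    using Ctl[of "wt (Suc a)" q "et (Suc a)" "nt (Suc a)"] tile[of "Suc a"] n adj[of a] et[of a]
    by (auto simp: row_def)
  have scan: "scanned r = g 0" using cell[of "Suc a"] n by (auto simp: cell_of_def)
  \<comment> \<open>The guess on border \<open>i\<close> is confirmed by tile \<open>Suc i\<close>.
    The exceptions are the control tile, which hands the guess on to its successor, and the last
    tile, where the edge colour decides.\<close>
  have border: "et i = Some (border a r g i)" if i: "i < n" for i
  proof -
    have succ: "cell_of a (Suc i) = cell_of a i + 1" if "i \<noteq> a" for i
      using that by (auto simp: cell_of_def)
    have b1: "et (Suc a) = Some (border a r g (Suc a))"
      using cell[of "Suc a"] adj[of "Suc a"] n succ[of "Suc a"] by (auto simp: border_def)
    consider "i = a" | "i = Suc a" | "Suc i = n" "i \<noteq> a" "i \<noteq> Suc a" | "Suc i < n" "i \<noteq> a" "i \<noteq> Suc a"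
      using i by linarith
    then show ?thesis
    proof cases
      case 1
      then show ?thesis using ctl b1 by (auto simp: border_def cell_of_def)
    next
      case 2
      then show ?thesis using b1 by simp
    next
      case 3
      have "et i \<in> edge_colours"
        using right[of r] r(3) 3(1) et[OF i] by (auto simp: et_def nt_def)
      moreover have "after r g (cell_of a i + 1) = blank"
        using blank(2) n 3 by (auto simp: after_def cell_of_def)
      ultimately show ?thesis
        using et[OF i] 3 by (auto simp: edge_colours_def border_def)
    next
      case 4
      then show ?thesis using cell[of i] adj[of i] succ[of i] by (auto simp: border_def)
    qed
  qed
  have "nt i = top_row a r g i" if i: "i < n" for i
  proof (cases i)
    case 0
    then show ?thesis using r by (simp add: top_row_def up_def row_def)
  next
    case (Suc j)
    show ?thesis
    proof (cases "j = a")
      case True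
      then show ?thesis using ctl Suc by (simp add: top_row_def up_def row_def)
    next
      case False
      have eq: "cell_of a j = cell_of a (Suc j) - 1" using False by (auto simp: cell_of_def)
      obtain z where z: "et (Suc j) = Some (r, False, after r g (cell_of a (Suc j)), z)"
        "nt (Suc j) = up r (Sym (shifted r (after r g (cell_of a j)) (after r g (cell_of a (Suc j))) z))"
        using cell[of j] i Suc False by auto
      have "z = after r g (cell_of a (Suc j) + 1)"
        using border[of "Suc j"] z(1) i Suc by (simp add: border_def)
      then show ?thesis
        using z(2) Suc False by (simp add: top_row_def up_def row_def next_row_def eq)
    qed
  qed
  then show ?thesis using r(1) ctl scan unfolding nt_def by blast
qed

lemma k_pos: "0 < k" using tm by (simp add: turing_machine_def)

lemma blank_words: "blank \<in> words"
  using tm by (auto simp: blank_def words_def turing_machine_def)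

lemma shifted_words:
  assumes "r \<in> rules" "a \<in> words" "b \<in> words" "c \<in> words"
  shows "shifted r a b c \<in> words"
proof -
  have "(case m of Go_Left \<Rightarrow> a ! j | Stay \<Rightarrow> b ! j | Go_Right \<Rightarrow> c ! j) < n_symbols M" if "j < k" for j m
  proof -
    have "w ! j < n_symbols M" if "w \<in> words" for w
    proof -
      have "w ! j \<in> set w" "set w \<subseteq> {..<n_symbols M}" using that \<open>j < k\<close> by (auto simp: words_def)
      then show ?thesis by blast
    qed
    then show ?thesis using assms by (cases m) auto
  qed
  then show ?thesis using rules_wf(4)[OF assms(1)] by (auto simp: shifted_def words_def)
qed

lemma shifted_blank: "r \<in> rules \<Longrightarrow> shifted r blank blank blank = blank"
  using rules_wf(4)[of r] by (auto simp: shifted_def blank_def intro!: nth_equalityI split: move.split)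

lemma after_words: "r \<in> rules \<Longrightarrow> g i \<in> words \<Longrightarrow> after r g i \<in> words"
  using rules_wf(5) by (simp add: after_def)

lemma window_initial:
  "window (initial M x) i =
    (if 0 \<le> i \<and> i < int (length x) then bit_symbol (x ! nat i) else 0) # replicate (k - 1) 0"
  by (auto simp: window_def initial_def input_tape_def)

lemma blank_Cons: "blank = 0 # replicate (k - 1) 0"
  using k_pos by (cases k) (auto simp: blank_def)

lemma bit_words: "bit_symbol b # replicate (k - 1) 0 \<in> words"
  using tm k_pos by (auto simp: words_def bit_symbol_def turing_machine_def)

text \<open>Even if the input is empty, \<open>t\<close> steps can leave a nonblank cell at distance \<open>t\<close> to the right of the
  head, whence the shift by one.\<close>

lemma reachable_window:
  "(step M ^^ t) (initial M x) c \<Longrightarrow> length (snd c) = k \<and> fst c < n_states M \<and> (\<forall>i. window c i \<in> words) \<and>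
     (\<forall>i. i < - int t \<or> int (length x + 1 + t) \<le> i \<longrightarrow> window c i = blank)"
proof (induction t arbitrary: c)
  case 0
  then show ?case
    using k_pos tm bit_words blank_words
    by (auto simp: window_initial blank_Cons) (auto simp: initial_def turing_machine_def)
next
  case (Suc t)
  then obtain b where b: "(step M ^^ t) (initial M x) b" "step M b c" by auto
  note IH = Suc.IH[OF b(1)]
  obtain r where r: "r \<in> delta M" "source r = fst b" "scanned r = window b 0" "fst c = target r"
    "window c = next_row r (window b)" "length (snd c) = k"
    using step_window[OF b(2)] IH by blast
  have rr: "r \<in> rules" using r(1) by (simp add: rules_def)
  have "target r < n_states M" using r(1) delta_wf(3) by (cases r) (auto simp: rule_sel)
  moreover have "window c i \<in> words" for i
    unfolding r(5) next_row_def using IH rr by (intro shifted_words after_words) auto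
  moreover have "window c i = blank" if "i < - int (Suc t) \<or> int (length x + 1 + Suc t) \<le> i" for i
  proof -
    have "after r (window b) j = blank" if "j \<in> {i - 1, i, i + 1}" for j
      using IH that \<open>i < - int (Suc t) \<or> _\<close> by (auto simp: after_def)
    then show ?thesis unfolding r(5) next_row_def using shifted_blank[OF rr] by simp
  qed
  ultimately show ?case using r by simp
qed

text \<open>The \<open>a\<close> blanks on either side leave room for every cell that fewer than
  \<open>a\<close> steps can change.\<close>

definition bottom :: "nat \<Rightarrow> bool list \<Rightarrow> vcolour option list" where
  "bottom a x = Some Wall # replicate a (Some (Sym blank)) @ Some (Ctl 0) #
     map (\<lambda>b. Some (Sym (bit_symbol b # replicate (k - 1) 0))) x @ replicate a (Some (Sym blank))"

lemma bottom_row: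
  assumes "i < 2 * a + length x + 2"
  shows "bottom a x ! i = row a 0 (window (initial M x)) i"
proof -
  consider "i = 0" | "0 < i" "i \<le> a" | "i = Suc a" | "Suc a < i" "i < a + 2 + length x" | "a + 2 + length x \<le> i"
    by linarith
  then show ?thesis
  proof cases
    case 4
    then have "i - a - 2 = nat (cell_of a i)" "0 \<le> cell_of a i" "cell_of a i < int (length x)"
      by (auto simp: cell_of_def)
    with 4 show ?thesis
      by (auto simp: bottom_def row_def window_initial nth_append nth_Cons' numeral_2_eq_2 diff_diff_add)
  qed (use assms in \<open>auto simp: bottom_def row_def window_initial blank_Cons nth_append nth_Cons' cell_of_def\<close>)
qed

definition accepts :: "bool list \<Rightarrow> bool" where
  "accepts x \<longleftrightarrow> (\<exists>n c. (step M ^^ n) (initial M x) c \<and> halted M c \<and> fst c \<in> accepting M)"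

text \<open>Row by row, the strip follows a computation until it uses a halting rule. If it never
  did, row \<open>a\<close> would witness a computation of \<open>a\<close> steps, contrary to
  \<open>bound\<close>.\<close>

lemma tiling_accepts:
  assumes tiling: "tiling None None tiles W (Suc a * W) (bottom a x) \<theta>"
    and W: "W = 2 * a + length x + 2" and a: "0 < a"
    and bound: "\<And>n c. (step M ^^ n) (initial M x) c \<Longrightarrow> n < a"
  shows "accepts x"
proof -
  have t: "\<theta> c \<in> tiles" if "c < Suc a * W" for c using tiling that by (auto simp: tiling_def)
  have adj: "east (\<theta> c) = west (\<theta> (Suc c))" if "Suc c < Suc a * W" for c
    using tiling that by (auto simp: tiling_def)
  have vadj: "north (\<theta> c) = south (\<theta> (c + W))" if "c + W < Suc a * W" for c
    using tiling that by (auto simp: tiling_def)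
  have "(\<exists>c. (step M ^^ t) (initial M x) c \<and> (\<forall>i<W. south (\<theta> (t * W + i)) = row a (fst c) (window c) i))
     \<or> accepts x" if "t \<le> a" for t
    using that
  proof (induction t)
    case 0
    have "fst (initial M x) = 0" by (simp add: initial_def)
    then show ?case using tiling bottom_row[of _ a x] by (auto simp: tiling_def W)
  next
    case (Suc t)
    show ?case
    proof (cases "accepts x")
      case False
      then obtain c where c: "(step M ^^ t) (initial M x) c"
        and south: "\<And>i. i < W \<Longrightarrow> south (\<theta> (t * W + i)) = row a (fst c) (window c) i"
        using Suc by auto
      have Wle: "t * W + W + W \<le> Suc a * W"
        using mult_le_mono1[of "Suc (Suc t)" "Suc a" W] Suc.prems by simp
      note inv = reachable_window[OF c]
      have "\<exists>r\<in>rules. source r = fst c \<and> scanned r = window c 0 \<and>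
          (\<forall>i<W. north (\<theta> (t * W + i)) = top_row a r (window c) i)"
      proof (rule row_up)
        fix i assume i: "i < W"
        show "\<theta> (t * W + i) \<in> tiles" using t Wle i by auto
        show "south (\<theta> (t * W + i)) = row a (fst c) (window c) i" using south i by blast
      next
        fix i assume i: "Suc i < W"
        show "east (\<theta> (t * W + i)) = west (\<theta> (t * W + Suc i))" using adj[of "t * W + i"] i Wle by auto
      next
        show "a + 2 < W" "0 < a" using a W by auto
        have "cell_of a 0 < - int t" using Suc.prems by (simp add: cell_of_def)
        then show "window c (cell_of a 0) = blank" using inv by blast
        have "int (length x + 1 + t) \<le> cell_of a (W - 1) + 1" using Suc.prems by (simp add: cell_of_def W)
        then show "window c (cell_of a (W - 1) + 1) = blank" using inv by blast
      next
        \<comment> \<open>Only wall and closing tiles have \<open>Wall\<close> or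
          \<open>None\<close> below. So one of them stands on the wall of this row, and its left
          border is the one on which the row ends.\<close>
        fix r assume "north (\<theta> (t * W)) = up r Wall"
        then have "south (\<theta> (t * W + W)) = up r Wall" using vadj[of "t * W"] Wle W by auto
        then have "south (\<theta> (t * W + W)) \<in> {None, Some Wall}" by (auto simp: up_def)
        moreover have "\<theta> (t * W + W) \<in> tiles" using t Wle W by auto
        ultimately have "west (\<theta> (t * W + W)) \<in> insert None edge_colours"
          by (auto simp: tiles_def cell_tiles_def control_tiles_def wall_tiles_def close_tiles_def junk_tiles_def)
        then show "east (\<theta> (t * W + (W - 1))) \<in> insert None edge_colours"
          using adj[of "t * W + (W - 1)"] Wle W by auto
      qed
      then obtain r where r: "r \<in> rules" "source r = fst c" "scanned r = window c 0"
        and north: "\<And>i. i < W \<Longrightarrow> north (\<theta> (t * W + i)) = top_row a r (window c) i" by blast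
      show ?thesis
      proof (cases "r \<in> delta M")
        case True
        then have fin: "target r \<noteq> final" using delta_wf(3) by (cases r) (force simp: rule_sel final_def)
        obtain c' where c': "step M c c'" "fst c' = target r" "window c' = next_row r (window c)"
          using delta_step[OF True r(2,3)] inv by blast
        have "south (\<theta> (Suc t * W + i)) = row a (fst c') (window c') i" if "i < W" for i
          using vadj[of "t * W + i"] north[OF that] fin c' that Wle by (auto simp: top_row_def add_ac)
        moreover have "(step M ^^ Suc t) (initial M x) c'" using c c' by auto
        ultimately show ?thesis by blast
      next
        case False
        then have "r \<in> halting_rules" using r(1) by (auto simp: rules_def)
        then have acc: "fst c \<in> accepting M" "\<And>r'. (fst c, window c 0, r') \<notin> delta M"
          using r by (auto simp: halting_rules_def rule_sel)
        then have "halted M c" by (auto simp: halted_def step_def map_scan_window)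
        then show ?thesis using acc c unfolding accepts_def by blast
      qed
    qed auto
  qed
  from this[of a] show ?thesis using bound by fastforce
qed

lemma control_tile:
  "r \<in> rules \<Longrightarrow> a \<in> words \<Longrightarrow> b \<in> words \<Longrightarrow> q = source r \<Longrightarrow> u = up r (Ctl (target r)) \<Longrightarrow>
    (Some (r, False, a, b), Some (Ctl q), Some (r, True, a, b), u) \<in> tiles"
  unfolding tiles_def control_tiles_def by blast

lemma cell_tile:
  "r \<in> rules \<Longrightarrow> a \<in> words \<Longrightarrow> b \<in> words \<Longrightarrow> c \<in> words \<Longrightarrow> s \<in> words \<Longrightarrow>
    b = (if f then map fst (actions r) else s) \<Longrightarrow> (f \<Longrightarrow> s = scanned r) \<Longrightarrow> u = up r (Sym (shifted r a b c)) \<Longrightarrow>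
    (Some (r, f, a, b), Some (Sym s), Some (r, False, b, c), u) \<in> tiles"
  unfolding tiles_def cell_tiles_def by blast

lemma wall_tile:
  "r \<in> rules \<Longrightarrow> c \<in> words \<Longrightarrow> l \<in> insert None edge_colours \<Longrightarrow> u = up r Wall \<Longrightarrow>
    (l, Some Wall, Some (r, False, blank, c), u) \<in> tiles"
  unfolding tiles_def wall_tiles_def by blast

lemma row_tile:
  assumes r: "r \<in> rules" "source r = q" "scanned r = g 0" and g: "\<And>i. g i \<in> words"
    and blank: "g (- int a - 1) = blank" and l: "pos = 0 \<Longrightarrow> l \<in> insert None edge_colours"
    "0 < pos \<Longrightarrow> l = Some (border a r g (pos - 1))" and a: "0 < a"
  shows "(l, row a q g pos, Some (border a r g pos), top_row a r g pos) \<in> tiles"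
proof -
  have w: "after r g i \<in> words" for i using after_words[OF r(1) g] .
  consider "pos = 0" | "pos = Suc a" | "0 < pos" "pos \<noteq> Suc a" by linarith
  then show ?thesis
  proof cases
    case 1
    have "border a r g 0 = (r, False, blank, after r g (cell_of a 0 + 1))"
      using blank by (auto simp: border_def after_def cell_of_def)
    moreover have "top_row a r g 0 = up r Wall" by (simp add: row_def top_row_def up_def)
    ultimately show ?thesis using 1 l(1) wall_tile[OF r(1) w] by (simp add: row_def)
  next
    case 2
    have "border a r g a = (r, False, after r g (-1), after r g 0)" "border a r g (Suc a) = (r, True, after r g (-1), after r g 0)"
      by (auto simp: border_def cell_of_def)
    moreover have "top_row a r g (Suc a) = up r (Ctl (target r))" by (simp add: row_def top_row_def up_def)
    ultimately show ?thesis using 2 l(2) control_tile[OF r(1) w w] r(2) by (simp add: row_def)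
  next
    case 3
    have eq: "cell_of a (pos - 1) = cell_of a pos - 1" using 3 by (auto simp: cell_of_def)
    have b: "border a r g pos = (r, False, after r g (cell_of a pos), after r g (cell_of a pos + 1))"
      "border a r g (pos - 1) = (r, pos - 1 = Suc a, after r g (cell_of a pos - 1), after r g (cell_of a pos))"
      using 3 unfolding border_def eq by auto
    have zero: "cell_of a pos = 0 \<longleftrightarrow> pos - 1 = Suc a" using 3 by (auto simp: cell_of_def)
    have "(Some (r, pos - 1 = Suc a, after r g (cell_of a pos - 1), after r g (cell_of a pos)), Some (Sym (g (cell_of a pos))),
        Some (r, False, after r g (cell_of a pos), after r g (cell_of a pos + 1)), top_row a r g pos) \<in> tiles"
      using 3 zero r(3) by (intro cell_tile r(1) w g) (auto simp: after_def top_row_def up_def row_def next_row_def)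
    then show ?thesis using 3 l(2) b by (simp add: row_def)
  qed
qed

text \<open>Rows up to \<open>n\<close> carry the accepting computation, row \<open>n\<close> with a
  halting rule, and closing tiles fill the rest. As \<open>n < a\<close>, the top row is closed,
  which gives the boundary colour \<open>None\<close>.\<close>

lemma accepts_tiling:
  assumes acc: "accepts x" and W: "W = 2 * a + length x + 2"
    and bound: "\<And>n c. (step M ^^ n) (initial M x) c \<Longrightarrow> n + 2 \<le> a"
  shows "\<exists>\<theta>. tiling None None tiles W (Suc a * W) (bottom a x) \<theta>"
proof -
  obtain n e where e: "(step M ^^ n) (initial M x) e" "halted M e" "fst e \<in> accepting M"
    using acc by (auto simp: accepts_def)
  then obtain C where C: "C 0 = initial M x" "C n = e" "\<And>i. i < n \<Longrightarrow> step M (C i) (C (Suc i))"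
    by (auto simp: relpowp_fun_conv)
  have n: "n + 2 \<le> a" using bound e by blast
  have reach: "(step M ^^ t) (initial M x) (C t)" if "t \<le> n" for t
    using that by (induction t) (auto simp: C(1) intro!: C(3) relcomppI)
  note inv = reachable_window[OF reach]
  have "\<exists>r\<in>rules. source r = fst (C t) \<and> scanned r = window (C t) 0 \<and>
      (if t = n then target r = final
       else target r \<noteq> final \<and> fst (C (Suc t)) = target r \<and> window (C (Suc t)) = next_row r (window (C t)))"
    if t: "t \<le> n" for t
  proof (cases "t = n")
    case True
    let ?r = "(fst e, window e 0, final, map (\<lambda>s. (s, Stay)) (window e 0))"
    have "(fst e, window e 0, r) \<notin> delta M" for r
    proof
      assume r: "(fst e, window e 0, r) \<in> delta M"
      have "length (snd e) = k" using inv[of n] C(2) by simp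
      from delta_step[OF r _ _ this] e(2) show False by (auto simp: rule_sel halted_def)
    qed
    then have "?r \<in> halting_rules" using e(3) inv[of n] C(2) by (auto simp: halting_rules_def)
    then show ?thesis using True C(2) by (intro bexI[of _ ?r]) (auto simp: rules_def rule_sel)
  next
    case False
    then have "t < n" using t by simp
    then obtain r where r: "r \<in> delta M" "source r = fst (C t)" "scanned r = window (C t) 0"
      "fst (C (Suc t)) = target r" "window (C (Suc t)) = next_row r (window (C t))"
      using step_window[OF C(3)] inv[OF t] by blast
    have "target r \<noteq> final" using delta_wf(3) r(1) by (cases r) (force simp: rule_sel final_def)
    then show ?thesis using r False by (intro bexI[of _ r]) (auto simp: rules_def)
  qed
  then obtain R where R: "\<And>t. t \<le> n \<Longrightarrow> R t \<in> rules \<and> source (R t) = fst (C t) \<and> scanned (R t) = window (C t) 0 \<and>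
      (if t = n then target (R t) = final
       else target (R t) \<noteq> final \<and> fst (C (Suc t)) = target (R t) \<and>
         window (C (Suc t)) = next_row (R t) (window (C t)))"
    by metis
  define East where "East t pos = (if t \<le> n then Some (border a (R t) (window (C t)) pos) else None)" for t pos
  define South where "South t pos = (if t \<le> n then row a (fst (C t)) (window (C t)) pos else None)" for t pos
  define West where "West t pos = (if pos = 0 then (if t = 0 then None else East (t - 1) (W - 1)) else East t (pos - 1))"
    for t pos
  define \<theta> where "\<theta> c = (West (c div W) (c mod W), South (c div W) (c mod W), East (c div W) (c mod W),
    South (Suc (c div W)) (c mod W))" for c
  have W0: "0 < W" using W by simp
  have last_edge: "East t (W - 1) \<in> insert None edge_colours" for t
  proof (cases "t \<le> n")
    case True
    have "int (length x + 1 + t) \<le> cell_of a (W - 1) + 1" using True n by (simp add: cell_of_def W)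
    then have "window (C t) (cell_of a (W - 1) + 1) = blank" using inv[OF True] by blast
    moreover have "cell_of a (W - 1) + 1 \<noteq> 0" using n by (simp add: cell_of_def W)
    ultimately have "border a (R t) (window (C t)) (W - 1) = (R t, False, after (R t) (window (C t)) (cell_of a (W - 1)), blank)"
      using n by (auto simp: border_def after_def W)
    moreover have "after (R t) (window (C t)) (cell_of a (W - 1)) \<in> words"
      using R[OF True] inv[OF True] by (intro after_words) auto
    moreover have "R t \<in> rules" using R[OF True] by blast
    ultimately have "Some (border a (R t) (window (C t)) (W - 1)) \<in> edge_colours"
      unfolding edge_colours_def by blast
    then show ?thesis using True by (simp add: East_def)
  qed (simp add: East_def)
  have mem: "(West t pos, South t pos, East t pos, South (Suc t) pos) \<in> tiles" for t pos
  proof (cases "t \<le> n")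
    case True
    have "- int a - 1 < - int t" using True n by simp
    then have b: "window (C t) (- int a - 1) = blank" using inv[OF True] by blast
    have "South (Suc t) pos = top_row a (R t) (window (C t)) pos"
      using R[OF True] True by (auto simp: South_def top_row_def)
    moreover have "West t pos \<in> insert None edge_colours" if "pos = 0"
      using that last_edge by (simp add: West_def)
    moreover have "West t pos = Some (border a (R t) (window (C t)) (pos - 1))" if "0 < pos"
      using that True by (simp add: West_def East_def)
    ultimately show ?thesis
      using row_tile[of "R t" "fst (C t)" "window (C t)" a pos "West t pos"] R[OF True] inv[OF True] b True n
      by (auto simp: East_def South_def)
  next
    case False
    have "West t pos \<in> insert None edge_colours"
    proof (cases "pos = 0")
      case True
      then show ?thesis using last_edge by (simp add: West_def)
    qed (use False in \<open>simp add: West_def East_def\<close>)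
    then show ?thesis using False by (auto simp: South_def East_def tiles_def close_tiles_def)
  qed
  have "tiling None None tiles W (Suc a * W) (bottom a x) \<theta>"
    unfolding tiling_def
  proof (intro conjI allI impI)
    show "\<theta> c \<in> tiles" for c unfolding \<theta>_def by (rule mem)
    show "west (\<theta> 0) = None" by (simp add: \<theta>_def West_def)
    have "(Suc a * W - 1) div W = a"
      using W0 by (intro div_nat_eqI) (auto simp: algebra_simps)
    then show "east (\<theta> (Suc a * W - 1)) = None" using n by (simp add: \<theta>_def East_def)
  next
    fix c
    show "east (\<theta> c) = west (\<theta> (Suc c))"
      using W0 by (auto simp: \<theta>_def West_def mod_Suc div_Suc intro!: arg_cong2[where f = East])
  next
    fix c assume "c < W"
    then show "south (\<theta> c) = bottom a x ! c"
      using bottom_row[of c a x] C(1) by (simp add: \<theta>_def South_def W initial_def)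
  next
    fix c
    show "north (\<theta> c) = south (\<theta> (c + W))" using W0 by (simp add: \<theta>_def)
  next
    fix c assume "c < Suc a * W" "Suc a * W \<le> c + W"
    then have "c div W = a" using W0 by (intro div_nat_eqI) (auto simp: algebra_simps)
    then show "north (\<theta> c) = None" using n by (simp add: \<theta>_def South_def)
  qed
  then show ?thesis by blast
qed

end

section \<open>Renaming the colours to numbers\<close>

lemma tiling_recolour:
  assumes "inj f" "inj g" and that: "W \<le> length ws" "0 < N" "W \<le> N"
  shows "(\<exists>\<theta>. tiling (f h0) (g v0) ((\<lambda>(w, s, e, n). (f w, g s, f e, g n)) ` S) W N (map g ws) \<theta>) \<longleftrightarrow>
    (\<exists>\<theta>. tiling h0 v0 S W N ws \<theta>)"
proof -
  let ?F = "\<lambda>(w, s, e, n). (f w, g s, f e, g n)"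
  have eq: "tiling (f h0) (g v0) (?F ` S) W N (map g ws) (\<lambda>c. ?F (\<theta> c)) \<longleftrightarrow> tiling h0 v0 S W N ws \<theta>" for \<theta>
  proof -
    have "inj ?F" using assms by (auto simp: inj_def)
    then have "?F (\<theta> c) \<in> ?F ` S \<longleftrightarrow> \<theta> c \<in> S" for c by (simp add: inj_image_mem_iff)
    moreover have "west (?F t) = f (west t)" "south (?F t) = g (south t)" "east (?F t) = f (east t)"
      "north (?F t) = g (north t)" for t
      by (cases t; simp)+
    ultimately show ?thesis
      using that by (simp add: tiling_def inj_eq[OF assms(1)] inj_eq[OF assms(2)])
  qed
  show ?thesis
  proof
    assume "\<exists>\<theta>. tiling (f h0) (g v0) (?F ` S) W N (map g ws) \<theta>"
    then obtain \<theta> where \<theta>: "tiling (f h0) (g v0) (?F ` S) W N (map g ws) \<theta>" by blast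
    \<comment> \<open>Outside the \<open>N\<close> cells \<open>\<theta>\<close> is arbitrary, so
      preimages are chosen on these cells only.\<close>
    then have "\<forall>c. \<exists>t. c < N \<longrightarrow> ?F t = \<theta> c" by (fastforce simp: tiling_def)
    then obtain \<theta>' where \<theta>': "\<And>c. c < N \<Longrightarrow> ?F (\<theta>' c) = \<theta> c" by metis
    have "tiling (f h0) (g v0) (?F ` S) W N (map g ws) (\<lambda>c. ?F (\<theta>' c))"
      using \<theta> that unfolding tiling_def by (simp only: \<theta>' diff_less) (auto simp: \<theta>')
    then show "\<exists>\<theta>. tiling h0 v0 S W N ws \<theta>" using eq by blast
  next
    assume "\<exists>\<theta>. tiling h0 v0 S W N ws \<theta>"
    then show "\<exists>\<theta>. tiling (f h0) (g v0) (?F ` S) W N (map g ws) \<theta>" using eq by blast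
  qed
qed

text \<open>The boundary colour \<open>None\<close> becomes 0, the boundary colour expected by the
  numerical gadget.\<close>

definition code :: "'a::countable option \<Rightarrow> nat" where
  "code z = (case z of None \<Rightarrow> 0 | Some x \<Rightarrow> Suc (to_nat x))"

lemma inj_code: "inj code"
  by (auto simp: inj_def code_def split: option.splits)

text \<open>The equivalence for all large \<open>a\<close> permits rounding the time bound up to a
  number that a program can easily compute.\<close>

theorem NP_tiling:
  assumes "L \<in> NP"
  shows "\<exists>(S :: (nat \<times> nat \<times> nat \<times> nat) set) wall cell ctl sym (p :: nat poly).
    finite S \<and> 3 \<le> card S \<and> (\<forall>x a. poly p (length x) + 2 \<le> a \<longrightarrow>
      (x \<in> L \<longleftrightarrow> (\<exists>\<theta>. tiling 0 0 S (2 * a + length x + 2) (Suc a * (2 * a + length x + 2))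
         (wall # replicate a cell @ ctl # map sym x @ replicate a cell) \<theta>)))"
proof -
  obtain M and p :: "nat poly" where M: "turing_machine M"
    and bound: "\<And>x n c. (step M ^^ n) (initial M x) c \<Longrightarrow> n \<le> poly p (length x)"
    and L: "\<And>x. x \<in> L \<longleftrightarrow> (\<exists>n c. (step M ^^ n) (initial M x) c \<and> halted M c \<and> fst c \<in> accepting M)"
    using assms unfolding NP_def by blast
  interpret ntm M by unfold_locales (rule M)
  let ?F = "\<lambda>(w, s, e, n). (code w, code s, code e, code n) :: nat \<times> nat \<times> nat \<times> nat"
  let ?S = "?F ` tiles"
  have inj: "inj ?F" by (rule injI) (auto simp: inj_eq[OF inj_code])
  let ?X = "{(None, None, None, None), (None, Some (Junk 0), None, None), (None, Some (Junk 1), None, None)} :: ctile set"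
  have "?X \<subseteq> tiles"
    by (auto simp: tiles_def junk_tiles_def close_tiles_def)
  then have "card ?X \<le> card tiles"
    using finite_tiles by (intro card_mono) auto
  then have card: "3 \<le> card ?S" by (simp add: card_image inj_on_subset[OF inj])
  have "x \<in> L \<longleftrightarrow> (\<exists>\<theta>. tiling 0 0 ?S (2 * a + length x + 2) (Suc a * (2 * a + length x + 2))
      (code (Some Wall) # replicate a (code (Some (Sym blank))) @ code (Some (Ctl 0)) #
       map (\<lambda>b. code (Some (Sym (bit_symbol b # replicate (k - 1) 0)))) x @ replicate a (code (Some (Sym blank)))) \<theta>)"
    (is "_ \<longleftrightarrow> (\<exists>\<theta>. tiling 0 0 ?S ?W ?N ?w \<theta>)") if a: "poly p (length x) + 2 \<le> a" for x a
  proof -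
    have "x \<in> L \<longleftrightarrow> accepts x" unfolding accepts_def by (rule L)
    also have "\<dots> \<longleftrightarrow> (\<exists>\<theta>. tiling None None tiles ?W ?N (bottom a x) \<theta>)"
      using tiling_accepts[of ?W a x] accepts_tiling[of x ?W a] bound a by fastforce
    also have "\<dots> \<longleftrightarrow> (\<exists>\<theta>. tiling (code (None :: hcolour option)) (code (None :: vcolour option)) ?S ?W ?N (map code (bottom a x)) \<theta>)"
      by (rule tiling_recolour[where f = "code :: hcolour option \<Rightarrow> nat" and g = "code :: vcolour option \<Rightarrow> nat", OF inj_code inj_code, symmetric]) (auto simp: bottom_def)
    also have "map code (bottom a x) = ?w" by (simp add: bottom_def)
    finally show ?thesis by (simp add: code_def)
  qed
  then show ?thesis using card finite_tiles by blast
qed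

section \<open>From tilings to balanced partitions\<close>

text \<open>Reduction modulo \<open>B\<close> kills the lowest digit, and division by
  \<open>B\<close> leads to the next. The leading coefficient may be arbitrarily large.\<close>

lemma signed_digits_zero:
  fixes e :: "nat \<Rightarrow> int"
  shows "(\<And>i. i < n \<Longrightarrow> \<bar>e i\<bar> < B) \<Longrightarrow> (\<Sum>i<n. e i * B ^ i) + e n * B ^ n = 0 \<Longrightarrow> i \<le> n \<Longrightarrow> e i = 0"
proof (induction n arbitrary: e i)
  case (Suc n)
  let ?r = "(\<Sum>i<n. e (Suc i) * B ^ i) + e (Suc n) * B ^ n"
  have eq: "e 0 + B * ?r = 0"
    using Suc.prems(2) unfolding sum.lessThan_Suc_shift
    by (simp add: sum_distrib_left algebra_simps)
  then have "B dvd e 0" by (metis dvd_add_times_triv_right_iff dvd_0_right mult.commute)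
  moreover have "\<bar>e 0\<bar> < B" using Suc.prems(1)[of 0] by simp
  ultimately have e0: "e 0 = 0"
    using dvd_imp_le_int[of "e 0" B] by linarith
  have "0 < B" using Suc.prems(1)[of 0] by simp
  with eq e0 have "?r = 0" by (metis add_0 less_irrefl mult_eq_0_iff)
  then have "e (Suc j) = 0" if "j \<le> n" for j
    using Suc.IH[of "\<lambda>i. e (Suc i)" j] Suc.prems(1) that by auto
  then show ?case using e0 Suc.prems(3) by (cases i) auto
qed simp

lemma three_digits_zero:
  fixes x y z B :: int
  assumes "\<bar>x\<bar> < B" "\<bar>y\<bar> < B" "x + B * y + B ^ 2 * z = 0"
  shows "x = 0 \<and> y = 0 \<and> z = 0"
proof -
  define e where "e i = (if i = 0 then x else if i = 1 then y else z)" for i :: nat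
  have "(\<Sum>i<2::nat. e i * B ^ i) + e 2 * B ^ 2 = 0"
    using assms by (simp add: e_def numeral_2_eq_2 algebra_simps)
  moreover have "\<bar>e i\<bar> < B" if "i < 2" for i using that assms by (auto simp: e_def less_2_cases_iff)
  ultimately have "e i = 0" if "i \<le> 2" for i using signed_digits_zero that by blast
  from this[of 0] this[of 1] this[of 2] show ?thesis by (simp add: e_def)
qed

lemma two_digits_zero:
  fixes x y B :: int
  assumes "\<bar>x\<bar> < B" "x + B * y = 0"
  shows "x = 0 \<and> y = 0"
proof -
  define e where "e i = (if i = 0 then x else y)" for i :: nat
  have "(\<Sum>i<1::nat. e i * B ^ i) + e 1 * B ^ 1 = 0" using assms by (simp add: e_def mult.commute)
  moreover have "\<bar>e i\<bar> < B" if "i < 1" for i using that assms by (simp add: e_def)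
  ultimately have "e i = 0" if "i \<le> 1" for i using signed_digits_zero that by blast
  from this[of 0] this[of 1] show ?thesis by (simp add: e_def)
qed

lemma three_digits_bound:
  fixes x y z B :: int
  assumes "\<bar>x\<bar> < B" "\<bar>y\<bar> < B" "\<bar>z\<bar> < B"
  shows "\<bar>x + B * y + B ^ 2 * z\<bar> < B ^ 3"
proof -
  have B: "0 < B" using assms by linarith
  have "\<bar>x + B * y + B ^ 2 * z\<bar> \<le> \<bar>x\<bar> + B * \<bar>y\<bar> + B ^ 2 * \<bar>z\<bar>"
    using B abs_triangle_ineq[of "x + B * y" "B ^ 2 * z"] abs_triangle_ineq[of x "B * y"]
    by (simp add: abs_mult)
  also have "\<dots> \<le> (B - 1) + B * (B - 1) + B ^ 2 * (B - 1)"
    using assms B by (intro add_mono mult_left_mono) auto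
  also have "\<dots> = B ^ 3 - 1" by (simp add: power2_eq_square power3_eq_cube algebra_simps)
  finally show ?thesis by simp
qed

section \<open>The numbers of the partition instance\<close>

type_synonym tile = "nat \<times> nat \<times> nat \<times> nat"

text \<open>In the partition made from a tiling, every item has a dummy with the same
  \<open>c\<close> and \<open>t\<close> on the opposite side, so that both sides have the same
  size.\<close>

datatype index = Plus | Minus | Item nat tile | Dummy nat tile

text \<open>The bound on \<open>B\<close> excludes carries: summed over all numbers, a digit is at
  most \<open>4 * K\<close>, from \<open>Plus\<close> and \<open>Minus\<close>, plus twice the total
  of the items. This total is at most \<open>2 * K * card S\<close> for \<open>H\<close> and
  \<open>V\<close>, and \<open>card S\<close> for \<open>P\<close>.\<close>

locale gadget =
  fixes S :: "tile set" and K W N B :: nat and w :: "nat list"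
  assumes finite: "finite S" and card: "3 \<le> card S"
    and bounds: "\<And>t. t \<in> S \<Longrightarrow> west t < K \<and> south t < K \<and> east t < K \<and> north t < K"
    and w: "length w = W" "\<And>i. i < W \<Longrightarrow> w ! i < K"
    and W: "2 \<le> W" "W \<le> N"
    and B: "4 * K * card S + 4 * K + 2 * card S + 3 \<le> B"
begin

definition J :: "index set" where
  "J = {Plus, Minus} \<union> (\<lambda>(c, t). Item c t) ` ({..<N} \<times> S) \<union> (\<lambda>(c, t). Dummy c t) ` ({..<N} \<times> S)"

text \<open>Item \<open>(c, t)\<close> stands for placing tile \<open>t\<close> on cell \<open>c\<close>. Position \<open>i\<close> of the three digit functions records the left
  border, the lower border of cell \<open>i\<close>, and the fact that cell \<open>i - W\<close> is tiled. Colours of a border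
  are entered as \<open>x\<close> from one side and \<open>K - x\<close> from the other, so that they match if the sum is \<open>K\<close>.\<close>

definition goal_H :: "nat \<Rightarrow> nat" where "goal_H i = (if i < N then K else 0)"
definition goal_V :: "nat \<Rightarrow> nat" where "goal_V i = (if i < W then K - w ! i else if i < N then K else 0)"
definition goal_P :: "nat \<Rightarrow> nat" where "goal_P i = (if i < W then 0 else 1)"

definition total_H :: "nat \<Rightarrow> nat" where
  "total_H i = (if i < N then \<Sum>t\<in>S. K - west t else 0) + (if 0 < i \<and> i \<le> N then \<Sum>t\<in>S. east t else 0)"
definition total_V :: "nat \<Rightarrow> nat" where
  "total_V i = (if i < N then \<Sum>t\<in>S. K - south t else 0) + (if W \<le> i then \<Sum>t\<in>S. north t else 0)"
definition total_P :: "nat \<Rightarrow> nat" where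
  "total_P i = (if i < W then 0 else card S)"

text \<open>If \<open>Plus\<close> and the chosen items stand against \<open>Minus\<close> and the
  other items, a digit balances iff \<open>total - 2 * goal + chosen = total - chosen\<close>, that
  is, iff \<open>chosen = goal\<close>. The summand \<open>2 * K\<close> keeps the subtraction from
  being truncated.\<close>

fun H :: "index \<Rightarrow> nat \<Rightarrow> nat" where
  "H Plus i = 2 * K + total_H i - 2 * goal_H i"
| "H Minus i = 2 * K"
| "H (Item c t) i = (if i = c then K - west t else if i = Suc c then east t else 0)"
| "H (Dummy c t) i = 0"

fun V :: "index \<Rightarrow> nat \<Rightarrow> nat" where
  "V Plus i = 2 * K + total_V i - 2 * goal_V i"
| "V Minus i = 2 * K"
| "V (Item c t) i = (if i = c then K - south t else if i = c + W then north t else 0)"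
| "V (Dummy c t) i = 0"

fun P :: "index \<Rightarrow> nat \<Rightarrow> nat" where
  "P Plus i = 2 * K + total_P i - 2 * goal_P i"
| "P Minus i = 2 * K"
| "P (Item c t) i = (if i = c + W then 1 else 0)"
| "P (Dummy c t) i = 0"

text \<open>Only two numbers have this digit, so a balanced partition separates \<open>Plus\<close>
  from \<open>Minus\<close>.\<close>

fun flag :: "index \<Rightarrow> nat" where
  "flag Plus = 1" | "flag Minus = 1" | "flag (Item c t) = 0" | "flag (Dummy c t) = 0"

abbreviation "D \<equiv> B ^ 3"
abbreviation "Z \<equiv> N + W"

definition block :: "index \<Rightarrow> nat \<Rightarrow> nat" where
  "block j i = H j i + B * V j i + B ^ 2 * P j i"

definition low :: "index \<Rightarrow> nat" where
  "low j = (\<Sum>i<Z. block j i * D ^ i) + flag j * D ^ Z"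

text \<open>The top digit forces the two sides of a partition to have the same number of elements.\<close>

definition num :: "index \<Rightarrow> nat" where
  "num j = low j + B * D ^ Z"

lemma sum_J:
  fixes f :: "index \<Rightarrow> 'b::comm_monoid_add"
  shows "sum f J = f Plus + f Minus + (\<Sum>c<N. \<Sum>t\<in>S. f (Item c t)) + (\<Sum>c<N. \<Sum>t\<in>S. f (Dummy c t))"
proof -
  have inj: "inj_on (\<lambda>(c, t). Item c t) X" "inj_on (\<lambda>(c, t). Dummy c t) X" for X by (auto simp: inj_on_def)
  define X Y where "X = (\<lambda>(c, t). Item c t) ` ({..<N} \<times> S)" and "Y = (\<lambda>(c, t). Dummy c t) ` ({..<N} \<times> S)"
  have "finite X" "finite Y" "X \<inter> Y = {}" "Plus \<notin> X \<union> Y" "Minus \<notin> X \<union> Y"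
    using finite by (auto simp: X_def Y_def)
  moreover have "J = insert Plus (insert Minus (X \<union> Y))" by (auto simp: J_def X_def Y_def)
  ultimately have "sum f J = f Plus + (f Minus + (sum f X + sum f Y))"
    by (simp add: sum.union_disjoint)
  then show ?thesis
    unfolding X_def Y_def sum.reindex[OF inj(1)] sum.reindex[OF inj(2)]
    by (simp add: sum.reindex[OF inj(1)] sum.reindex[OF inj(2)] sum.cartesian_product comp_def split_def add.assoc)
qed

lemma finite_J: "finite J" using finite by (simp add: J_def)

lemma K_pos: "0 < K"
proof -
  have "S \<noteq> {}" using card by auto
  then show ?thesis using bounds by fastforce
qed

lemma sum_delta_less: "(\<Sum>c<N. if i = c + d then (x c :: 'b::comm_monoid_add) else 0) = (if d \<le> i \<and> i < N + d then x (i - d) else 0)"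
proof -
  have "(\<Sum>c<N. if i = c + d then x c else 0) = (\<Sum>c<N. if c = i - d then (if d \<le> i then x c else 0) else 0)"
    by (intro sum.cong) auto
  then show ?thesis by auto
qed

lemma sum_H:
  fixes f :: "nat \<Rightarrow> nat \<Rightarrow> 'b::comm_monoid_add"
  shows "(\<Sum>c<N. if i = c then x c else if i = Suc c then y c else (0::'b)) =
    (if i < N then x i else 0) + (if 0 < i \<and> i \<le> N then y (i - 1) else 0)"
proof -
  have "(\<Sum>c<N. if i = c then x c else if i = Suc c then y c else 0) =
      (\<Sum>c<N. (if i = c + 0 then x c else 0) + (if i = c + 1 then y c else 0))"
    by (intro sum.cong) auto
  then show ?thesis by (simp only: sum.distrib sum_delta_less) (auto simp: le_less_Suc_eq)
qed

lemma sum_V: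
  "(\<Sum>c<N. if i = c then x c else if i = c + W then y c else (0::'b::comm_monoid_add)) =
    (if i < N then x i else 0) + (if W \<le> i \<and> i < Z then y (i - W) else 0)"
proof -
  have "(\<Sum>c<N. if i = c then x c else if i = c + W then y c else 0) =
      (\<Sum>c<N. (if i = c + 0 then x c else 0) + (if i = c + W then y c else 0))"
    using W by (intro sum.cong) auto
  then show ?thesis by (simp only: sum.distrib sum_delta_less) auto
qed

lemma sum_if: "(\<Sum>t\<in>S. if b then f t else g t) = (if b then sum f S else sum g S)"
  by simp

lemma items_H: "(\<Sum>c<N. \<Sum>t\<in>S. H (Item c t) i) = total_H i"
  by (simp only: H.simps sum_if sum_H sum.neutral_const total_H_def)

lemma items_V: "i < Z \<Longrightarrow> (\<Sum>c<N. \<Sum>t\<in>S. V (Item c t) i) = total_V i"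
  by (simp only: V.simps sum_if sum_V sum.neutral_const total_V_def) auto

lemma items_P: "i < Z \<Longrightarrow> (\<Sum>c<N. \<Sum>t\<in>S. P (Item c t) i) = total_P i"
  by (simp only: P.simps sum_if sum_delta_less sum.neutral_const total_P_def) auto

lemma goal_bounds: "2 * goal_H i \<le> 2 * K" "2 * goal_V i \<le> 2 * K" "2 * goal_P i \<le> 2 * K"
  using K_pos by (auto simp: goal_H_def goal_V_def goal_P_def)

lemma sum_S_bound: "(\<And>t. t \<in> S \<Longrightarrow> f t \<le> K) \<Longrightarrow> sum f S \<le> K * card S"
  using sum_bounded_above[of S f K] by (simp add: mult.commute)

lemma total_bounds: "total_H i \<le> 2 * (K * card S)" "total_V i \<le> 2 * (K * card S)" "total_P i \<le> card S"
proof -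
  have "(\<Sum>t\<in>S. K - west t) \<le> K * card S" "(\<Sum>t\<in>S. east t) \<le> K * card S"
    "(\<Sum>t\<in>S. K - south t) \<le> K * card S" "(\<Sum>t\<in>S. north t) \<le> K * card S"
    using bounds by (intro sum_S_bound; fastforce)+
  then show "total_H i \<le> 2 * (K * card S)" "total_V i \<le> 2 * (K * card S)" "total_P i \<le> card S"
    by (auto simp: total_H_def total_V_def total_P_def)
qed

lemma digit_sums:
  assumes "i < Z"
  shows "(\<Sum>j\<in>J. H j i) < B" "(\<Sum>j\<in>J. V j i) < B" "(\<Sum>j\<in>J. P j i) < B" "(\<Sum>j\<in>J. flag j) < B"
  using total_bounds[of i] B items_H[of i] items_V[OF assms] items_P[OF assms]
  unfolding sum_J by (auto simp del: H.simps(3) V.simps(3) P.simps(3))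

section \<open>Balanced partitions and tilings\<close>

definition signed :: "index set \<Rightarrow> (index \<Rightarrow> nat) \<Rightarrow> int" where
  "signed U f = (\<Sum>j\<in>J. if j \<in> U then int (f j) else - int (f j))"

lemma signed_add: "signed U (\<lambda>j. f j + g j) = signed U f + signed U g"
  unfolding signed_def sum.distrib[symmetric] by (intro sum.cong) auto

lemma signed_mult: "signed U (\<lambda>j. a * f j) = int a * signed U f"
  unfolding signed_def sum_distrib_left by (intro sum.cong) auto

lemma signed_sum: "signed U (\<lambda>j. \<Sum>i\<in>X. f i j) = (\<Sum>i\<in>X. signed U (f i))"
  by (induction X rule: infinite_finite_induct) (auto simp: signed_add, simp_all add: signed_def cong: if_cong)

lemma signed_bound: "\<bar>signed U f\<bar> \<le> int (sum f J)"
proof -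
  have "\<bar>signed U f\<bar> \<le> (\<Sum>j\<in>J. \<bar>if j \<in> U then int (f j) else - int (f j)\<bar>)"
    unfolding signed_def by (rule sum_abs)
  also have "\<dots> = (\<Sum>j\<in>J. int (f j))" by (intro sum.cong) auto
  finally show ?thesis by simp
qed

lemma signed_balanced:
  assumes "U \<subseteq> J"
  shows "signed U f = 0 \<longleftrightarrow> sum f U = sum f (J - U)"
proof -
  have "signed U f = (\<Sum>j\<in>J \<inter> {j. j \<in> U}. int (f j)) + (\<Sum>j\<in>J \<inter> - {j. j \<in> U}. - int (f j))"
    unfolding signed_def by (rule sum.If_cases) (rule finite_J)
  also have "J \<inter> {j. j \<in> U} = U" using assms by auto
  also have "J \<inter> - {j. j \<in> U} = J - U" by auto
  also have "(\<Sum>j\<in>U. int (f j)) + (\<Sum>j\<in>J - U. - int (f j)) = int (sum f U) - int (sum f (J - U))"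
    by (simp add: sum_negf)
  finally show ?thesis by linarith
qed

lemma signed_block: "signed U (\<lambda>j. block j i) =
    signed U (\<lambda>j. H j i) + int B * signed U (\<lambda>j. V j i) + (int B)\<^sup>2 * signed U (\<lambda>j. P j i)"
  unfolding block_def by (simp add: signed_add signed_mult)

lemma signed_num: "signed U num = (\<Sum>i<Z. signed U (\<lambda>j. block j i) * (int B ^ 3) ^ i) +
    (signed U flag + int B * signed U (\<lambda>j. 1)) * (int B ^ 3) ^ Z"
proof -
  have "num = (\<lambda>j. (\<Sum>i<Z. D ^ i * block j i) + (D ^ Z * flag j + (B * D ^ Z) * 1))"
    by (auto simp: num_def low_def algebra_simps)
  then have "signed U num = signed U \<dots>" by simp
  also have "\<dots> = (\<Sum>i<Z. signed U (\<lambda>j. block j i) * (int B ^ 3) ^ i) +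
    (signed U flag + int B * signed U (\<lambda>j. 1)) * (int B ^ 3) ^ Z"
    by (simp only: signed_add signed_sum signed_mult) (simp add: algebra_simps)
  finally show ?thesis .
qed

text \<open>Without carries, a signed sum vanishes only digit by digit. The signed sum of the common
  leading digits is a multiple of the difference of the two sizes, so this must be 0 as
  well.\<close>

lemma signed_num_zero:
  "signed U num = 0 \<longleftrightarrow> (\<forall>i<Z. signed U (\<lambda>j. H j i) = 0 \<and> signed U (\<lambda>j. V j i) = 0 \<and> signed U (\<lambda>j. P j i) = 0) \<and>
     signed U flag = 0 \<and> signed U (\<lambda>j. 1) = 0"
proof
  assume zero: "signed U num = 0"
  define e where "e i = (if i < Z then signed U (\<lambda>j. block j i) else signed U flag + int B * signed U (\<lambda>j. 1))" for i
  have small: "\<bar>signed U (\<lambda>j. H j i)\<bar> < int B" "\<bar>signed U (\<lambda>j. V j i)\<bar> < int B" "\<bar>signed U (\<lambda>j. P j i)\<bar> < int B"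
    "\<bar>signed U flag\<bar> < int B" if "i < Z" for i
    using digit_sums[OF that] signed_bound[of U "\<lambda>j. H j i"] signed_bound[of U "\<lambda>j. V j i"]
      signed_bound[of U "\<lambda>j. P j i"] signed_bound[of U flag] by linarith+
  have "\<bar>e i\<bar> < int B ^ 3" if "i < Z" for i
    using three_digits_bound[OF small(1-3)[OF that]] that by (simp add: e_def signed_block)
  moreover have "(\<Sum>i<Z. e i * (int B ^ 3) ^ i) + e Z * (int B ^ 3) ^ Z = 0"
    using zero by (simp add: signed_num e_def)
  ultimately have e: "e i = 0" if "i \<le> Z" for i using signed_digits_zero[of Z e "int B ^ 3" i] that by blast
  have "signed U (\<lambda>j. H j i) = 0 \<and> signed U (\<lambda>j. V j i) = 0 \<and> signed U (\<lambda>j. P j i) = 0" if "i < Z" for i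
    using three_digits_zero[OF small(1,2)[OF that]] e[of i] that by (simp add: e_def signed_block)
  moreover have "signed U flag = 0 \<and> signed U (\<lambda>j. 1) = 0"
    using two_digits_zero[OF small(4)[of 0]] e[of Z] W by (simp add: e_def)
  ultimately show "(\<forall>i<Z. signed U (\<lambda>j. H j i) = 0 \<and> signed U (\<lambda>j. V j i) = 0 \<and> signed U (\<lambda>j. P j i) = 0) \<and>
     signed U flag = 0 \<and> signed U (\<lambda>j. 1) = 0" by blast
next
  assume "(\<forall>i<Z. signed U (\<lambda>j. H j i) = 0 \<and> signed U (\<lambda>j. V j i) = 0 \<and> signed U (\<lambda>j. P j i) = 0) \<and>
     signed U flag = 0 \<and> signed U (\<lambda>j. 1) = 0"
  then show "signed U num = 0" by (simp add: signed_num signed_block)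
qed

definition chosen :: "index set \<Rightarrow> (index \<Rightarrow> nat) \<Rightarrow> nat" where
  "chosen U f = (\<Sum>c<N. \<Sum>t\<in>S. if Item c t \<in> U then f (Item c t) else 0)"

lemma signed_chosen:
  assumes "Plus \<in> U" "Minus \<notin> U" "\<And>c t. f (Dummy c t) = 0" "(\<Sum>c<N. \<Sum>t\<in>S. f (Item c t)) = tot"
    and "f Plus = 2 * K + tot - 2 * g" "f Minus = 2 * K" "2 * g \<le> 2 * K"
  shows "signed U f = 0 \<longleftrightarrow> chosen U f = g"
proof -
  have "(\<Sum>c<N. \<Sum>t\<in>S. if Item c t \<in> U then int (f (Item c t)) else - int (f (Item c t))) =
      (\<Sum>c<N. \<Sum>t\<in>S. 2 * (if Item c t \<in> U then int (f (Item c t)) else 0) - int (f (Item c t)))"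
    by (intro sum.cong) auto
  also have "\<dots> = 2 * int (chosen U f) - int tot"
    unfolding sum_subtractf sum_distrib_left[symmetric] chosen_def assms(4)[symmetric]
    by (simp add: if_distrib cong: if_cong)
  finally have items: "(\<Sum>c<N. \<Sum>t\<in>S. if Item c t \<in> U then int (f (Item c t)) else - int (f (Item c t))) =
      2 * int (chosen U f) - int tot" .
  have "(\<Sum>c<N. \<Sum>t\<in>S. if Dummy c t \<in> U then int (f (Dummy c t)) else - int (f (Dummy c t))) = 0"
    using assms(3) by (intro sum.neutral ballI) auto
  moreover have "int (f Plus) = 2 * int K + int tot - 2 * int g"
    using assms(5,7) by simp
  ultimately show ?thesis unfolding signed_def sum_J using items assms(1,2,6) by auto
qed

lemma signed_goals:
  assumes "Plus \<in> U" "Minus \<notin> U" "i < Z"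
  shows "signed U (\<lambda>j. H j i) = 0 \<longleftrightarrow> chosen U (\<lambda>j. H j i) = goal_H i"
    and "signed U (\<lambda>j. V j i) = 0 \<longleftrightarrow> chosen U (\<lambda>j. V j i) = goal_V i"
    and "signed U (\<lambda>j. P j i) = 0 \<longleftrightarrow> chosen U (\<lambda>j. P j i) = goal_P i"
  using assms items_H items_V items_P goal_bounds
  by (intro signed_chosen; simp)+

lemma chosen_graph:
  assumes "\<And>c. c < N \<Longrightarrow> \<theta> c \<in> S" "\<And>c t. c < N \<Longrightarrow> t \<in> S \<Longrightarrow> Item c t \<in> U \<longleftrightarrow> t = \<theta> c"
  shows "chosen U f = (\<Sum>c<N. f (Item c (\<theta> c)))"
proof -
  have "chosen U f = (\<Sum>c<N. \<Sum>t\<in>S. if t = \<theta> c then f (Item c (\<theta> c)) else 0)"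
    unfolding chosen_def using assms(2) by (intro sum.cong) auto
  then show ?thesis using assms(1) finite by simp
qed

text \<open>On an inner border, \<open>K - x + y = K\<close> means that the colours agree. Position
  0 and position \<open>N\<close> of \<open>H\<close>, and the first \<open>W\<close> and last
  \<open>W\<close> positions of \<open>V\<close>, get a contribution from one side only, which the
  goal compares with the boundary colour.\<close>

lemma graph_tiling:
  assumes \<theta>: "\<And>c. c < N \<Longrightarrow> \<theta> c \<in> S"
  shows "(\<forall>i<Z. (\<Sum>c<N. H (Item c (\<theta> c)) i) = goal_H i \<and> (\<Sum>c<N. V (Item c (\<theta> c)) i) = goal_V i \<and>
      (\<Sum>c<N. P (Item c (\<theta> c)) i) = goal_P i) \<longleftrightarrow> tiling 0 0 S W N w \<theta>" (is "?L \<longleftrightarrow> ?R")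
proof -
  have sums: "(\<Sum>c<N. H (Item c (\<theta> c)) i) =
      (if i < N then K - west (\<theta> i) else 0) + (if 0 < i \<and> i \<le> N then east (\<theta> (i - 1)) else 0)"
    "(\<Sum>c<N. V (Item c (\<theta> c)) i) =
      (if i < N then K - south (\<theta> i) else 0) + (if W \<le> i \<and> i < Z then north (\<theta> (i - W)) else 0)"
    "(\<Sum>c<N. P (Item c (\<theta> c)) i) = (if W \<le> i \<and> i < Z then 1 else 0)" for i
    by (simp_all only: H.simps V.simps P.simps sum_H sum_V sum_delta_less)
  have lt: "west (\<theta> c) < K" "south (\<theta> c) < K" "east (\<theta> c) < K" "north (\<theta> c) < K" if "c < N" for c
    using bounds[OF \<theta>[OF that]] by auto
  show ?thesis
  proof
    assume L: ?L
    have h: "(if i < N then K - west (\<theta> i) else 0) + (if 0 < i \<and> i \<le> N then east (\<theta> (i - 1)) else 0) = goal_H i"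
      and v: "(if i < N then K - south (\<theta> i) else 0) + (if W \<le> i then north (\<theta> (i - W)) else 0) = goal_V i"
      if "i < Z" for i using L that unfolding sums by auto
    show ?R
      unfolding tiling_def
    proof (intro conjI allI impI)
      show "c < N \<Longrightarrow> \<theta> c \<in> S" for c using \<theta> .
      show "west (\<theta> 0) = 0" using h[of 0] W lt(1)[of 0] by (auto simp: goal_H_def)
      show "east (\<theta> (N - 1)) = 0" using h[of N] W by (auto simp: goal_H_def)
      show "east (\<theta> c) = west (\<theta> (Suc c))" if "Suc c < N" for c
        using h[of "Suc c"] lt(1)[OF that] that by (auto simp: goal_H_def)
      show "south (\<theta> c) = w ! c" if "c < W" for c
        using v[of c] lt(2)[of c] w(2)[OF that] W that by (auto simp: goal_V_def)
      show "north (\<theta> c) = south (\<theta> (c + W))" if "c + W < N" for c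
        using v[of "c + W"] lt(2)[OF that] that by (auto simp: goal_V_def)
      show "north (\<theta> c) = 0" if "c < N" "N \<le> c + W" for c
        using v[of "c + W"] that by (auto simp: goal_V_def)
    qed
  next
    assume R: ?R
    have h: "(if i < N then K - west (\<theta> i) else 0) + (if 0 < i \<and> i \<le> N then east (\<theta> (i - 1)) else 0) = goal_H i" for i
      using R lt(1)[of i] W by (cases i) (auto simp: goal_H_def tiling_def le_Suc_eq less_Suc_eq_le)
    have v: "(if i < N then K - south (\<theta> i) else 0) + (if W \<le> i \<and> i < Z then north (\<theta> (i - W)) else 0) = goal_V i"
      if "i < Z" for i
    proof (cases "W \<le> i")
      case True
      then obtain c where "i = c + W" by (metis add.commute le_Suc_ex)
      then show ?thesis using R lt(2)[of i] that by (auto simp: goal_V_def tiling_def)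
    next
      case False
      then show ?thesis using R W by (auto simp: goal_V_def tiling_def)
    qed
    show ?L unfolding sums using h v by (auto simp: goal_P_def)
  qed
qed

lemma chosen_tiling:
  assumes "\<And>c. c < N \<Longrightarrow> \<theta> c \<in> S" "\<And>c t. c < N \<Longrightarrow> t \<in> S \<Longrightarrow> Item c t \<in> U \<longleftrightarrow> t = \<theta> c"
  shows "(\<forall>i<Z. chosen U (\<lambda>j. H j i) = goal_H i \<and> chosen U (\<lambda>j. V j i) = goal_V i \<and>
      chosen U (\<lambda>j. P j i) = goal_P i) \<longleftrightarrow> tiling 0 0 S W N w \<theta>"
proof -
  have "chosen U f = (\<Sum>c<N. f (Item c (\<theta> c)))" for f by (rule chosen_graph) (use assms in auto)
  then show ?thesis using graph_tiling[of \<theta>] assms(1) by simp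
qed

lemma chosen_P:
  assumes "c < N"
  shows "chosen U (\<lambda>j. P j (c + W)) = card {t \<in> S. Item c t \<in> U}"
proof -
  have "chosen U (\<lambda>j. P j (c + W)) = (\<Sum>c'<N. if c' = c then card {t \<in> S. Item c t \<in> U} else 0)"
    unfolding chosen_def using finite
    by (intro sum.cong) (auto simp: sum.If_cases Int_def)
  then show ?thesis using assms by simp
qed

text \<open>The digit \<open>P\<close> at position \<open>c + W\<close> counts the tiles chosen for
  cell \<open>c\<close>, and its goal is 1. So the chosen items form a function from cells to
  tiles.\<close>

lemma balanced_tiling:
  assumes "Plus \<in> U" "Minus \<notin> U" "signed U num = 0"
  shows "\<exists>\<theta>. tiling 0 0 S W N w \<theta>"
proof -
  have goals: "chosen U (\<lambda>j. H j i) = goal_H i" "chosen U (\<lambda>j. V j i) = goal_V i" "chosen U (\<lambda>j. P j i) = goal_P i"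
    if "i < Z" for i
    using assms signed_goals[OF assms(1,2) that] that by (auto simp: signed_num_zero)
  have "\<exists>!t. t \<in> S \<and> Item c t \<in> U" if "c < N" for c
  proof -
    have "card {t \<in> S. Item c t \<in> U} = 1"
      using goals(3)[of "c + W"] chosen_P[OF that, of U] that by (simp add: goal_P_def)
    then obtain t where "{t \<in> S. Item c t \<in> U} = {t}" by (auto simp: card_1_singleton_iff)
    then show ?thesis by (intro ex1I[of _ t]) auto
  qed
  then obtain \<theta> where \<theta>: "\<And>c. c < N \<Longrightarrow> \<theta> c \<in> S" "\<And>c t. c < N \<Longrightarrow> t \<in> S \<Longrightarrow> Item c t \<in> U \<longleftrightarrow> t = \<theta> c"
    by metis
  have "tiling 0 0 S W N w \<theta>"
    using goals by (intro chosen_tiling[OF \<theta>, THEN iffD1]) auto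
  then show ?thesis by blast
qed

lemma tiling_balanced:
  assumes "tiling 0 0 S W N w \<theta>"
  defines "U \<equiv> insert Plus ((\<lambda>c. Item c (\<theta> c)) ` {..<N} \<union> {Dummy c t | c t. c < N \<and> t \<in> S \<and> t \<noteq> \<theta> c})"
  shows "U \<subseteq> J" "Plus \<in> U" "Minus \<notin> U" "signed U num = 0" "card U = card (J - U)"
proof -
  have \<theta>: "\<theta> c \<in> S" if "c < N" for c using assms(1) that by (simp add: tiling_def)
  show "U \<subseteq> J" using \<theta> by (auto simp: U_def J_def)
  show pm: "Plus \<in> U" "Minus \<notin> U" by (auto simp: U_def)
  have item: "Item c t \<in> U \<longleftrightarrow> t = \<theta> c" and dummy: "Dummy c t \<in> U \<longleftrightarrow> t \<noteq> \<theta> c" if "c < N" "t \<in> S" for c t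
    using that by (simp_all add: U_def image_iff del: split_paired_All split_paired_Ex)
  have goals: "chosen U (\<lambda>j. H j i) = goal_H i" "chosen U (\<lambda>j. V j i) = goal_V i" "chosen U (\<lambda>j. P j i) = goal_P i"
    if "i < Z" for i
    using chosen_tiling[of \<theta> U] \<theta> item assms(1) that by auto
  have "signed U flag = 0" using pm by (simp add: signed_def sum_J cong: if_cong)
  moreover have one: "signed U (\<lambda>j. 1) = 0"
  proof -
    \<comment> \<open>Exactly one of \<open>Item c t\<close> and \<open>Dummy c t\<close> lies in
      \<open>U\<close>.\<close>
    have "(\<Sum>t\<in>S. if Item c t \<in> U then 1 else - 1 :: int) + (\<Sum>t\<in>S. if Dummy c t \<in> U then 1 else - 1) = 0" if "c < N" for c
      unfolding sum.distrib[symmetric] using item[OF that] dummy[OF that] by (intro sum.neutral) auto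
    then have "(\<Sum>c<N. (\<Sum>t\<in>S. if Item c t \<in> U then 1 else - 1 :: int) + (\<Sum>t\<in>S. if Dummy c t \<in> U then 1 else - 1)) = 0"
      by (intro sum.neutral) auto
    then show ?thesis using pm by (simp add: signed_def sum_J sum.distrib cong: if_cong)
  qed
  ultimately show "signed U num = 0"
    using goals signed_goals[OF pm] by (auto simp: signed_num_zero)
  have "sum (\<lambda>j. 1) U = sum (\<lambda>j. 1 :: nat) (J - U)"
    using signed_balanced[OF \<open>U \<subseteq> J\<close>] one by blast
  then show "card U = card (J - U)" by simp
qed

end

lemma digits_less:
  fixes e :: "nat \<Rightarrow> nat"
  shows "(\<And>i. i < n \<Longrightarrow> e i < D) \<Longrightarrow> (\<Sum>i<n. e i * D ^ i) < D ^ n"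
proof (induction n)
  case (Suc n)
  then have "(\<Sum>i<n. e i * D ^ i) < D ^ n" and "e n + 1 \<le> D" by (auto simp: Suc_leI)
  moreover from this(2) have "(e n + 1) * D ^ n \<le> D * D ^ n" by (intro mult_le_mono1)
  ultimately show ?case by simp
qed simp

lemma three_digits_less:
  fixes x y z B :: nat
  assumes "x < B" "y < B" "z < B"
  shows "x + B * y + B ^ 2 * z < B ^ 3"
proof -
  have "(\<Sum>i<3. [x, y, z] ! i * B ^ i) < B ^ 3"
    using assms by (intro digits_less) (auto simp: numeral_3_eq_3 less_Suc_eq)
  then show ?thesis by (simp add: numeral_3_eq_3 numeral_2_eq_2 mult.commute)
qed

text \<open>Different indices may have equal numbers, as all dummies do. So a splitting of the
  multiset of numbers has to be lifted to the index set.\<close>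

lemma image_mset_mset_set_split:
  assumes "finite J" "image_mset f (mset_set J) = A + B"
  shows "\<exists>U\<subseteq>J. A = image_mset f (mset_set U) \<and> B = image_mset f (mset_set (J - U))"
proof -
  obtain A' B' where AB: "mset_set J = A' + B'" "A = image_mset f A'" "B = image_mset f B'"
    using image_mset_eq_plusD[OF assms(2)] by blast
  have J: "J = set_mset A' \<union> set_mset B'" using AB(1) assms(1)
    by (metis finite_set_mset_mset_set set_mset_union)
  have c: "count A' x + count B' x = (if x \<in> J then 1 else 0)" for x
    using arg_cong[OF AB(1), of "\<lambda>m. count m x"] assms(1) by (simp add: count_mset_set')
  have single: "M = mset_set (set_mset M)" if "\<And>x. count M x \<le> 1" for M :: "'a multiset"
  proof (rule multiset_eqI)
    fix x
    have "count M x = 1" if "x \<in># M"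
      using \<open>\<And>x. count M x \<le> 1\<close>[of x] that count_greater_zero_iff[of M x] by linarith
    then show "count M x = count (mset_set (set_mset M)) x"
      by (cases "x \<in># M") (simp_all add: count_eq_zero_iff)
  qed
  have "count A' x \<le> 1" "count B' x \<le> 1" for x using c[of x] by (auto split: if_splits)
  then have sa: "A' = mset_set (set_mset A')" and sb: "B' = mset_set (set_mset B')" by (auto intro: single)
  have diff: "set_mset B' = J - set_mset A'"
  proof -
    have "set_mset A' \<inter> set_mset B' = {}"
    proof (rule ccontr)
      assume "\<not> ?thesis"
      then obtain x where "x \<in># A'" "x \<in># B'" by auto
      then have "1 \<le> count A' x" "1 \<le> count B' x" by (simp_all add: Suc_le_eq)
      moreover have "count A' x + count B' x \<le> 1" using c[of x] by simp
      ultimately show False by linarith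
    qed
    then show ?thesis using J by auto
  qed
  show ?thesis
  proof (intro exI conjI)
    show "set_mset A' \<subseteq> J" using J by blast
    show "A = image_mset f (mset_set (set_mset A'))" unfolding sa[symmetric] by (rule AB(2))
    show "B = image_mset f (mset_set (J - set_mset A'))" unfolding diff[symmetric] sb[symmetric] by (rule AB(3))
  qed
qed

context gadget
begin

lemma sum_blocks_less:
  assumes "X \<subseteq> J"
  shows "(\<Sum>j\<in>X. \<Sum>i<Z. block j i * D ^ i) < D ^ Z"
proof -
  have "(\<Sum>j\<in>X. block j i) < D" if "i < Z" for i
  proof -
    have "(\<Sum>j\<in>X. block j i) \<le> (\<Sum>j\<in>J. block j i)"
      using assms finite_J by (intro sum_mono2) auto
    also have "\<dots> = (\<Sum>j\<in>J. H j i) + B * (\<Sum>j\<in>J. V j i) + B ^ 2 * (\<Sum>j\<in>J. P j i)"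
      by (simp add: block_def sum.distrib sum_distrib_left)
    also have "\<dots> < D" using digit_sums[OF that] by (intro three_digits_less)
    finally show ?thesis .
  qed
  then have "(\<Sum>i<Z. (\<Sum>j\<in>X. block j i) * D ^ i) < D ^ Z" by (rule digits_less)
  then show ?thesis by (subst sum.swap) (simp add: sum_distrib_right)
qed

text \<open>The flag of \<open>Plus\<close> outweighs all low parts without a flag, and the common
  leading digit outweighs all low parts together. These are the two estimates that make the
  multiplicities on the path positive.\<close>

lemma low_less: 
  shows "(\<Sum>j\<in>J - {Plus, Minus}. low j) < D ^ Z" "D ^ Z \<le> low Plus" "(\<Sum>j\<in>J. low j) < B * D ^ Z"
proof -
  have "(\<Sum>j\<in>J - {Plus, Minus}. low j) = (\<Sum>j\<in>J - {Plus, Minus}. \<Sum>i<Z. block j i * D ^ i)"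
    by (intro sum.cong) (auto simp: low_def J_def)
  then show "(\<Sum>j\<in>J - {Plus, Minus}. low j) < D ^ Z" using sum_blocks_less[of "J - {Plus, Minus}"] by auto
  show "D ^ Z \<le> low Plus" by (simp add: low_def)
  have "(\<Sum>j\<in>J. low j) = (\<Sum>j\<in>J. \<Sum>i<Z. block j i * D ^ i) + (\<Sum>j\<in>J. flag j) * D ^ Z"
    by (simp add: low_def sum.distrib sum_distrib_right)
  also have "(\<Sum>j\<in>J. flag j) = 2" by (simp add: sum_J)
  also have "(\<Sum>j\<in>J. \<Sum>i<Z. block j i * D ^ i) + 2 * D ^ Z < 3 * D ^ Z" using sum_blocks_less[of J] by simp
  also have "\<dots> \<le> B * D ^ Z" using B by (intro mult_le_mono1) simp
  finally show "(\<Sum>j\<in>J. low j) < B * D ^ Z" .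
qed

text \<open>\<open>Plus\<close> comes first among the \<open>y\<close>, \<open>Minus\<close> last
  among the \<open>x\<close>. Since \<open>?D k\<close> compares equally many \<open>y\<close> and
  \<open>x\<close>, the leading digits cancel. For \<open>0 < k < n\<close> it is positive because
  it contains \<open>Plus\<close> and subtracts unflagged numbers only; it stays below
  \<open>num (x k)\<close> because of the leading digit of the latter.\<close>

lemma balanced_path:
  assumes d: "sorted_wrt (\<ge>) d" "mset d = image_mset num (mset_set J)"
    and U: "U \<subseteq> J" "Plus \<in> U" "Minus \<notin> U" "sum num U = sum num (J - U)" "card U = card (J - U)"
  shows "\<exists>H :: nat multigraph. realization H d \<and> is_path (underlying H)"
proof -
  have fin: "finite U" "finite (J - U)" using finite_J U(1) by (auto intro: finite_subset)
  have Minus: "Minus \<in> J - U" using U(3) by (auto simp: J_def)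
  obtain us where us: "set us = U - {Plus}" "distinct us" using fin finite_distinct_list[of "U - {Plus}"] by auto
  obtain vs where vs: "set vs = J - U - {Minus}" "distinct vs" using fin finite_distinct_list[of "J - U - {Minus}"] by auto
  define n where "n = card U"
  have n: "0 < n" using U(2) fin by (auto simp: n_def card_gt_0_iff)
  have len: "Suc (length us) = n" "Suc (length vs) = n"
    using distinct_card[OF us(2)] distinct_card[OF vs(2)] us(1) vs(1) U(2,5) Minus fin n
    by (auto simp: n_def)
  define y x where "y i = (Plus # us) ! i" and "x i = (vs @ [Minus]) ! i" for i
  have my: "map y [0..<n] = Plus # us" and mx: "map x [0..<n] = vs @ [Minus]"
    unfolding y_def x_def using len by (metis length_Cons map_nth, metis length_append_singleton map_nth)
  have injy: "inj_on y {..<n}" and injx: "inj_on x {..<n}"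
  proof -
    have "distinct (map y [0..<n])" unfolding my using us by simp
    then show "inj_on y {..<n}" by (simp add: distinct_map lessThan_atLeast0)
    have "distinct (map x [0..<n])" unfolding mx using vs by simp
    then show "inj_on x {..<n}" by (simp add: distinct_map lessThan_atLeast0)
  qed
  have imy: "y ` {..<n} = U" using arg_cong[OF my, of set] us U(2) by (auto simp: lessThan_atLeast0)
  have imx: "x ` {..<n} = J - U" using arg_cong[OF mx, of set] vs Minus by (auto simp: lessThan_atLeast0)
  have imx': "x ` {..<n - 1} \<subseteq> J - {Plus, Minus}"
  proof
    fix j assume "j \<in> x ` {..<n - 1}"
    then obtain i where i: "i < length vs" "j = x i" using len by auto
    then have "j \<in> set vs" by (simp add: x_def nth_append)
    then show "j \<in> J - {Plus, Minus}" using vs U(2) by auto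
  qed
  have y0: "y 0 = Plus" by (simp add: y_def)
  let ?D = "\<lambda>k. (\<Sum>i<k. int (num (y i))) - (\<Sum>i<k. int (num (x i)))"
  have D: "?D k = int (\<Sum>i<k. low (y i)) - int (\<Sum>i<k. low (x i))" for k
    by (simp add: num_def sum.distrib)
  show ?thesis
  proof (rule path_realization[of d "\<lambda>i. num (x i)" n "\<lambda>i. num (y i)"])
    show "sorted_wrt (\<ge>) d" by (rule d(1))
    have "mset (map (\<lambda>i. num (x i)) [0..<n]) = image_mset num (mset (map x [0..<n]))"
      "mset (map (\<lambda>i. num (y i)) [0..<n]) = image_mset num (mset (map y [0..<n]))"
      by (simp_all add: image_mset.compositionality comp_def)
    moreover have "mset (map x [0..<n]) = mset_set (J - U)" "mset (map y [0..<n]) = mset_set U"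
      using image_mset_mset_set[OF injx] image_mset_mset_set[OF injy] imx imy by (auto simp: lessThan_atLeast0)
    moreover have "mset_set J = mset_set (J - U) + mset_set U"
      using fin U(1) mset_set_Union[of "J - U" U] by (auto simp: Un_absorb2)
    ultimately show "mset d = mset (map (\<lambda>i. num (x i)) [0..<n]) + mset (map (\<lambda>i. num (y i)) [0..<n])"
      using d(2) by simp
    show "0 < n" by (rule n)
  next
    fix k assume k: "0 < k" "k < n"
    have "(\<Sum>i<k. low (x i)) = sum low (x ` {..<k})"
      using inj_on_subset[OF injx] k by (subst sum.reindex) auto
    also have "\<dots> \<le> sum low (J - {Plus, Minus})"
    proof (rule sum_mono2)
      have "x ` {..<k} \<subseteq> x ` {..<n - 1}" using k by (intro image_mono) auto
      then show "x ` {..<k} \<subseteq> J - {Plus, Minus}" using imx' by (rule order_trans)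
    qed (use finite_J in auto)
    also have "\<dots> < low Plus" using low_less by linarith
    also have "\<dots> \<le> (\<Sum>i<k. low (y i))"
      using member_le_sum[of 0 "{..<k}" "\<lambda>i. low (y i)"] k y0 by simp
    finally show "0 < ?D k" unfolding D by linarith
  next
    fix k assume k: "k < n"
    have "(\<Sum>i<k. low (y i)) = sum low (y ` {..<k})"
      using inj_on_subset[OF injy] k by (subst sum.reindex) auto
    also have "\<dots> \<le> sum low J"
    proof (rule sum_mono2)
      have "y ` {..<k} \<subseteq> y ` {..<n}" using k by (intro image_mono) auto
      then show "y ` {..<k} \<subseteq> J" using imy U(1) by simp
    qed (use finite_J in auto)
    also have "\<dots> < num (x k)" using low_less(3) by (simp add: num_def)
    finally show "?D k < int (num (x k))" unfolding D by linarith
  next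
    have "(\<Sum>i<n. num (y i)) = sum num U" "(\<Sum>i<n. num (x i)) = sum num (J - U)"
      using sum.reindex[OF injy, of num] sum.reindex[OF injx, of num] imx imy by simp_all
    then have "int (\<Sum>i<n. num (y i)) = int (\<Sum>i<n. num (x i))" using U(4) by simp
    then show "?D n = 0" unfolding of_nat_sum by simp
  qed
qed

theorem realizable_iff_tiling:
  fixes F :: "nat sgraph set"
  assumes F: "\<forall>G\<in>F. simple_graph G \<and> bipartite G" "\<forall>G. is_path G \<longrightarrow> G \<in> F"
    and d: "sorted_wrt (\<ge>) d" "mset d = image_mset num (mset_set J)"
  shows "(\<exists>H. realization H d \<and> underlying H \<in> F) \<longleftrightarrow> (\<exists>\<theta>. tiling 0 0 S W N w \<theta>)"
proof
  assume "\<exists>H. realization H d \<and> underlying H \<in> F"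
  then obtain A C where AC: "mset d = A + C" "sum_mset A = sum_mset C"
    using F(1) bipartite_realization_halves by blast
  then obtain U where U: "U \<subseteq> J" "A = image_mset num (mset_set U)" "C = image_mset num (mset_set (J - U))"
    using image_mset_mset_set_split[OF finite_J] d(2) by metis
  have eq: "sum num U = sum num (J - U)" using AC(2) U by (simp add: sum_unfold_sum_mset)
  then have z: "signed U num = 0" using signed_balanced[OF U(1)] by blast
  have z': "signed (J - U) num = 0" using signed_balanced[of "J - U" num] eq U(1) by (simp add: double_diff)
  \<comment> \<open>The flags put \<open>Plus\<close> and \<open>Minus\<close> on different sides;
    exchanging the sides if necessary, \<open>Plus\<close> lies in the set to which
    \<open>balanced_tiling\<close> is applied.\<close>
  have "signed U flag = 0" using z signed_num_zero by blast
  then have "Plus \<in> U \<longleftrightarrow> Minus \<notin> U"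
    by (auto simp: signed_def sum_J split: if_splits cong: if_cong)
  moreover have "Plus \<in> J" "Minus \<in> J" by (auto simp: J_def)
  ultimately show "\<exists>\<theta>. tiling 0 0 S W N w \<theta>"
    using balanced_tiling[of U] balanced_tiling[of "J - U"] z z' by blast
next
  assume "\<exists>\<theta>. tiling 0 0 S W N w \<theta>"
  then obtain \<theta> where "tiling 0 0 S W N w \<theta>" by blast
  note U = tiling_balanced[OF this]
  have "\<exists>H :: nat multigraph. realization H d \<and> is_path (underlying H)"
    by (rule balanced_path[OF d U(1-3) signed_balanced[OF U(1), THEN iffD1, OF U(4)] U(5)])
  then show "\<exists>H. realization H d \<and> underlying H \<in> F" using F(2) by blast
qed

end

section \<open>The encoded instance\<close>

fun bin :: "nat \<Rightarrow> nat \<Rightarrow> bool list" where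
  "bin 0 x = []"
| "bin (Suc m) x = odd x # bin m (x div 2)"

lemma bits_append: "x < 2 ^ m \<Longrightarrow> 0 < y \<Longrightarrow> bits (x + 2 ^ m * y) = bin m x @ bits y"
proof (induction m arbitrary: x)
  case (Suc m)
  have "(x + 2 ^ Suc m * y) div 2 = x div 2 + 2 ^ m * y"
    by (simp add: mult.assoc)
  then show ?case using Suc by (subst bits.simps) auto
qed simp

definition marked :: "bool list \<Rightarrow> bool list" where
  "marked bs = concat (map (\<lambda>b. [True, b]) bs)"

lemma marked_append: "marked (xs @ ys) = marked xs @ marked ys"
  by (simp add: marked_def)

lemma marked_concat: "marked (concat xss) = concat (map marked xss)"
  by (induction xss) (auto simp: marked_append, simp add: marked_def)

text \<open>The base is a power of two and the least significant bit comes first, so the digits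
  appear in order as words of \<open>m\<close> bits. The positive \<open>y\<close> on top keeps
  zeros at the end of these words from being dropped.\<close>

lemma bits_blocks:
  fixes h v p :: "nat \<Rightarrow> nat"
  assumes "\<And>i. i < n \<Longrightarrow> h i < 2 ^ m \<and> v i < 2 ^ m \<and> p i < 2 ^ m" "0 < y"
  shows "bits ((\<Sum>i<n. (h i + 2 ^ m * v i + (2 ^ m) ^ 2 * p i) * ((2 ^ m) ^ 3) ^ i) + ((2 ^ m) ^ 3) ^ n * y) =
    concat (map (\<lambda>i. bin m (h i) @ bin m (v i) @ bin m (p i)) [0..<n]) @ bits y"
  using assms
proof (induction n arbitrary: y)
  case (Suc n)
  let ?B = "2 ^ m :: nat"
  let ?y = "h n + ?B * (v n + ?B * (p n + ?B * y))"
  have split: "(\<Sum>i<Suc n. (h i + ?B * v i + ?B ^ 2 * p i) * (?B ^ 3) ^ i) + (?B ^ 3) ^ Suc n * y =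
      (\<Sum>i<n. (h i + ?B * v i + ?B ^ 2 * p i) * (?B ^ 3) ^ i) + (?B ^ 3) ^ n * ?y"
    by (simp add: algebra_simps power2_eq_square power3_eq_cube)
  have lt: "h n < ?B" "v n < ?B" "p n < ?B" using Suc.prems(1)[of n] by simp_all
  have pos: "0 < p n + ?B * y" "0 < v n + ?B * (p n + ?B * y)" "0 < ?y" using Suc.prems(2) by simp_all
  have IH: "bits ((\<Sum>i<n. (h i + ?B * v i + ?B ^ 2 * p i) * (?B ^ 3) ^ i) + (?B ^ 3) ^ n * ?y) =
      concat (map (\<lambda>i. bin m (h i) @ bin m (v i) @ bin m (p i)) [0..<n]) @ bits ?y"
    using Suc.prems(1) pos(3) by (intro Suc.IH) simp_all
  show ?case
    unfolding split IH bits_append[OF lt(1) pos(2)] bits_append[OF lt(2) pos(1)] bits_append[OF lt(3) Suc.prems(2)]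
    by simp
qed simp

definition digit_word :: "nat \<Rightarrow> nat \<Rightarrow> nat \<Rightarrow> nat \<Rightarrow> bool list" where
  "digit_word m h v p = marked (bin m h @ bin m v @ bin m p)"

text \<open>After the flag, the pair \<open>True, True\<close> is the marked leading digit 1, and
  \<open>False\<close> ends the number.\<close>

definition end_word :: "nat \<Rightarrow> nat \<Rightarrow> bool list" where
  "end_word m f = marked (bin m f) @ [True, True, False]"

text \<open>The key does not mention the cell or the width, yet it orders the tiles on each cell by
  their numbers. So the tiles can be sorted in advance, independently of the input.\<close>

locale gadget_bits = gadget S K W N B w for S :: "tile set" and K W N B w +
  fixes \<beta> :: nat and ts :: "tile list"
  assumes \<beta>: "B = 2 ^ \<beta>"
    and ts: "distinct ts" "set ts = S"
    and sorted_ts: "sorted_wrt (\<lambda>t t'. north t' * B ^ 4 + east t' * B ^ 3 + (K - south t') * B + (K - west t')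
        \<le> north t * B ^ 4 + east t * B ^ 3 + (K - south t) * B + (K - west t)) ts"
begin

definition items :: "nat \<Rightarrow> index list" where
  "items n = concat (map (\<lambda>c. map (Item c) ts) (rev [0..<n]))"

definition indices :: "index list" where
  "indices = Plus # Minus # items N @ concat (map (\<lambda>c. map (Dummy c) ts) [0..<N])"

definition degs :: "nat list" where "degs = map num indices"

lemma B2: "2 \<le> B" using B by simp

lemma B_pow_mono: "i \<le> j \<Longrightarrow> B ^ i \<le> B ^ j"
  using B2 by (intro power_increasing) auto

lemma mset_degs: "mset degs = image_mset num (mset_set J)"
proof -
  have inj: "inj (Item c)" "inj (Dummy c)" for c by (auto simp: inj_def)
  have "distinct (items n) \<and> set (items n) = (\<lambda>(c, t). Item c t) ` ({..<n} \<times> S)" for n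
    using ts by (induction n) (auto simp: items_def distinct_map inj_on_subset[OF inj(1)] image_iff)
  moreover have "distinct (concat (map (\<lambda>c. map (Dummy c) ts) [0..<n])) \<and>
      set (concat (map (\<lambda>c. map (Dummy c) ts) [0..<n])) = (\<lambda>(c, t). Dummy c t) ` ({..<n} \<times> S)" for n
    using ts by (induction n) (auto simp: distinct_map inj_on_subset[OF inj(2)] image_iff)
  ultimately have "distinct indices" "set indices = J"
    unfolding indices_def J_def by auto
  then have "mset indices = mset_set J" using mset_set_set by metis
  then show ?thesis by (simp add: degs_def)
qed

abbreviation lowpart :: "tile \<Rightarrow> nat" where
  "lowpart t \<equiv> (K - west t) + B * (K - south t) + D * east t"

lemma block_Item: "block (Item c t) i = (if i = c then (K - west t) + B * (K - south t) else 0) +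
    (if i = Suc c then east t else 0) + (if i = c + W then B * north t + B ^ 2 else 0)"
  using W by (auto simp: block_def)

lemma low_Item:
  assumes "c < N"
  shows "low (Item c t) = D ^ c * (lowpart t + D ^ W * (B * north t + B ^ 2))"
proof -
  have "low (Item c t) = (\<Sum>i<Z. (if i = c then ((K - west t) + B * (K - south t)) * D ^ c else 0) +
      (if i = Suc c then east t * D ^ Suc c else 0) + (if i = c + W then (B * north t + B ^ 2) * D ^ (c + W) else 0))"
    unfolding low_def block_Item using W by (auto intro!: sum.cong)
  also have "\<dots> = ((K - west t) + B * (K - south t)) * D ^ c + east t * D ^ Suc c + (B * north t + B ^ 2) * D ^ (c + W)"
    using assms W by (simp add: sum.distrib)
  finally show ?thesis by (simp add: algebra_simps power_add)
qed

lemma tile_less: "t \<in> S \<Longrightarrow> K - west t < B \<and> K - south t < B \<and> east t < B \<and> north t + 2 \<le> B"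
  using bounds[of t] B by auto

lemma lowpart_less: "t \<in> S \<Longrightarrow> lowpart t < B ^ 4"
proof -
  assume "t \<in> S"
  then have "K - west t \<le> B - 1" "K - south t \<le> B - 1" "east t \<le> B - 1" using tile_less by fastforce+
  then have "lowpart t \<le> (B - 1) + B * (B - 1) + D * (B - 1)" by (intro add_mono mult_le_mono) auto
  also have "\<dots> < B ^ 4"
  proof -
    obtain b where "B = Suc b" using B2 by (cases B) auto
    then show ?thesis by (simp add: algebra_simps power3_eq_cube power4_eq_xxxx)
  qed
  finally show ?thesis .
qed

lemma low_Item_less:
  assumes "t \<in> S" "c < N"
  shows "low (Item c t) < D ^ (c + W + 1)"
proof -
  have "lowpart t < D ^ W"
  proof -
    have "B ^ 4 \<le> B ^ (3 * W)" using W by (intro B_pow_mono) simp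
    then show ?thesis using lowpart_less[OF assms(1)] by (simp add: power_mult)
  qed
  then have "lowpart t + D ^ W * (B * north t + B ^ 2) < D ^ W * (B * north t + B ^ 2 + 1)" by simp
  also have "B * north t + B ^ 2 + 1 \<le> D"
  proof -
    have "B * north t + B ^ 2 + 1 \<le> B * (north t + 2) + B ^ 2" using B2 by simp
    also have "\<dots> \<le> B * B + B ^ 2" using tile_less[OF assms(1)] by (intro add_mono mult_le_mono) auto
    also have "\<dots> = 2 * B ^ 2" by (simp add: power2_eq_square)
    also have "\<dots> \<le> B * B ^ 2" using B2 by (intro mult_le_mono1)
    finally show ?thesis by (simp add: power2_eq_square power3_eq_cube)
  qed
  then have "D ^ W * (B * north t + B ^ 2 + 1) \<le> D ^ W * D" by (rule mult_le_mono2)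
  finally have "D ^ c * (lowpart t + D ^ W * (B * north t + B ^ 2)) < D ^ c * (D ^ W * D)"
    using B2 by (intro mult_strict_left_mono) auto
  then show ?thesis using low_Item[OF assms(2)] by (simp add: power_add algebra_simps)
qed

text \<open>Because of the digit \<open>P\<close>, the highest nonzero block of an item is at
  position \<open>c + W\<close>. With \<open>low_Item_less\<close> this puts the items of different
  cells into disjoint intervals.\<close>

lemma low_Item_ge:
  assumes "c < N"
  shows "D ^ (c + W) \<le> low (Item c t)"
proof -
  have "D ^ c * (D ^ W * 1) \<le> D ^ c * (lowpart t + D ^ W * (B * north t + B ^ 2))"
    using B2 by (intro mult_le_mono2 trans_le_add2) auto
  then show ?thesis using low_Item[OF assms] by (simp add: power_add)
qed

text \<open>As \<open>lowpart\<close> is below \<open>B ^ 4\<close>, raising the weight of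
  \<open>north t\<close> from \<open>B ^ 4\<close> in the key to \<open>D ^ W * B\<close> in the
  number does not change the order.\<close>

lemma low_Item_mono:
  assumes "c < N" "t \<in> S" "t' \<in> S" and key: "north t' * B ^ 4 + east t' * B ^ 3 + (K - south t') * B + (K - west t')
        \<le> north t * B ^ 4 + east t * B ^ 3 + (K - south t) * B + (K - west t)"
  shows "low (Item c t') \<le> low (Item c t)"
proof -
  let ?X = "lowpart t" and ?X' = "lowpart t'"
  have key': "north t' * B ^ 4 + ?X' \<le> north t * B ^ 4 + ?X" using key by (simp add: algebra_simps)
  have "?X' + D ^ W * (B * north t' + B ^ 2) \<le> ?X + D ^ W * (B * north t + B ^ 2)"
  proof (cases "north t' < north t")
    case True
    have "?X' \<le> B ^ 4" using lowpart_less[OF assms(3)] by simp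
    also have "B ^ 4 \<le> B ^ (3 * W + 1)" using W by (intro B_pow_mono) simp
    also have "\<dots> = D ^ W * B" by (simp add: power_mult)
    finally have "?X' + D ^ W * (B * north t' + B ^ 2) \<le> D ^ W * B + D ^ W * (B * north t' + B ^ 2)" by simp
    also have "\<dots> = D ^ W * (B * Suc (north t') + B ^ 2)" by (simp add: algebra_simps)
    also have "\<dots> \<le> D ^ W * (B * north t + B ^ 2)" using True by (intro mult_le_mono add_mono) auto
    finally show ?thesis by simp
  next
    case False
    have "north t' \<le> north t"
    proof (rule ccontr)
      assume "\<not> ?thesis"
      then have "(north t + 1) * B ^ 4 \<le> north t' * B ^ 4" by (intro mult_le_mono1) simp
      then show False using key' lowpart_less[OF assms(2)] by (simp add: algebra_simps)
    qed
    then show ?thesis using False key' by simp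
  qed
  then show ?thesis unfolding low_Item[OF assms(1)] by (rule mult_le_mono2)
qed

text \<open>The highest block decides: there the digit \<open>P\<close> is
  \<open>2 * K + card S - 2\<close> for \<open>Plus\<close> and \<open>2 * K\<close> for
  \<open>Minus\<close>. This is the reason for having at least three tiles.\<close>

lemma low_Plus: "low Minus \<le> low Plus"
proof -
  obtain z where z: "Z = Suc z" using W by (cases Z) auto
  have zN: "N \<le> z" "W \<le> z" using z W by auto
  have digits: "H Minus i < B" "V Minus i < B" "P Minus i < B" for i using B card by auto
  have "(\<Sum>i<z. block Minus i * D ^ i) < D ^ z"
    unfolding block_def using digits by (intro digits_less three_digits_less)
  moreover have "block Minus z + 1 \<le> block Plus z"
  proof -
    have "2 * K + B * (2 * K) < B ^ 2"
    proof -
      have "2 * K + B * (2 * K) = (B + 1) * (2 * K)" by simp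
      also have "\<dots> \<le> (B + 1) * (B - 1)" using B by (intro mult_le_mono2) simp
      also have "\<dots> < B ^ 2" using B2 by (simp add: power2_eq_square algebra_simps diff_mult_distrib2)
      finally show ?thesis .
    qed
    then have "block Minus z + 1 \<le> B ^ 2 * (2 * K + 1)" by (simp add: block_def algebra_simps)
    also have "\<dots> \<le> B ^ 2 * P Plus z"
      using zN card by (intro mult_le_mono2) (simp add: total_P_def goal_P_def)
    also have "\<dots> \<le> block Plus z" by (simp add: block_def)
    finally show ?thesis .
  qed
  then have "(block Minus z + 1) * D ^ z \<le> block Plus z * D ^ z" by (rule mult_le_mono1)
  ultimately have "(\<Sum>i<Z. block Minus i * D ^ i) \<le> block Plus z * D ^ z" unfolding z by simp
  also have "\<dots> \<le> (\<Sum>i<Z. block Plus i * D ^ i)" unfolding z by simp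
  finally show ?thesis by (simp add: low_def)
qed

lemma low_other_less: "j \<in> J \<Longrightarrow> j \<noteq> Plus \<Longrightarrow> j \<noteq> Minus \<Longrightarrow> low j < D ^ Z"
  using low_less(1) member_le_sum[of j "J - {Plus, Minus}" low] finite_J by fastforce

text \<open>The flags put \<open>Plus\<close> and \<open>Minus\<close> in front, the items follow by
  decreasing cells, and the dummies, whose low part is 0, come last.\<close>

lemma sorted_degs: "sorted_wrt (\<ge>) degs"
proof -
  let ?R = "\<lambda>j j'. low j' \<le> low j"
  have mem: "t \<in> set ts \<Longrightarrow> t \<in> S" for t using ts by simp
  have items: "sorted_wrt ?R (items n)" if "n \<le> N" for n
    using that
  proof (induction n)
    case (Suc n)
    have "sorted_wrt ?R (map (Item n) ts)"
      unfolding sorted_wrt_map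
      by (rule sorted_wrt_mono_rel[OF low_Item_mono sorted_ts]) (use mem Suc.prems in simp_all)
    moreover have "low (Item c t) \<le> low (Item n t')" if "c < n" "t \<in> S" for c t t'
    proof -
      have "low (Item c t) < D ^ (c + W + 1)" using low_Item_less that Suc.prems by simp
      also have "\<dots> \<le> D ^ (n + W)" using that B2 by (intro power_increasing) auto
      also have "\<dots> \<le> low (Item n t')" using low_Item_ge Suc.prems by simp
      finally show ?thesis by simp
    qed
    ultimately show ?case using Suc mem by (auto simp: items_def sorted_wrt_append)
  qed (simp add: items_def)
  define ds where "ds = concat (map (\<lambda>c. map (Dummy c) ts) [0..<N])"
  have ds: "low j = 0" if "j \<in> set ds" for j using that by (auto simp: ds_def low_def block_def)
  then have sorted_ds: "sorted_wrt ?R ds"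
    by (simp add: sorted_wrt_iff_nth_less)
  have item_less: "low j \<le> low Minus" if "j \<in> set (items N)" for j
  proof -
    obtain c t where "j = Item c t" "c < N" "t \<in> S" using \<open>j \<in> set (items N)\<close> mem by (auto simp: items_def)
    then have "low j < D ^ Z" by (intro low_other_less) (auto simp: J_def)
    also have "\<dots> \<le> low Minus" by (simp add: low_def)
    finally show ?thesis by simp
  qed
  have "sorted_wrt ?R (items N @ ds)"
    unfolding sorted_wrt_append using items[of N] sorted_ds ds by simp
  moreover have "low j \<le> low Minus" if "j \<in> set (items N @ ds)" for j
    using that ds item_less by auto
  ultimately have "sorted_wrt ?R indices"
    using low_Plus unfolding indices_def ds_def[symmetric] by (auto intro: order_trans)
  then show ?thesis by (simp add: degs_def sorted_wrt_map num_def)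
qed

text \<open>The base is even, so the parity of a number is that of its lowest digit.\<close>

lemma even_num: "even (num j + H j 0)"
proof -
  obtain z where z: "Z = Suc z" using W by (cases Z) auto
  have "even B" using \<beta> B2 by (cases \<beta>) auto
  moreover have "num j + H j 0 = 2 * H j 0 + B * V j 0 + B ^ 2 * P j 0 + D * (\<Sum>i<z. block j (Suc i) * D ^ i) +
      (flag j + B) * D ^ Suc z"
    by (simp only: num_def low_def z sum.lessThan_Suc_shift) (simp add: block_def sum_distrib_left algebra_simps)
  ultimately show ?thesis by simp
qed

lemma degree_sequence_degs: "degree_sequence degs"
  unfolding degree_sequence_def
proof (intro conjI ballI)
  show "sorted_wrt (\<ge>) degs" by (rule sorted_degs)
  show "0 < x" if "x \<in> set degs" for x
    using that B2 by (auto simp: degs_def num_def)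
  have "even (\<Sum>j\<in>J. num j + H j 0)" by (intro dvd_sum even_num)
  moreover have "even (\<Sum>j\<in>J. H j 0)"
  proof -
    \<comment> \<open>\<open>Plus\<close> contains the total of the items once more, so the sum is
      even whatever the parity of the total.\<close>
    have "(\<Sum>j\<in>J. H j 0) = 2 * (2 * K + total_H 0 - goal_H 0)"
      unfolding sum_J items_H using goal_bounds(1)[of 0] by (simp add: diff_mult_distrib2)
    then show ?thesis by simp
  qed
  ultimately have "even (sum num J)" by (simp add: sum.distrib)
  moreover have "sum_list degs = sum num J"
    using mset_degs by (metis sum_mset_sum_list sum_unfold_sum_mset)
  ultimately show "even (sum_list degs)" by simp
qed

lemma digit_less:
  assumes "j \<in> J" "i < Z"
  shows "H j i < B" "V j i < B" "P j i < B" "flag j < B"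
  using digit_sums[OF assms(2)] member_le_sum[OF assms(1), of "\<lambda>j. H j i"] member_le_sum[OF assms(1), of "\<lambda>j. V j i"]
    member_le_sum[OF assms(1), of "\<lambda>j. P j i"] member_le_sum[OF assms(1), of flag] finite_J by fastforce+

lemma encode_num:
  assumes "j \<in> J"
  shows "encode_nat (num j) = concat (map (\<lambda>i. digit_word \<beta> (H j i) (V j i) (P j i)) [0..<Z]) @ end_word \<beta> (flag j)"
proof -
  have num: "num j = (\<Sum>i<Z. block j i * D ^ i) + D ^ Z * (flag j + B * 1)"
    by (simp add: num_def low_def algebra_simps)
  have "bits (flag j + B * 1) = bin \<beta> (flag j) @ [True]"
    using digit_less(4)[OF assms, of 0] W bits_append[of "flag j" \<beta> 1]
    by (simp add: \<beta>) (simp add: bits.simps)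
  moreover have "bits ((\<Sum>i<Z. block j i * D ^ i) + D ^ Z * (flag j + B * 1)) =
      concat (map (\<lambda>i. bin \<beta> (H j i) @ bin \<beta> (V j i) @ bin \<beta> (P j i)) [0..<Z]) @ bits (flag j + B * 1)"
    using bits_blocks[of Z "H j" \<beta> "V j" "P j" "flag j + B * 1", folded \<beta>] digit_less[OF assms] B2
    by (simp add: block_def)
  ultimately have "bits (num j) =
      concat (map (\<lambda>i. bin \<beta> (H j i) @ bin \<beta> (V j i) @ bin \<beta> (P j i)) [0..<Z]) @ bin \<beta> (flag j) @ [True]"
    unfolding num by simp
  then show ?thesis
    by (simp add: encode_nat_def marked_def[symmetric] marked_append marked_concat digit_word_def end_word_def comp_def)
qed

end

section \<open>The code as a concatenation of constant words\<close>

abbreviation rep :: "nat \<Rightarrow> 'a list \<Rightarrow> 'a list" where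
  "rep n w \<equiv> concat (replicate n w)"

lemma upt_split: "l \<le> m \<Longrightarrow> m \<le> u \<Longrightarrow> [l..<u] = [l..<m] @ [m..<u]"
  using upt_add_eq_append[of l m "u - m"] by simp

lemma concat_map_const: "(\<And>i. l \<le> i \<Longrightarrow> i < u \<Longrightarrow> f i = v) \<Longrightarrow> concat (map f [l..<u]) = rep (u - l) v"
  by (rule arg_cong[of _ _ concat]) (auto intro!: nth_equalityI)

lemma map_nth_tl: "map (\<lambda>i. f (xs ! i)) [1..<length xs] = map f (tl xs)"
proof (cases xs)
  case (Cons y ys)
  have "map (\<lambda>i. f (xs ! i)) [1..<length xs] = map (\<lambda>i. f (ys ! i)) [0..<length ys]"
    unfolding Cons by (simp add: map_Suc_upt[symmetric] comp_def del: upt_Suc)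
  also have "\<dots> = map f ys" by (rule nth_equalityI) auto
  finally show ?thesis using Cons by simp
qed simp

lemma concat_map_concat: "concat (map f (concat (map g xs))) = concat (map (\<lambda>x. concat (map f (g x))) xs)"
  by (induction xs) auto

locale reduction =
  fixes S :: "tile set" and K \<beta> :: nat and ts :: "tile list" and wall cell ctl :: nat and sym :: "bool \<Rightarrow> nat"
  assumes finite: "finite S" and card: "3 \<le> card S"
    and bounds: "\<And>t. t \<in> S \<Longrightarrow> west t < K \<and> south t < K \<and> east t < K \<and> north t < K"
    and colours: "wall < K" "cell < K" "ctl < K" "\<And>b. sym b < K"
    and large: "4 * K * card S + 4 * K + 2 * card S + 3 \<le> 2 ^ \<beta>"
    and ts: "distinct ts" "set ts = S"
    and sorted_ts: "sorted_wrt (\<lambda>t t'. north t' * (2 ^ \<beta>) ^ 4 + east t' * (2 ^ \<beta>) ^ 3 + (K - south t') * 2 ^ \<beta> + (K - west t')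
        \<le> north t * (2 ^ \<beta>) ^ 4 + east t * (2 ^ \<beta>) ^ 3 + (K - south t) * 2 ^ \<beta> + (K - west t)) ts"
begin

definition width :: "nat \<Rightarrow> bool list \<Rightarrow> nat" where "width a x = 2 * a + length x + 2"
definition area :: "nat \<Rightarrow> bool list \<Rightarrow> nat" where "area a x = Suc a * width a x"
definition bottom_colours :: "nat \<Rightarrow> bool list \<Rightarrow> nat list" where
  "bottom_colours a x = wall # replicate a cell @ ctl # map sym x @ replicate a cell"

lemma gadget: "gadget_bits S K (width a x) (area a x) (2 ^ \<beta>) (bottom_colours a x) \<beta> ts"
proof unfold_locales
  show "bottom_colours a x ! i < K" if "i < width a x" for i
  proof -
    have "bottom_colours a x ! i \<in> set (bottom_colours a x)"
      using that by (intro nth_mem) (simp add: bottom_colours_def width_def)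
    then show ?thesis using colours by (auto simp: bottom_colours_def)
  qed
qed (use finite card bounds large ts sorted_ts in \<open>auto simp: bottom_colours_def width_def area_def\<close>)

definition "sum_w = (\<Sum>t\<in>S. K - west t)"
definition "sum_s = (\<Sum>t\<in>S. K - south t)"
definition "sum_e = (\<Sum>t\<in>S. east t)"
definition "sum_n = (\<Sum>t\<in>S. north t)"

text \<open>The blocks of \<open>Plus\<close> have five forms, depending on which cells touch the
  position: the first cell, the rest of the bottom row, the other cells, position \<open>N\<close>
  with the right border of the last cell, and the positions beyond.\<close>

definition "plus_first = digit_word \<beta> (2 * K + sum_w - 2 * K) (2 * K + sum_s - 2 * (K - wall)) (2 * K)"
definition "plus_bottom v = digit_word \<beta> (2 * K + (sum_w + sum_e) - 2 * K) (2 * K + sum_s - 2 * (K - v)) (2 * K)"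
definition "plus_inner = digit_word \<beta> (2 * K + (sum_w + sum_e) - 2 * K) (2 * K + (sum_s + sum_n) - 2 * K) (2 * K + card S - 2)"
definition "plus_after = digit_word \<beta> (2 * K + sum_e) (2 * K + sum_n) (2 * K + card S - 2)"
definition "plus_top = digit_word \<beta> (2 * K) (2 * K + sum_n) (2 * K + card S - 2)"
definition "minus_word = digit_word \<beta> (2 * K) (2 * K) (2 * K)"
definition "zero_word = digit_word \<beta> 0 0 0"
definition "lower_word t = digit_word \<beta> (K - west t) (K - south t) 0"
definition "right_word t = digit_word \<beta> (east t) 0 0"
definition "upper_word t = digit_word \<beta> 0 (north t) 1"

definition plus_code :: "nat \<Rightarrow> bool list \<Rightarrow> bool list" where
  "plus_code a x = plus_first @ rep a (plus_bottom cell) @ plus_bottom ctl @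
     concat (map (\<lambda>b. plus_bottom (sym b)) x) @ rep a (plus_bottom cell) @ rep (a * width a x) plus_inner @
     plus_after @ rep (width a x - 1) plus_top @ end_word \<beta> 1"

definition minus_code :: "nat \<Rightarrow> bool list \<Rightarrow> bool list" where
  "minus_code a x = rep (area a x + width a x) minus_word @ end_word \<beta> 1"

text \<open>\<open>i\<close> and \<open>j\<close> are the numbers of cells before and after the
  given one; \<open>v\<close> is the width minus 2, the number of positions strictly between the
  right and the upper border.\<close>

definition item_code :: "nat \<Rightarrow> nat \<Rightarrow> nat \<Rightarrow> tile \<Rightarrow> bool list" where
  "item_code v i j t = rep i zero_word @ lower_word t @ right_word t @ rep v zero_word @ upper_word t @
     rep j zero_word @ end_word \<beta> 0"

definition dummy_code :: "nat \<Rightarrow> bool list \<Rightarrow> bool list" where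
  "dummy_code a x = rep (area a x + width a x) zero_word @ end_word \<beta> 0"

definition code_of :: "nat \<Rightarrow> bool list \<Rightarrow> bool list" where
  "code_of a x = plus_code a x @ minus_code a x @
     concat (map (\<lambda>c. concat (map (item_code (width a x - 2) c (area a x - 1 - c)) ts)) (rev [0..<area a x])) @
     rep (area a x) (rep (length ts) (dummy_code a x))"

lemma encode_degs:
  "encode_seq (gadget_bits.degs S K (width a x) (area a x) (2 ^ \<beta>) (bottom_colours a x) ts) = code_of a x"
proof -
  let ?W = "width a x" and ?N = "area a x"
  interpret gadget_bits S K ?W ?N "2 ^ \<beta>" "bottom_colours a x" \<beta> ts by (rule gadget)
  have W2: "2 \<le> ?W" "?W \<le> ?N" "0 < ?N" by (auto simp: width_def area_def)
  have J: "Plus \<in> J" "Minus \<in> J" "c < ?N \<Longrightarrow> t \<in> S \<Longrightarrow> Item c t \<in> J" "c < ?N \<Longrightarrow> t \<in> S \<Longrightarrow> Dummy c t \<in> J" for c t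
    by (auto simp: J_def)
  have plus: "encode_nat (num Plus) = plus_code a x"
  proof -
    let ?f = "\<lambda>i. digit_word \<beta> (H Plus i) (V Plus i) (P Plus i)"
    have "?f i = plus_bottom (bottom_colours a x ! i)" if "1 \<le> i" "i < ?W" for i
      using that W2 by (simp add: plus_bottom_def total_H_def goal_H_def total_V_def goal_V_def total_P_def goal_P_def
          sum_w_def sum_e_def sum_s_def)
    then have "concat (map ?f [1..<?W]) = concat (map (\<lambda>i. plus_bottom (bottom_colours a x ! i)) [1..<?W])"
      by (intro arg_cong[of _ _ concat] map_cong) auto
    also have "map (\<lambda>i. plus_bottom (bottom_colours a x ! i)) [1..<?W] = map plus_bottom (tl (bottom_colours a x))"
      using map_nth_tl[of plus_bottom "bottom_colours a x"] by (simp add: w(1))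
    also have "concat (map plus_bottom (tl (bottom_colours a x))) = rep a (plus_bottom cell) @ plus_bottom ctl @
        concat (map (\<lambda>b. plus_bottom (sym b)) x) @ rep a (plus_bottom cell)"
      by (simp add: bottom_colours_def comp_def)
    finally have 1: "concat (map ?f [1..<?W]) = \<dots>" .
    have wall: "bottom_colours a x ! 0 = wall" by (simp add: bottom_colours_def)
    have 0: "?f 0 = plus_first"
      using W2 by (simp add: plus_first_def total_H_def goal_H_def total_V_def goal_V_def total_P_def goal_P_def
          sum_w_def sum_s_def wall)
    have 2: "concat (map ?f [?W..<?N]) = rep (?N - ?W) plus_inner"
      using W2 by (intro concat_map_const) (simp add: plus_inner_def total_H_def goal_H_def total_V_def goal_V_def
          total_P_def goal_P_def sum_w_def sum_e_def sum_s_def sum_n_def)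
    have 3: "?f ?N = plus_after"
      using W2 by (simp add: plus_after_def total_H_def goal_H_def total_V_def goal_V_def
          total_P_def goal_P_def sum_e_def sum_n_def)
    have 4: "concat (map ?f [Suc ?N..<?N + ?W]) = rep (?N + ?W - Suc ?N) plus_top"
      using W2 by (intro concat_map_const) (simp add: plus_top_def total_H_def goal_H_def total_V_def goal_V_def
          total_P_def goal_P_def sum_n_def)
    have "[0..<?N + ?W] = 0 # [1..<?W] @ [?W..<?N] @ ?N # [Suc ?N..<?N + ?W]"
      using W2 upt_split[of 0 1 "?N + ?W"] upt_split[of 1 ?W "?N + ?W"]
        upt_split[of ?W ?N "?N + ?W"] upt_conv_Cons[of ?N "?N + ?W"]
      by simp
    then have "concat (map ?f [0..<?N + ?W]) = ?f 0 @ concat (map ?f [1..<?W]) @ concat (map ?f [?W..<?N]) @ ?f ?N @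
        concat (map ?f [Suc ?N..<?N + ?W])" by simp
    then show ?thesis
      unfolding encode_num[OF J(1)] plus_code_def 0 1 2 3 4 by (simp add: area_def)
  qed
  have minus: "encode_nat (num Minus) = minus_code a x"
    unfolding encode_num[OF J(2)] minus_code_def minus_word_def by (simp add: map_replicate_const)
  have item: "encode_nat (num (Item c t)) = item_code (?W - 2) c (?N - 1 - c) t" if "c < ?N" "t \<in> S" for c t
  proof -
    let ?f = "\<lambda>i. digit_word \<beta> (H (Item c t) i) (V (Item c t) i) (P (Item c t) i)"
    have "[0..<?N + ?W] = [0..<c] @ c # Suc c # [Suc (Suc c)..<c + ?W] @ (c + ?W) # [Suc (c + ?W)..<?N + ?W]"
      using W2 that upt_split[of 0 c "?N + ?W"] upt_conv_Cons[of c "?N + ?W"] upt_conv_Cons[of "Suc c" "?N + ?W"]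
        upt_split[of "Suc (Suc c)" "c + ?W" "?N + ?W"] upt_conv_Cons[of "c + ?W" "?N + ?W"]
      by simp
    then have "concat (map ?f [0..<?N + ?W]) = concat (map ?f [0..<c]) @ ?f c @ ?f (Suc c) @
        concat (map ?f [Suc (Suc c)..<c + ?W]) @ ?f (c + ?W) @ concat (map ?f [Suc (c + ?W)..<?N + ?W])" by simp
    moreover have "concat (map ?f [0..<c]) = rep (c - 0) zero_word"
      by (intro concat_map_const) (simp add: zero_word_def)
    moreover have "concat (map ?f [Suc (Suc c)..<c + ?W]) = rep (c + ?W - Suc (Suc c)) zero_word"
      by (intro concat_map_const) (simp add: zero_word_def)
    moreover have "concat (map ?f [Suc (c + ?W)..<?N + ?W]) = rep (?N + ?W - Suc (c + ?W)) zero_word"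
      using W2 by (intro concat_map_const) (auto simp: zero_word_def)
    moreover have "?f c = lower_word t" "?f (Suc c) = right_word t" "?f (c + ?W) = upper_word t"
      using W2 by (simp_all add: lower_word_def right_word_def upper_word_def)
    moreover have "c + ?W - Suc (Suc c) = ?W - 2" "?N + ?W - Suc (c + ?W) = ?N - 1 - c" by auto
    ultimately show ?thesis unfolding encode_num[OF J(3)[OF that]] by (simp add: item_code_def)
  qed
  have dummy: "encode_nat (num (Dummy c t)) = dummy_code a x" if "c < ?N" "t \<in> S" for c t
    unfolding encode_num[OF J(4)[OF that]] dummy_code_def zero_word_def by (simp add: map_replicate_const)
  have items: "concat (map encode_nat (map num (items ?N))) =
      concat (map (\<lambda>c. concat (map (item_code (?W - 2) c (?N - 1 - c)) ts)) (rev [0..<?N]))"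
  proof -
    have "map (\<lambda>t. encode_nat (num (Item c t))) ts = map (item_code (?W - 2) c (?N - 1 - c)) ts" if "c < ?N" for c
      using item that ts by (intro map_cong) auto
    then show ?thesis
      unfolding items_def map_map comp_def concat_map_concat
      by (intro arg_cong[of _ _ concat] map_cong) (simp_all add: comp_def)
  qed
  have dummies: "concat (map encode_nat (map num (concat (map (\<lambda>c. map (Dummy c) ts) [0..<?N])))) =
      rep ?N (rep (length ts) (dummy_code a x))"
  proof -
    have "concat (map (\<lambda>t. encode_nat (num (Dummy c t))) ts) = rep (length ts) (dummy_code a x)" if "c < ?N" for c
    proof -
      have "map (\<lambda>t. encode_nat (num (Dummy c t))) ts = map (\<lambda>_. dummy_code a x) ts"
        using dummy that ts by (intro map_cong) auto
      then show ?thesis by (simp add: map_replicate_const)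
    qed
    then show ?thesis
      using concat_map_const[of 0 ?N "\<lambda>c. concat (map (\<lambda>t. encode_nat (num (Dummy c t))) ts)"]
      unfolding map_map comp_def concat_map_concat by (simp add: comp_def)
  qed
  show ?thesis
    unfolding encode_seq_def degs_def indices_def code_of_def using plus minus items dummies by simp
qed

end

section \<open>Computing the instance\<close>

text \<open>The output does not depend on what \<open>r\<close> already contains, so pieces of
  output can be composed while \<open>E\<close> stays fixed.\<close>

definition emits :: "nat \<Rightarrow> regs \<Rightarrow> com \<Rightarrow> bool list \<Rightarrow> bool" where
  "emits r E c v \<longleftrightarrow> (\<forall>y. exec c (E(r := y)) = E(r := y @ v))"

primrec seq :: "com list \<Rightarrow> com" where
  "seq [] = Skip"
| "seq (c # cs) = Seq c (seq cs)"

abbreviation Loop :: "nat \<Rightarrow> com \<Rightarrow> com" where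
  "Loop j c \<equiv> For j c c"

definition word :: "nat \<Rightarrow> bool list \<Rightarrow> com" where
  "word r v = seq (map (Push r) v)"

lemma emits_Nil: "emits r E (seq []) []"
  by (simp add: emits_def)

lemma emits_Cons: "emits r E c v \<Longrightarrow> emits r E (seq cs) v' \<Longrightarrow> emits r E (seq (c # cs)) (v @ v')"
  by (simp add: emits_def)

lemma emits_Push: "emits r E (Push r b) [b]"
  by (simp add: emits_def)

lemma emits_word: "emits r E (word r v) v"
proof (induction v)
  case (Cons b v)
  then show ?case using emits_Cons[OF emits_Push, of r E "map (Push r) v" v b] by (simp add: word_def)
qed (simp add: word_def emits_Nil[simplified])

lemma emits_For:
  assumes "j \<noteq> r" "emits r E c v" "emits r E d v'"
  shows "emits r E (For j c d) (concat (map (\<lambda>b. if b then v' else v) (E j)))"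
proof -
  have "fold (\<lambda>b. if b then exec d else exec c) xs (E(r := y)) =
      E(r := y @ concat (map (\<lambda>b. if b then v' else v) xs))" for xs y
    using assms(2,3) by (induction xs arbitrary: y) (auto simp: emits_def)
  then show ?thesis using assms(1) by (simp add: emits_def)
qed

lemma emits_Loop:
  assumes "j \<noteq> r" "emits r E c v"
  shows "emits r E (Loop j c) (rep (length (E j)) v)"
  using emits_For[OF assms assms(2)] by (simp add: map_replicate_const)

lemma emits_seq_map: "(\<And>t. t \<in> set ts \<Longrightarrow> emits r E (c t) (f t)) \<Longrightarrow> emits r E (seq (map c ts)) (concat (map f ts))"
  by (induction ts) (auto simp: emits_Nil intro: emits_Cons[simplified] simp: emits_def)

lemma emitsD: "emits r E c v \<Longrightarrow> E r = y \<Longrightarrow> exec c E = E(r := y @ v)"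
  unfolding emits_def by (metis fun_upd_triv)

lemma emits_eq: "emits r E c v \<Longrightarrow> v = v' \<Longrightarrow> emits r E c v'"
  by simp

lemmas emits_intros = emits_Cons emits_Nil emits_Loop emits_For emits_word

lemma rep_rep: "rep m (rep n v) = rep (m * n) v"
  by (induction m) (auto simp: replicate_add)

lemma rep_add: "rep m v @ rep n v = rep (m + n) v"
  by (simp add: replicate_add)

lemma rep_snoc: "rep n v @ v = rep (Suc n) v" "rep n v @ v @ ys = rep (Suc n) v @ ys"
  using rep_add[of n v 1] by simp_all

lemma rep_append: "rep m v @ rep n v @ ys = rep (m + n) v @ ys"
  by (simp add: replicate_add)

lemma rep_single: "rep n [b] = replicate n b"
  by (induction n) auto

lemma rep_replicate: "rep m (replicate n b) = replicate (m * n) b"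
  using rep_rep[of m n "[b]"] by (simp add: rep_single)

lemma safe_seq: "safe R (seq cs) \<longleftrightarrow> (\<forall>c\<in>set cs. safe R c)"
  by (induction cs) auto

lemma polytime_seq: "(\<And>c. c \<in> set cs \<Longrightarrow> polytime c) \<Longrightarrow> polytime (seq cs)"
proof (induction cs)
  case Nil
  show ?case by (rule polytime_safe[of "{}"]) auto
qed (auto intro: polytime_Seq)

lemma uses_seq: "uses (seq cs) = (\<Union>c\<in>set cs. uses c)"
  by (induction cs) auto

lemma safe_word: "safe R (word r v) \<longleftrightarrow> r \<notin> R \<or> v = []"
  by (auto simp: word_def safe_seq)

lemma uses_word: "uses (word r v) \<subseteq> {r}"
  by (auto simp: word_def uses_seq)

lemma uses_wordD: "i \<in> uses (word r v) \<Longrightarrow> i = r"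
  using uses_word by blast

text \<open>Register \<open>7 + i\<close> receives the unary number \<open>C * u ^ i\<close>, where \<open>u\<close> is the number in register \<open>1\<close>.\<close>

fun powers :: "nat \<Rightarrow> nat \<Rightarrow> com" where
  "powers C 0 = word 7 (replicate C True)"
| "powers C (Suc i) = Seq (powers C i) (Loop (7 + i) (Loop 1 (word (8 + i) [True])))"

lemma exec_powers:
  assumes "\<And>j. j \<noteq> 0 \<Longrightarrow> j \<noteq> 1 \<Longrightarrow> \<rho> j = []"
  shows "exec (powers C i) \<rho> (7 + i) = replicate (C * length (\<rho> 1) ^ i) True \<and>
    (\<forall>j. j < 7 \<or> 7 + i < j \<longrightarrow> exec (powers C i) \<rho> j = \<rho> j)"
proof (induction i)
  case 0
  have "exec (word 7 (replicate C True)) \<rho> = \<rho>(7 := [] @ replicate C True)"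
    by (rule emitsD[OF emits_word]) (simp add: assms)
  then show ?case by simp
next
  case (Suc i)
  let ?\<rho> = "exec (powers C i) \<rho>"
  have "emits (8 + i) ?\<rho> (Loop (7 + i) (Loop 1 (word (8 + i) [True])))
      (rep (length (?\<rho> (7 + i))) (rep (length (?\<rho> 1)) [True]))"
    by (intro emits_Loop emits_word) auto
  note e = emitsD[OF this]
  have "?\<rho> (8 + i) = []" and one: "?\<rho> 1 = \<rho> 1" using Suc assms by auto
  from e[OF this(1)]
  have "exec (powers C (Suc i)) \<rho> = ?\<rho>(8 + i := [] @ rep (length (?\<rho> (7 + i))) (rep (length (\<rho> 1)) [True]))"
    unfolding one by (simp only: powers.simps exec.simps(4))
  moreover have "rep (length (?\<rho> (7 + i))) (rep (length (\<rho> 1)) [True]) = replicate (C * length (\<rho> 1) ^ Suc i) True"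
    unfolding rep_single rep_replicate using Suc by (simp add: algebra_simps)
  ultimately have "exec (powers C (Suc i)) \<rho> = ?\<rho>(8 + i := replicate (C * length (\<rho> 1) ^ Suc i) True)"
    by (simp only: append_Nil)
  then show ?case using Suc by (simp del: powers.simps)
qed

text \<open>Each stage loops over the register that the preceding stage has written, so every stage
  has its own set of loop registers and \<open>polytime_Seq\<close> joins them.\<close>

lemma polytime_powers: "polytime (powers C i)"
proof (induction i)
  case 0
  have "safe {} (powers C 0)" by (simp add: safe_word)
  then show ?case using polytime_safe by blast
next
  case (Suc i)
  have "safe {7 + i, 1} (Loop (7 + i) (Loop 1 (word (8 + i) [True])))"
    by (auto simp: safe_word dest!: uses_wordD)
  then have "polytime (Loop (7 + i) (Loop 1 (word (8 + i) [True])))" by (intro polytime_safe[of "{7 + i, 1}"]) auto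
  then show ?case using Suc by (simp add: polytime_Seq)
qed

lemma uses_powers: "uses (powers C i) \<subseteq> {..7 + i}"
  by (induction i) (auto dest!: uses_wordD)

context reduction
begin

text \<open>Register \<open>0\<close> holds the input \<open>x\<close>, \<open>7 + k\<close> the number \<open>a\<close>, \<open>3\<close> the number \<open>width a x - 2\<close>, \<open>5\<close> the
  number \<open>area a x\<close>, \<open>4\<close> and \<open>6\<close> the numbers of cells before and after the current one; the code goes to \<open>8 + k\<close>.\<close>

abbreviation out :: "nat \<Rightarrow> bool list \<Rightarrow> com" where
  "out k \<equiv> word (8 + k)"

text \<open>Register 3 is shorter than the width by 2, the count needed in \<open>item_code\<close>;
  hence the additional copies after the loops over it.\<close>

definition plus_com :: "nat \<Rightarrow> com" where
  "plus_com k = seq [out k plus_first, Loop (7 + k) (out k (plus_bottom cell)), out k (plus_bottom ctl),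
     For 0 (out k (plus_bottom (sym False))) (out k (plus_bottom (sym True))),
     Loop (7 + k) (out k (plus_bottom cell)),
     Loop (7 + k) (seq [Loop 3 (out k plus_inner), out k plus_inner, out k plus_inner]),
     out k plus_after, Loop 3 (out k plus_top), out k plus_top, out k (end_word \<beta> 1)]"

definition minus_com :: "nat \<Rightarrow> com" where
  "minus_com k = seq [Loop 5 (out k minus_word), Loop 3 (out k minus_word), out k minus_word,
     out k minus_word, out k (end_word \<beta> 1)]"

definition item_com :: "nat \<Rightarrow> tile \<Rightarrow> com" where
  "item_com k t = seq [Loop 4 (out k zero_word), out k (lower_word t), out k (right_word t),
     Loop 3 (out k zero_word), out k (upper_word t), Loop 6 (out k zero_word),
     out k (end_word \<beta> 0)]"

text \<open>Cells are visited in decreasing order, moving one unit per round from the count of cells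
  before to the count of cells after. The sum of both counts never grows, so both may control loops
  inside this loop.\<close>

definition items_com :: "nat \<Rightarrow> com" where
  "items_com k = Loop 5 (Seq (seq (map (item_com k) ts)) (Transfer 4 6))"

definition dummies_com :: "nat \<Rightarrow> com" where
  "dummies_com k = Loop 5 (seq (map (\<lambda>_. seq [Loop 6 (out k zero_word), out k zero_word,
     Loop 3 (out k zero_word), out k zero_word, out k zero_word, out k (end_word \<beta> 0)]) ts))"

definition unary_com :: com where
  "unary_com = seq [Loop 0 (word 1 [True]), word 1 [True]]"

definition width_com :: "nat \<Rightarrow> com" where
  "width_com k = seq [Loop (7 + k) (word 3 [True, True]), Loop 0 (word 3 [True])]"

text \<open>\<open>a\<close> full rows and a last row without one cell: register 4 needs
  \<open>area a x - 1\<close>, and register 5 gets one more bit afterwards.\<close>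

definition area_com :: "nat \<Rightarrow> nat \<Rightarrow> com" where
  "area_com k r = seq [Loop (7 + k) (seq [Loop 3 (word r [True]), word r [True, True]]), Loop 3 (word r [True]), word r [True]]"

definition instance_com :: "nat \<Rightarrow> com" where
  "instance_com k = seq [plus_com k, minus_com k, items_com k, dummies_com k]"

definition program :: "nat \<Rightarrow> nat \<Rightarrow> com" where
  "program C k = seq [unary_com, powers C k, width_com k, area_com k 4, Seq (area_com k 5) (word 5 [True]),
     instance_com k]"

text \<open>A register is filled in one phase and controls loops in later ones, so each phase is
  safe for a different set.\<close>

lemma polytime_program: "polytime (program C k)"
proof -
  have "safe {0} unary_com" by (auto simp: unary_com_def safe_word dest!: uses_wordD)
  then have 1: "polytime unary_com" by (intro polytime_safe) auto
  have "safe {0, 7 + k} (width_com k)" by (auto simp: width_com_def safe_word dest!: uses_wordD)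
  then have 2: "polytime (width_com k)" by (intro polytime_safe) auto
  have "safe {3, 7 + k} (area_com k r)" if "r = 4 \<or> r = 5" for r
    using that by (auto simp: area_com_def safe_word dest!: uses_wordD)
  then have 3: "polytime (area_com k r)" if "r = 4 \<or> r = 5" for r
    using that by (intro polytime_safe[of "{3, 7 + k}"]) auto
  have 4: "polytime (word 5 [True])" by (rule polytime_safe[of "{}"]) (auto simp: safe_word)
  have "safe {0, 3, 4, 5, 6, 7 + k} (instance_com k)"
    by (auto simp: instance_com_def plus_com_def minus_com_def items_com_def item_com_def dummies_com_def safe_seq
        uses_seq safe_word dest!: uses_wordD)
  then have 5: "polytime (instance_com k)" by (intro polytime_safe) auto
  show ?thesis
    unfolding program_def by (rule polytime_seq) (use 1 2 3 4 5 polytime_powers polytime_Seq in auto)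
qed

lemma uses_program: "uses (program C k) \<subseteq> {..8 + k}"
  using uses_powers[of C k]
  by (auto simp: program_def instance_com_def unary_com_def width_com_def area_com_def plus_com_def minus_com_def items_com_def item_com_def
      dummies_com_def uses_seq dest!: uses_wordD)

lemma emits_plus:
  assumes "length (E (7 + k)) = a" "E 0 = x" "length (E 3) = width a x - 2"
  shows "emits (8 + k) E (plus_com k) (plus_code a x)"
proof -
  have W: "width a x = length (E 3) + 2" using assms(3) by (simp add: width_def)
  have eq: "(\<lambda>b. if b then plus_bottom (sym True) else plus_bottom (sym False)) = (\<lambda>b. plus_bottom (sym b))"
    by (rule ext) simp
  show ?thesis
    unfolding plus_com_def plus_code_def
    by (rule emits_eq, (rule emits_intros | simp; fail)+)
      (simp add: W rep_snoc rep_rep eq assms(1,2) flip: replicate_Suc)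
qed

lemma emits_minus:
  assumes "length (E 5) = area a x" "length (E 3) = width a x - 2"
  shows "emits (8 + k) E (minus_com k) (minus_code a x)"
proof -
  have W: "width a x = length (E 3) + 2" using assms(2) by (simp add: width_def)
  show ?thesis
    unfolding minus_com_def minus_code_def W assms(1)[symmetric]
    by (rule emits_eq, (rule emits_intros | simp; fail)+) (simp add: rep_snoc rep_append flip: replicate_Suc)
qed

lemma emits_item:
  "emits (8 + k) E (item_com k t) (item_code (length (E 3)) (length (E 4)) (length (E 6)) t)"
  unfolding item_com_def item_code_def
  by (rule emits_eq, (rule emits_intros | simp; fail)+)

lemma exec_items:
  assumes "E 4 = replicate n True" "E 6 = []" "length (E 5) = Suc n"
  shows "exec (items_com k) E = E(4 := [], 6 := replicate n True,
    8 + k := E (8 + k) @ concat (map (\<lambda>c. concat (map (item_code (length (E 3)) c (n - c)) ts)) (rev [0..<Suc n])))"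
proof -
  let ?v = "length (E 3)"
  let ?body = "Seq (seq (map (item_com k) ts)) (Transfer 4 6)"
  let ?st = "\<lambda>i j y. E(4 := replicate i True, 6 := replicate j True, 8 + k := y)"
  have butlast_rep: "butlast (replicate (Suc i) True) = replicate i True" for i
    by (simp flip: replicate_append_same)
  have snoc: "replicate j True @ [True] = replicate (Suc j) True" for j
    by (simp add: replicate_append_same)
  have body: "exec ?body (?st i j y) = ?st (i - 1) (if i = 0 then j else Suc j) (y @ concat (map (item_code ?v i j) ts))" for i j y
  proof -
    have "emits (8 + k) (?st i j y) (seq (map (item_com k) ts)) (concat (map (item_code ?v i j) ts))"
      using emits_item[of k "?st i j y"] by (intro emits_seq_map) simp
    then have "exec (seq (map (item_com k) ts)) (?st i j y) = (?st i j y)(8 + k := y @ concat (map (item_code ?v i j) ts))"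
      by (rule emitsD) simp
    then have "exec (seq (map (item_com k) ts)) (?st i j y) = ?st i j (y @ concat (map (item_code ?v i j) ts))"
      by simp
    then show ?thesis
      using butlast_rep by (cases i) (auto simp: fun_eq_iff snoc simp del: replicate_Suc)
  qed
  define F where "F = exec ?body"
  define st where "st = ?st"
  have F: "F (st i j y) = st (i - 1) (if i = 0 then j else Suc j) (y @ concat (map (item_code ?v i j) ts))" for i j y
    unfolding F_def st_def by (rule body)
  \<comment> \<open>With \<open>i\<close> cells before and \<open>j\<close> cells after the current
    one, \<open>Suc i\<close> rounds remain. In the last of them the transfer finds register 4 empty
    and does nothing.\<close>
  have loop: "fold (\<lambda>_. F) ys (st i j y) =
      st 0 (j + i) (y @ concat (map (\<lambda>c. concat (map (item_code ?v c (j + i - c)) ts)) (rev [0..<Suc i])))"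
    if "length ys = Suc i" for ys :: "bool list" and i j y
    using that
  proof (induction i arbitrary: ys j y)
    case 0
    then obtain b where "ys = [b]" by (auto simp: length_Suc_conv)
    then show ?case using F[of 0 j y] by simp
  next
    case (Suc i)
    then obtain b ys' where ys: "ys = b # ys'" "length ys' = Suc i" by (auto simp: length_Suc_conv)
    have "fold (\<lambda>_. F) ys (st (Suc i) j y) =
        fold (\<lambda>_. F) ys' (st i (Suc j) (y @ concat (map (item_code ?v (Suc i) j) ts)))"
      unfolding ys fold_simps F by simp
    also have "\<dots> = st 0 (Suc j + i) ((y @ concat (map (item_code ?v (Suc i) j) ts)) @
        concat (map (\<lambda>c. concat (map (item_code ?v c (Suc j + i - c)) ts)) (rev [0..<Suc i])))"
      by (rule Suc.IH[OF ys(2)])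
    finally show ?case by simp
  qed
  have "exec (items_com k) E = fold (\<lambda>_. F) (E 5) E"
    unfolding items_com_def exec.simps(5) F_def by (simp only: if_cancel)
  also have "E = st n 0 (E (8 + k))" using assms by (auto simp: st_def fun_eq_iff)
  then have "fold (\<lambda>_. F) (E 5) E = fold (\<lambda>_. F) (E 5) (st n 0 (E (8 + k)))" by simp
  also have "\<dots> = st 0 (0 + n) (E (8 + k) @ concat (map (\<lambda>c. concat (map (item_code ?v c (0 + n - c)) ts)) (rev [0..<Suc n])))"
    by (rule loop[OF assms(3)])
  finally show ?thesis by (simp add: st_def)
qed

lemma emits_dummies:
  assumes "length (E 5) = area a x" "length (E 3) = width a x - 2" "length (E 6) = area a x - 1"
  shows "emits (8 + k) E (dummies_com k) (rep (area a x) (rep (length ts) (dummy_code a x)))"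
proof -
  let ?c = "seq [Loop 6 (out k zero_word), out k zero_word,
     Loop 3 (out k zero_word), out k zero_word, out k zero_word, out k (end_word \<beta> 0)]"
  have W: "area a x + width a x = length (E 6) + 1 + length (E 3) + 2"
    using assms(2,3) by (simp add: width_def area_def)
  have "emits (8 + k) E ?c (dummy_code a x)"
    unfolding dummy_code_def W
    by (rule emits_eq, (rule emits_intros | simp; fail)+) (simp add: rep_snoc rep_append flip: replicate_Suc)
  then have "emits (8 + k) E (seq (map (\<lambda>_. ?c) ts)) (concat (map (\<lambda>_. dummy_code a x) ts))"
    by (intro emits_seq_map)
  then have "emits (8 + k) E (dummies_com k) (rep (length (E 5)) (concat (map (\<lambda>_. dummy_code a x) ts)))"
    unfolding dummies_com_def by (intro emits_Loop) auto
  then show ?thesis by (simp add: assms(1) map_replicate_const)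
qed

lemma exec_instance:
  assumes "length (E (7 + k)) = a" "E 0 = x" "length (E 3) = width a x - 2" "E 4 = replicate (area a x - 1) True"
    "length (E 5) = area a x" "E 6 = []" "E (8 + k) = []"
  shows "exec (instance_com k) E (8 + k) = code_of a x"
proof -
  have area: "length (E 5) = Suc (area a x - 1)" using assms(5) by (simp add: area_def width_def)
  have e1: "exec (plus_com k) E = E(8 + k := [] @ plus_code a x)" (is "_ = ?E1")
    by (rule emitsD[OF emits_plus]) (use assms in auto)
  have e2: "exec (minus_com k) ?E1 = ?E1(8 + k := ([] @ plus_code a x) @ minus_code a x)" (is "_ = ?E2")
    by (rule emitsD[OF emits_minus]) (use assms in auto)
  have e3: "exec (items_com k) ?E2 = ?E2(4 := [], 6 := replicate (area a x - 1) True, 8 + k := ?E2 (8 + k) @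
      concat (map (\<lambda>c. concat (map (item_code (length (?E2 3)) c (area a x - 1 - c)) ts)) (rev [0..<Suc (area a x - 1)])))"
    (is "_ = ?E3")
    by (rule exec_items) (use assms area in auto)
  have "emits (8 + k) ?E3 (dummies_com k) (rep (area a x) (rep (length ts) (dummy_code a x)))"
    by (rule emits_dummies) (use assms in auto)
  then have e4: "exec (dummies_com k) ?E3 = ?E3(8 + k := ?E3 (8 + k) @ rep (area a x) (rep (length ts) (dummy_code a x)))"
    by (rule emitsD) simp
  have "Suc (area a x - 1) = area a x" by (simp add: area_def width_def)
  then show ?thesis
    unfolding instance_com_def seq.simps exec.simps(1,4) e1 e2 e3 e4 by (simp add: code_of_def assms(3))
qed

lemma exec_area:
  assumes "length (E (7 + k)) = a" "length (E 3) = width a x - 2" "E r = []" "r = 4 \<or> r = 5"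
  shows "exec (area_com k r) E = E(r := replicate (area a x - 1) True)"
proof -
  have "emits r E (area_com k r) (rep (length (E (7 + k))) (rep (length (E 3)) [True] @ [True, True] @ []) @
      rep (length (E 3)) [True] @ [True] @ [])"
    unfolding area_com_def by (intro emits_intros) (use assms(4) in auto)
  then have "exec (area_com k r) E = E(r := [] @ rep (length (E (7 + k))) (rep (length (E 3)) [True] @ [True, True] @ []) @
      rep (length (E 3)) [True] @ [True] @ [])"
    by (rule emitsD) (rule assms(3))
  also have "rep (length (E 3)) [True] @ [True, True] @ [] = replicate (width a x) True"
    using assms(2) rep_add[of "length (E 3)" "[True]" 2] by (simp add: rep_single numeral_2_eq_2 width_def)
  also have "rep (length (E (7 + k))) (replicate (width a x) True) = replicate (a * width a x) True"
    unfolding rep_replicate assms(1) ..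
  also have "[] @ replicate (a * width a x) True @ rep (length (E 3)) [True] @ [True] @ [] = replicate (area a x - 1) True"
  proof -
    have "area a x - 1 = a * width a x + (length (E 3) + 1)" using assms(2) by (simp add: area_def width_def)
    moreover have "replicate m True @ replicate n True @ [True] = replicate (m + (n + 1)) True" for m n
      unfolding replicate_add by simp
    ultimately show ?thesis by (simp only: rep_single append_Nil append_Nil2)
  qed
  finally show ?thesis .
qed

lemma exec_program:
  "exec (program C k) ((\<lambda>_. [])(0 := x)) (8 + k) = code_of (C * (length x + 1) ^ k) x"
proof -
  let ?a = "C * (length x + 1) ^ k"
  define E0 :: regs where "E0 = (\<lambda>_. [])(0 := x)"
  define E1 where "E1 = exec unary_com E0"
  define E2 where "E2 = exec (powers C k) E1"
  define E3 where "E3 = exec (width_com k) E2"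
  define E4 where "E4 = exec (area_com k 4) E3"
  define E5 where "E5 = exec (area_com k 5) E4"
  define E6 where "E6 = exec (word 5 [True]) E5"
  have "emits 1 E0 unary_com (rep (length (E0 0)) [True] @ [True] @ [])"
    unfolding unary_com_def by (intro emits_intros) auto
  then have "E1 = E0(1 := [] @ rep (length (E0 0)) [True] @ [True] @ [])"
    unfolding E1_def by (rule emitsD) (simp add: E0_def)
  then have s1: "E1 = E0(1 := replicate (length x + 1) True)"
    by (simp add: E0_def rep_single replicate_append_same)
  have s2: "E2 (7 + k) = replicate ?a True" "\<And>j. j < 7 \<or> 7 + k < j \<Longrightarrow> E2 j = E1 j"
    using exec_powers[of E1 C k] unfolding E2_def by (auto simp: s1 E0_def)
  have "emits 3 E2 (width_com k) (rep (length (E2 (7 + k))) [True, True] @ rep (length (E2 0)) [True] @ [])"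
    unfolding width_com_def by (intro emits_intros) auto
  then have "E3 = E2(3 := [] @ rep (length (E2 (7 + k))) [True, True] @ rep (length (E2 0)) [True] @ [])"
    unfolding E3_def by (rule emitsD) (simp add: s2 s1 E0_def)
  moreover have "rep n [True, True] = replicate (2 * n) True" for n by (induction n) auto
  ultimately have s3: "E3 = E2(3 := replicate (width ?a x - 2) True)"
    by (simp add: s2 s1 E0_def rep_single width_def replicate_add)
  have s4: "E4 = E3(4 := replicate (area ?a x - 1) True)"
    unfolding E4_def by (rule exec_area) (simp_all add: s3 s2 s1 E0_def)
  have s5: "E5 = E4(5 := replicate (area ?a x - 1) True)"
    unfolding E5_def by (rule exec_area) (simp_all add: s4 s3 s2 s1 E0_def)
  have "E6 = E5(5 := replicate (area ?a x - 1) True @ [True])"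
    unfolding E6_def by (rule emitsD[OF emits_word]) (simp add: s5)
  moreover have "area ?a x - 1 + 1 = area ?a x" by (simp add: area_def width_def)
  ultimately have s6: "E6 = E5(5 := replicate (area ?a x) True)"
    by (metis replicate_add replicate_0 replicate_Suc One_nat_def)
  have "exec (program C k) E0 = exec (instance_com k) E6"
    unfolding program_def E6_def E5_def E4_def E3_def E2_def E1_def by (simp only: seq.simps exec.simps(1,4))
  moreover have "exec (instance_com k) E6 (8 + k) = code_of ?a x"
    by (rule exec_instance) (simp_all add: s6 s5 s4 s3 s2 s1 E0_def)
  ultimately show ?thesis by (simp add: E0_def)
qed

lemma polytime_computable_code: "polytime_computable (\<lambda>x. code_of (C * (length x + 1) ^ k) x)"
  using polytime_computable_exec[OF polytime_program uses_program, of C k] by (simp add: exec_program)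

end

section \<open>NP-hardness\<close>

text \<open>A bound of this form can be written down in unary by repeated multiplication, as
  \<open>powers\<close> does.\<close>

lemma poly_nat_bound: "\<exists>C k. \<forall>n. poly (p :: nat poly) n \<le> C * (n + 1) ^ k"
proof (induction p)
  case (pCons c p)
  then obtain C k where Ck: "\<And>n. poly p n \<le> C * (n + 1) ^ k" by blast
  have "poly (pCons c p) n \<le> (c + C) * (n + 1) ^ Suc k" for n
  proof -
    have "n * poly p n \<le> (n + 1) * (C * (n + 1) ^ k)" using Ck by (intro mult_le_mono) auto
    moreover have "c * 1 \<le> c * (n + 1) ^ Suc k" using one_le_power[of "n + 1" "Suc k"] by (intro mult_le_mono2) simp
    ultimately show ?thesis by (simp add: algebra_simps)
  qed
  then show ?case by blast
qed simp

theorem theorem26: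
  fixes \<F> :: "nat sgraph set"
  assumes "\<forall>G\<in>\<F>. simple_graph G \<and> bipartite G"
    and "\<forall>G. is_path G \<longrightarrow> G \<in> \<F>"
  shows "NP_hard encode_seq {d. degree_sequence d}
    (\<lambda>d. \<exists>H. realization H d \<and> underlying H \<in> \<F>)"
  unfolding NP_hard_def
proof
  fix L assume "L \<in> NP"
  then obtain S :: "tile set" and wall cell ctl :: nat and sym :: "bool \<Rightarrow> nat" and p :: "nat poly" where
    S: "finite S" "3 \<le> card S" and L: "\<And>x a. poly p (length x) + 2 \<le> a \<Longrightarrow>
      x \<in> L \<longleftrightarrow> (\<exists>\<theta>. tiling 0 0 S (2 * a + length x + 2) (Suc a * (2 * a + length x + 2))
         (wall # replicate a cell @ ctl # map sym x @ replicate a cell) \<theta>)"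
    using NP_tiling by metis
  define cs where "cs = west ` S \<union> south ` S \<union> east ` S \<union> north ` S \<union> {wall, cell, ctl, sym True, sym False}"
  define K where "K = Suc (Max cs)"
  have "finite cs" using S(1) by (simp add: cs_def)
  then have K: "c < K" if "c \<in> cs" for c using that by (simp add: K_def le_imp_less_Suc)
  \<comment> \<open>As \<open>n < 2 ^ n\<close>, the required lower bound for the base can itself
    serve as the exponent.\<close>
  define \<beta> where "\<beta> = 4 * K * card S + 4 * K + 2 * card S + 3"
  define key where "key t = north t * (2 ^ \<beta>) ^ 4 + east t * (2 ^ \<beta>) ^ 3 + (K - south t) * 2 ^ \<beta> + (K - west t)" for t :: tile
  \<comment> \<open>The tiles are sorted here, once for the language; the program contains the
    sorted list.\<close>
  obtain us where us: "set us = S" "distinct us" using finite_distinct_list[OF S(1)] by blast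
  define ts where "ts = rev (sort_key key us)"
  have sorted: "sorted_wrt (\<lambda>t t'. key t' \<le> key t) ts"
    using sorted_sort_key[of key us] unfolding ts_def sorted_wrt_rev sorted_map by simp
  interpret reduction S K \<beta> ts wall cell ctl sym
  proof
    show "west t < K \<and> south t < K \<and> east t < K \<and> north t < K" if "t \<in> S" for t
      by (intro conjI K) (use that in \<open>auto simp: cs_def simp del: split_paired_All\<close>)
    show "sym b < K" for b by (cases b) (auto intro: K simp: cs_def)
    show "4 * K * card S + 4 * K + 2 * card S + 3 \<le> 2 ^ \<beta>"
      unfolding \<beta>_def by (rule less_imp_le[OF less_exp])
  qed (use S us sorted in \<open>simp_all add: K cs_def ts_def key_def\<close>)
  \<comment> \<open>The added 2 is the margin by which \<open>a\<close> has to exceed the time bound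
    in \<open>L\<close>.\<close>
  obtain C k where Ck: "\<And>n. poly (p + [:2:]) n \<le> C * (n + 1) ^ k" using poly_nat_bound[of "p + [:2:]"] by blast
  define a where "a x = C * (length x + 1) ^ k" for x :: "bool list"
  define f where "f x = gadget_bits.degs S K (width (a x) x) (area (a x) x) (2 ^ \<beta>) (bottom_colours (a x) x) ts" for x
  have "f x \<in> {d. degree_sequence d} \<and> (x \<in> L \<longleftrightarrow> (\<exists>H. realization H (f x) \<and> underlying H \<in> \<F>))" for x
  proof -
    interpret gadget_bits S K "width (a x) x" "area (a x) x" "2 ^ \<beta>" "bottom_colours (a x) x" \<beta> ts by (rule gadget)
    have f: "f x = degs" by (simp add: f_def)
    have "poly p (length x) + 2 \<le> a x" using Ck[of "length x"] by (simp add: a_def)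
    then have "x \<in> L \<longleftrightarrow> (\<exists>\<theta>. tiling 0 0 S (width (a x) x) (area (a x) x) (bottom_colours (a x) x) \<theta>)"
      unfolding area_def width_def bottom_colours_def by (rule L)
    then show ?thesis
      using degree_sequence_degs realizable_iff_tiling[OF assms sorted_degs mset_degs] by (simp add: f)
  qed
  moreover have "polytime_computable (\<lambda>x. encode_seq (f x))"
    using polytime_computable_code[of C k] by (simp add: f_def encode_degs a_def)
  ultimately show "\<exists>f. polytime_computable (\<lambda>x. encode_seq (f x)) \<and>
      (\<forall>x. f x \<in> {d. degree_sequence d} \<and> (x \<in> L \<longleftrightarrow> (\<exists>H. realization H (f x) \<and> underlying H \<in> \<F>)))"
    by blast
qed

end
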